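(* Let $n\ge 1$ and let $A$ and $B$ be two complex $n\times n$ matrices such that $A$ is normal and $\|B\|=1$, where $\|\cdot\|$ is the operator norm induced by the Euclidean norm on $\mathbb{C}^n$. Suppose that $$\sigma_p(A,B,AB)=\{(x,y,z)\in\mathbb{C}^3: x^n+y^n+(-1)^{n-1}z^n=1\}.$$ Then: 1) The matrices $A$ and $B$ are unitary, and the spectra $\sigma(A)$ and $\sigma(B)$ each consist of the $n$-th roots of unity, each of multiplicity $1$. 2) If $e_0,\dots,e_{n-1}$ and $\zeta_0,\dots,\zeta_{n-1}$ are orthonormal eigenbases for $A$ and $B$ respectively, such that $Ae_j=e^{2\pi j i/n}e_j$ and $B\zeta_j=e^{2\pi j i/n}\zeta_j$ for $j=0,\dots,n-1$, then $\sqrt{n}$ times the transition matrix from the basis $\{e_0,\dots,e_{n-1}\}$ to the basis $\{\zeta_0,\dots,\zeta_{n-1}\}$ is a complex Hadamard matrix. Moreover, if $n=3,4$ or $5$, then the pair $(A,B)$ is unitarily equivalent to a Hadamard pair of Fourier type.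
   Context: For bounded operators (or square matrices) $A_1,\dots,A_k$ on a complex Hilbert space, the proper projective joint spectrum is $\sigma_p(A_1,\dots,A_k)=\{(x_1,\dots,x_k)\in\mathbb{C}^k: x_1A_1+\dots+x_kA_k-I \text{ is not invertible}\}$. A complex Hadamard matrix of order $n$ is an $n\times n$ complex matrix all of whose entries have modulus one and whose rows are mutually orthogonal. The Fourier matrix is $F_n=[e^{2\pi i(k-1)(j-1)/n}]_{j,k=1}^n$. Two Hadamard matrices $h_1,h_2$ of order $n$ are similar if $h_2=\Lambda_1P_1h_1P_2\Lambda_2$ with $\Lambda_1,\Lambda_2$ diagonal matrices with unimodular diagonal entries and $P_1,P_2$ permutation matrices. A Hadamard matrix is of Fourier type (F-type) if it is similar to $F_n$. The transition matrix from $\{e_r\}$ to $\{\zeta_j\}$ is the matrix $C$ whose $r$-th column ($r=0,\dots,n-1$) is $(c_{r0},\dots,c_{r\,n-1})^{T}$, where $e_r=\sum_{j=0}^{n-1}c_{rj}\zeta_j$. Let $D_n=\mathrm{diag}(1,e^{2\pi i/n},\dots,e^{2\pi i(n-1)/n})$. A Hadamard pair of Fourier type is a pair $(D_n,\frac1n h^*D_nh)$ with $h$ a complex Hadamard matrix of order $n$ that is similar to $F_n$. Pairs $(A,B)$ and $(A',B')$ are unitarily equivalent if there is a single unitary $U$ with $A'=U^*AU$ and $B'=U^*BU$. *)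

theory Defs
  imports
    "Jordan_Normal_Form.Spectral_Radius"
    "Jordan_Normal_Form.Schur_Decomposition"
    "HOL-Combinatorics.Permutations"
begin

definition normal_mat :: "complex mat \<Rightarrow> bool" where
  "normal_mat A \<longleftrightarrow> square_mat A \<and> A * mat_adjoint A = mat_adjoint A * A"

definition unitary_mat :: "nat \<Rightarrow> complex mat \<Rightarrow> bool" where
  "unitary_mat n U \<longleftrightarrow>
     U \<in> carrier_mat n n \<and> mat_adjoint U * U = 1\<^sub>m n \<and> U * mat_adjoint U = 1\<^sub>m n"

definition euclidean_norm :: "complex vec \<Rightarrow> real" where
  "euclidean_norm v = sqrt (\<Sum>i<dim_vec v. (cmod (v $ i))\<^sup>2)"

definition operator_norm :: "complex mat \<Rightarrow> real" where
  "operator_norm A =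
     (SUP v\<in>{v \<in> carrier_vec (dim_col A). euclidean_norm v \<le> 1}. euclidean_norm (A *\<^sub>v v))"

text \<open>Points of the \<open>k\<close>-dimensional complex space are lists of length \<open>k\<close>. The linear combination
  is a \<open>foldr\<close> because matrices with a dimension carrier are not in class \<^class>\<open>monoid_add\<close>.\<close>

definition matrix_pencil :: "nat \<Rightarrow> complex list \<Rightarrow> complex mat list \<Rightarrow> complex mat" where
  "matrix_pencil n xs As = foldr (+) (map2 (\<cdot>\<^sub>m) xs As) (0\<^sub>m n n) - 1\<^sub>m n"

definition proper_joint_spectrum :: "nat \<Rightarrow> complex mat list \<Rightarrow> complex list set" where
  "proper_joint_spectrum n As =
     {xs. length xs = length As \<and> \<not> invertible_mat (matrix_pencil n xs As)}"

lemma matrix_pencil_triple: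
  assumes "A \<in> carrier_mat n n" "B \<in> carrier_mat n n" "C \<in> carrier_mat n n"
  shows "matrix_pencil n [x, y, z] [A, B, C] = x \<cdot>\<^sub>m A + y \<cdot>\<^sub>m B + z \<cdot>\<^sub>m C - 1\<^sub>m n"
  using assms by (simp add: matrix_pencil_def assoc_add_mat[of _ n n])

definition complex_hadamard :: "nat \<Rightarrow> complex mat \<Rightarrow> bool" where
  "complex_hadamard n h \<longleftrightarrow>
     h \<in> carrier_mat n n \<and>
     (\<forall>i<n. \<forall>j<n. cmod (h $$ (i, j)) = 1) \<and>
     (\<forall>i<n. \<forall>j<n. i \<noteq> j \<longrightarrow> row h i \<bullet>c row h j = 0)"

definition fourier_mat :: "nat \<Rightarrow> complex mat" where
  "fourier_mat n = mat n n (\<lambda>(j, k). cis (2 * pi * real (k * j) / real n))"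

definition unimodular_diagonal_mat :: "nat \<Rightarrow> complex mat \<Rightarrow> bool" where
  "unimodular_diagonal_mat n L \<longleftrightarrow>
     L \<in> carrier_mat n n \<and> diagonal_mat L \<and> (\<forall>i<n. cmod (L $$ (i, i)) = 1)"

definition permutation_mat :: "nat \<Rightarrow> complex mat \<Rightarrow> bool" where
  "permutation_mat n P \<longleftrightarrow>
     (\<exists>p. p permutes {..<n} \<and> P = mat n n (\<lambda>(i, j). if j = p i then 1 else 0))"

definition hadamard_similar :: "nat \<Rightarrow> complex mat \<Rightarrow> complex mat \<Rightarrow> bool" where
  "hadamard_similar n h1 h2 \<longleftrightarrow>
     (\<exists>L1 P1 P2 L2.
        unimodular_diagonal_mat n L1 \<and> unimodular_diagonal_mat n L2 \<and>
        permutation_mat n P1 \<and> permutation_mat n P2 \<and>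
        h2 = L1 * P1 * h1 * P2 * L2)"

definition fourier_type :: "nat \<Rightarrow> complex mat \<Rightarrow> bool" where
  "fourier_type n h \<longleftrightarrow> complex_hadamard n h \<and> hadamard_similar n (fourier_mat n) h"

definition D_mat :: "nat \<Rightarrow> complex mat" where
  "D_mat n = mat n n (\<lambda>(i, j). if i = j then cis (2 * pi * real i / real n) else 0)"

definition fourier_hadamard_pair :: "nat \<Rightarrow> complex mat \<times> complex mat \<Rightarrow> bool" where
  "fourier_hadamard_pair n AB \<longleftrightarrow>
     (\<exists>h. fourier_type n h \<and>
        AB = (D_mat n, (1 / of_nat n) \<cdot>\<^sub>m (mat_adjoint h * D_mat n * h)))"

definition unitarily_equivalent_pairs ::
  "nat \<Rightarrow> complex mat \<times> complex mat \<Rightarrow> complex mat \<times> complex mat \<Rightarrow> bool" where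
  "unitarily_equivalent_pairs n AB AB' \<longleftrightarrow>
     (\<exists>U. unitary_mat n U \<and>
        fst AB' = mat_adjoint U * fst AB * U \<and> snd AB' = mat_adjoint U * snd AB * U)"

text \<open>A family of \<open>n\<close> orthonormal vectors of length \<open>n\<close> automatically spans.\<close>

definition orthonormal_basis :: "nat \<Rightarrow> (nat \<Rightarrow> complex vec) \<Rightarrow> bool" where
  "orthonormal_basis n e \<longleftrightarrow>
     (\<forall>i<n. e i \<in> carrier_vec n) \<and>
     (\<forall>i<n. \<forall>j<n. e i \<bullet>c e j = (if i = j then 1 else 0))"

text \<open>Column \<open>r\<close> holds the coordinates of \<open>e r\<close> with respect to \<open>\<zeta>\<close>; the matrix is determined
  uniquely whenever \<open>\<zeta>\<close> is a basis.\<close>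

definition transition_mat ::
  "nat \<Rightarrow> (nat \<Rightarrow> complex vec) \<Rightarrow> (nat \<Rightarrow> complex vec) \<Rightarrow> complex mat" where
  "transition_mat n e \<zeta> =
     (THE C. C \<in> carrier_mat n n \<and>
        (\<forall>r<n. e r = finsum_vec TYPE(complex) n (\<lambda>j. C $$ (j, r) \<cdot>\<^sub>v \<zeta> j) {..<n}))"

end

theory Submission
  imports Defs
begin

text \<open>Fix a point \<open>(x, y, z)\<close> at which \<open>q = x^n + y^n + (-1)^(n-1) z^n\<close> does not vanish. The line through it
meets the hypersurface in the \<open>n\<close> distinct points with parameter \<open>t\<close> satisfying \<open>t^n q = 1\<close>, so
\<open>M = x A + y B + z A B\<close> has the \<open>n\<close> distinct eigenvalues \<open>\<mu>\<close> with \<open>\<mu>^n = q\<close>, its characteristic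
polynomial is \<open>X^n - q\<close>, and \<open>M^n = q\<close> (\<open>char_poly_pencil\<close>, \<open>pow_mat_of_char_poly\<close>). In particular
\<open>A^n = B^n = 1\<close>. A normal matrix with unimodular eigenvalues is unitary, and a contraction of finite
order is an isometry; this settles the first part.

Let \<open>\<omega>\<^sub>j\<close> be the \<open>n\<close>-th roots of unity and \<open>c\<^sub>k\<^sub>l\<close> the inner products of the two eigenbases. The
determinant of \<open>u + v A + y B + z A B\<close>, written in these bases, says that
\<open>det (c\<^sub>k\<^sub>l f (\<omega>\<^sub>k, \<omega>\<^sub>l)) = det c * (u^n + z^n + (-1)^(n-1) (v^n + y^n))\<close> for every bi-affine
\<open>f (X, Y) = u + v X + y Y + z X Y\<close> for which \<open>v^n + y^n + (-1)^(n-1) z^n\<close> is not 0. Take \<open>f = (X - \<omega>\<^sub>i) (Y - \<omega>\<^sub>j) + s\<close>: as \<open>s\<close> tends to 0, row \<open>i\<close> and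
column \<open>j\<close> vanish to first order, and comparing the coefficients of \<open>s\<close> isolates
\<open>|c\<^sub>i\<^sub>j|^2 = 1/n\<close> (\<open>unbiased_of_biaffine_determinants\<close>). The transition matrix is the adjoint
of \<open>c\<close>, and \<open>h\<close>, its multiple by \<open>sqrt n\<close>, is a Hadamard matrix. In the eigenbasis of \<open>A\<close> the pair \<open>(A, B)\<close>
becomes \<open>(D, h\<^sup>* D h / n)\<close>, and it remains to show that \<open>h\<close> is similar to the Fourier matrix when \<open>n\<close> is 3, 4 or 5.

For these orders it suffices to find two rows whose entrywise ratio \<open>x\<close> is a multiple of the list of all
\<open>n\<close>-th roots of unity (\<open>row_ratio_fourier\<close>). For \<open>n = 3\<close> any two rows will do. For \<open>n = 5\<close> this is
Haagerup's theorem, proved here by a counting argument on the sums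
\<open>V\<^sub>i\<^sub>j\<^sub>k\<^sub>m = \<Sum>\<^sub>l h\<^sub>i\<^sub>l h\<^sub>j\<^sub>l cnj (h\<^sub>k\<^sub>l h\<^sub>m\<^sub>l)\<close>: if \<open>g = |V\<^sub>a\<^sub>a\<^sub>b\<^sub>b|\<close> were not 0, then \<open>g\<close> would be the same for
all pairs of rows, all \<open>V\<close> with four distinct indices would satisfy \<open>|V|^2 = 5 g / 2\<close>, and
Parseval's identity would leave only \<open>g = 5\<close>, which is impossible for five unimodular numbers with
sum 0 (\<open>order_five_square_sum_zero\<close>). For \<open>n = 4\<close> there is a one-parameter family of Hadamard
matrices. Here \<open>(A + B)^4 = (A - B)^4 = 2\<close> yields one more identity for the matrix of \<open>A\<close> in the
eigenbasis of \<open>B\<close> (\<open>order_four_cyclic\<close>), and this fixes the parameter (\<open>order_four_fourier\<close>).\<close>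

section \<open>Arrays with orthogonal unimodular rows\<close>

lemma unimodular_cnj [simp]: "cmod z = 1 \<Longrightarrow> z * cnj z = 1" "cmod z = 1 \<Longrightarrow> cnj z * z = 1"
  by (simp_all add: complex_norm_square[symmetric] mult.commute)

locale hadamard_array =
  fixes n :: nat and h :: "nat \<Rightarrow> nat \<Rightarrow> complex"
  assumes n_pos: "0 < n"
    and unimodular: "\<And>i l. i < n \<Longrightarrow> l < n \<Longrightarrow> cmod (h i l) = 1"
    and rows_orthogonal:
      "\<And>i j. i < n \<Longrightarrow> j < n \<Longrightarrow> i \<noteq> j \<Longrightarrow> (\<Sum>l<n. h i l * cnj (h j l)) = 0"
begin

lemma columns_orthogonal:
  assumes "l < n" "m < n"
  shows "(\<Sum>k<n. h k l * cnj (h k m)) = (if l = m then of_nat n else 0)"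
proof -
  define X where "X = mat n n (\<lambda>(i, l). h i l)"
  define Y where "Y = mat n n (\<lambda>(l, j). cnj (h j l) / of_nat n)"
  have "X * Y = 1\<^sub>m n"
  proof (rule eq_matI)
    fix i j assume ij: "i < dim_row (1\<^sub>m n)" "j < dim_col (1\<^sub>m n)"
    then have "(X * Y) $$ (i, j) = (\<Sum>l<n. h i l * cnj (h j l)) / of_nat n"
      by (simp add: X_def Y_def scalar_prod_def sum_divide_distrib atLeast0LessThan)
    also have "\<dots> = 1\<^sub>m n $$ (i, j)"
      using ij rows_orthogonal[of i j] n_pos by (auto simp: unimodular)
    finally show "(X * Y) $$ (i, j) = 1\<^sub>m n $$ (i, j)" .
  qed (simp_all add: X_def Y_def)
  then have "Y * X = 1\<^sub>m n"
    by (rule mat_mult_left_right_inverse[rotated 2]) (simp_all add: X_def Y_def)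
  then have "(Y * X) $$ (m, l) = (if l = m then 1 else 0)"
    using assms by auto
  then have "(\<Sum>k<n. h k l * cnj (h k m)) / of_nat n = (if l = m then 1 else 0)"
    using assms by (simp add: X_def Y_def scalar_prod_def sum_divide_distrib atLeast0LessThan mult.commute)
  then show ?thesis
    using n_pos by (auto simp: field_simps split: if_splits)
qed

text \<open>Parseval's identity for the orthogonal system of the rows \<open>h k\<close>. It is stated for
  arbitrary functions because it is applied to products of several rows.\<close>

lemma parseval:
  "(\<Sum>k<n. (\<Sum>l<n. f l * cnj (h k l)) * (\<Sum>m<n. h k m * cnj (g m))) = of_nat n * (\<Sum>l<n. f l * cnj (g l))"
proof -
  have "(\<Sum>k<n. (\<Sum>l<n. f l * cnj (h k l)) * (\<Sum>m<n. h k m * cnj (g m)))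
      = (\<Sum>k<n. \<Sum>l<n. \<Sum>m<n. f l * cnj (g m) * (h k m * cnj (h k l)))"
    by (simp add: sum_product mult_ac)
  also have "\<dots> = (\<Sum>l<n. \<Sum>k<n. \<Sum>m<n. f l * cnj (g m) * (h k m * cnj (h k l)))"
    by (rule sum.swap)
  also have "\<dots> = (\<Sum>l<n. \<Sum>m<n. f l * cnj (g m) * (\<Sum>k<n. h k m * cnj (h k l)))"
    by (subst sum.swap[where ?A = "{..<n}" and ?B = "{..<n}" and ?g = "\<lambda>k m. _ k m"]) (simp add: sum_distrib_left)
  also have "\<dots> = (\<Sum>l<n. \<Sum>m<n. if m = l then of_nat n * (f l * cnj (g m)) else 0)"
    by (intro sum.cong refl) (simp add: columns_orthogonal)
  finally show ?thesis
    by (simp add: sum_distrib_left)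
qed

lemma parseval_norm:
  "(\<Sum>k<n. (cmod (\<Sum>l<n. f l * cnj (h k l)))\<^sup>2) = real n * (\<Sum>l<n. (cmod (f l))\<^sup>2)"
proof -
  have "(\<Sum>m<n. h k m * cnj (f m)) = cnj (\<Sum>l<n. f l * cnj (h k l))" for k
    by (simp add: mult.commute)
  then have "complex_of_real (\<Sum>k<n. (cmod (\<Sum>l<n. f l * cnj (h k l)))\<^sup>2)
      = complex_of_real (real n * (\<Sum>l<n. (cmod (f l))\<^sup>2))"
    using parseval[of f f] by (simp only: of_real_sum of_real_mult complex_norm_square of_real_of_nat_eq)
  then show ?thesis
    using of_real_eq_iff by blast
qed

lemma expansion:
  assumes "l < n"
  shows "f l = (\<Sum>k<n. (\<Sum>m<n. f m * cnj (h k m)) * h k l) / of_nat n"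
  using parseval[of f "\<lambda>m. if m = l then 1 else 0"] assms n_pos
  by (simp add: if_distrib[of cnj] if_distrib[of "(*) _"] cong: if_cong)

end

section \<open>A row ratio that runs through the roots of unity\<close>

lemma cis_root_obtain:
  assumes "0 < n" "z ^ n = (1::complex)"
  obtains t where "t < n" "z = cis (2 * pi * real t / real n)"
proof -
  have "z \<in> (\<lambda>k. cis (2 * pi * real k / real n)) ` {..<n}"
    using bij_betw_roots_unity[OF assms(1)] assms(2) by (auto simp: bij_betw_def)
  then show ?thesis
    using that by auto
qed

lemma bij_betw_lessThanI:
  assumes "inj_on f {..<n}" and "\<And>i. i < n \<Longrightarrow> f i < (n::nat)"
  shows "bij_betw f {..<n} {..<n}"
  using assms endo_inj_surj[of "{..<n}" f] by (auto simp: bij_betw_def)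

context hadamard_array
begin

text \<open>The array arises from the Fourier matrix by permuting rows and columns and multiplying them by
  phases; this is similarity to the Fourier matrix in the language of arrays.\<close>

definition fourier_rows :: bool where
  "fourier_rows \<longleftrightarrow> (\<exists>k \<tau> \<mu> c. bij_betw k {..<n} {..<n} \<and> bij_betw \<tau> {..<n} {..<n} \<and>
     (\<forall>i<n. cmod (\<mu> i) = 1) \<and> (\<forall>l<n. cmod (c l) = 1) \<and>
     (\<forall>i<n. \<forall>l<n. h i l = \<mu> i * cis (2 * pi * real (k i * \<tau> l) / real n) * c l))"

text \<open>The powers \<open>x^0, \<dots>, x^(n-1)\<close> of the ratio form an orthogonal basis. Expand the
  ratio \<open>p\<close> of row \<open>i\<close> to row \<open>b\<close> in it. For a third row \<open>i\<close> the coefficients of \<open>x^0\<close> and \<open>x^1\<close>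
  are inner products of row \<open>i\<close> with rows \<open>b\<close> and \<open>a\<close>, hence 0. At most three coefficients remain,
  and \<open>|p| = 1\<close> makes the autocorrelations of the coefficients vanish, which leaves a single one:
  \<open>p\<close> is a multiple of a power of \<open>x\<close>. This count is where \<open>n \<le> 5\<close> enters.\<close>

lemma row_ratio_fourier:
  assumes n: "n \<in> {3, 4, 5}" and ab: "a < n" "b < n" "a \<noteq> b"
    and sums: "\<And>k. 0 < k \<Longrightarrow> k < n \<Longrightarrow> (\<Sum>l<n. (h a l * cnj (h b l)) ^ k) = 0"
  shows fourier_rows
proof -
  define x where "x l = h a l * cnj (h b l)" for l
  have xu: "cmod (x l) = 1" if "l < n" for l
    using that ab by (simp add: x_def norm_mult unimodular)
  have xinv: "x l ^ k * cnj (x l) ^ m = x l ^ (k - m)" if "l < n" "m \<le> k" for l k m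
  proof -
    have "x l ^ k = x l ^ (k - m) * x l ^ m"
      using that by (simp flip: power_add)
    then have "x l ^ k * cnj (x l) ^ m = x l ^ (k - m) * (x l * cnj (x l)) ^ m"
      by (simp add: power_mult_distrib)
    then show ?thesis
      using xu[OF that(1)] by simp
  qed
  interpret V: hadamard_array n "\<lambda>k l. x l ^ k"
  proof
    show "0 < n" by (rule n_pos)
    show "cmod (x l ^ i) = 1" if "i < n" "l < n" for i l
      using that by (simp add: norm_power xu)
    fix i j assume ij: "i < n" "j < n" "i \<noteq> j"
    show "(\<Sum>l<n. x l ^ i * cnj (x l ^ j)) = 0"
    proof (cases "j < i")
      case True
      then show ?thesis
        using sums[of "i - j"] ij by (simp add: xinv x_def[symmetric])
    next
      case False
      have "(\<Sum>l<n. x l ^ i * cnj (x l ^ j)) = cnj (\<Sum>l<n. x l ^ j * cnj (x l) ^ i)"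
        by (simp add: mult.commute)
      also have "\<dots> = 0"
        using sums[of "j - i"] ij False by (simp add: xinv x_def[symmetric])
      finally show ?thesis .
    qed
  qed
  have row: "\<exists>k<n. \<exists>\<mu>. \<forall>l<n. h i l = \<mu> * x l ^ k * h b l" if i: "i < n" for i
  proof -
    define p where "p l = h i l * cnj (h b l)" for l
    define c where "c k = (\<Sum>l<n. p l * cnj (x l ^ k))" for k
    have "cmod (p l) = 1" if "l < n" for l
      using that i ab by (simp add: p_def norm_mult unimodular)
    then have pu: "p l * cnj (p l) = 1" if "l < n" for l
      using that by simp
    have c0: "c 0 = 0" if "i \<noteq> b"
      using that i ab rows_orthogonal[of i b] by (simp add: c_def p_def)
    have c1: "c 1 = 0" if "i \<noteq> a"
    proof -
      have "c 1 = (\<Sum>l<n. h i l * cnj (h a l))"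
        unfolding c_def p_def x_def
        by (intro sum.cong refl) (simp add: mult_ac, simp add: mult.assoc[symmetric] unimodular ab)
      then show ?thesis
        using that i ab rows_orthogonal[of i a] by simp
    qed
    \<comment> \<open>Parseval for \<open>p x^s\<close> and \<open>p\<close>, whose inner product is the sum of the \<open>x^s\<close>.\<close>
    have autocorrelation: "(\<Sum>k<n. (\<Sum>l<n. p l * x l ^ s * cnj (x l ^ k)) * cnj (c k)) = 0"
      if "0 < s" "s < n" for s
    proof -
      have "cnj (c k) = (\<Sum>m<n. x m ^ k * cnj (p m))" for k
        by (simp add: c_def mult.commute)
      then have "(\<Sum>k<n. (\<Sum>l<n. p l * x l ^ s * cnj (x l ^ k)) * cnj (c k))
          = of_nat n * (\<Sum>l<n. p l * x l ^ s * cnj (p l))"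
        by (simp only: V.parseval)
      also have "(\<Sum>l<n. p l * x l ^ s * cnj (p l)) = (\<Sum>l<n. x l ^ s)"
        using pu by (intro sum.cong refl) (simp add: algebra_simps)
      finally show ?thesis
        using sums[OF that] by (simp add: x_def)
    qed
    have shift: "(\<Sum>l<n. p l * x l ^ s * cnj (x l ^ k)) = c (k - s)" if "s \<le> k" "k < n" for s k
    proof -
      have "x l ^ s * cnj (x l ^ k) = cnj (x l ^ (k - s))" if "l < n" for l
        using xinv[OF that \<open>s \<le> k\<close>] by (metis complex_cnj_cnj complex_cnj_mult complex_cnj_power mult.commute)
      then show ?thesis
        unfolding c_def by (intro sum.cong refl) (simp add: mult.assoc)
    qed
    have "\<exists>k<n. \<forall>k'<n. k' \<noteq> k \<longrightarrow> c k' = 0"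
    proof (cases "i = a \<or> i = b")
      case True
      have xx: "(\<Sum>l<n. x l ^ d * cnj (x l) ^ k) = 0" if "d < n" "k < n" "k \<noteq> d" for d k
        using V.rows_orthogonal[of d k] that by simp
      show ?thesis
      proof (cases "i = a")
        case True
        then have "c k = 0" if "k < n" "k \<noteq> 1" for k
          using xx[of 1 k] that n by (auto simp: c_def p_def x_def)
        then show ?thesis using n by (intro exI[of _ 1]) auto
      next
        case False
        with True have "c k = 0" if "k < n" "k \<noteq> 0" for k
          using xx[of 0 k] that n ab by (auto simp: c_def p_def unimodular)
        then show ?thesis using n by (intro exI[of _ 0]) auto
      qed
    next
      case False
      with c0 c1 have c01: "c 0 = 0" "c (Suc 0) = 0" by auto
      have k3: "(\<Sum>k<3. f k) = f 0 + f (Suc 0) + f 2" for f :: "nat \<Rightarrow> complex"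
        by (simp add: eval_nat_numeral)
      have k4: "(\<Sum>k<4. f k) = f 0 + f (Suc 0) + f 2 + f 3" for f :: "nat \<Rightarrow> complex"
        by (simp add: eval_nat_numeral)
      have k5: "(\<Sum>k<5. f k) = f 0 + f (Suc 0) + f 2 + f 3 + f 4" for f :: "nat \<Rightarrow> complex"
        by (simp add: eval_nat_numeral)
      have lt: "k < 3 \<longleftrightarrow> k = 0 \<or> k = Suc 0 \<or> k = 2" "k < 4 \<longleftrightarrow> k = 0 \<or> k = Suc 0 \<or> k = 2 \<or> k = 3"
        "k < 5 \<longleftrightarrow> k = 0 \<or> k = Suc 0 \<or> k = 2 \<or> k = 3 \<or> k = 4" for k :: nat
        by auto
      from n consider "n = 3" | "n = 4" | "n = 5" by auto
      then show ?thesis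
      proof cases
        case 1
        then show ?thesis using c01 by (intro exI[of _ 2]) (auto simp: lt)
      next
        case 2
        have "c 2 * cnj (c 3) = 0"
          using autocorrelation[of 1] shift[of 1 2] shift[of 1 3] c01 2
          by (simp add: k4)
        then show ?thesis
          using c01 2 by (cases "c 2 = 0"; simp add: lt) blast+
      next
        case 3
        have "c 2 * cnj (c 4) = 0"
          using autocorrelation[of 2] shift[of 2 2] shift[of 2 3] shift[of 2 4] c01 3
          by (simp add: k5)
        moreover have "c 2 * cnj (c 3) + c 3 * cnj (c 4) = 0"
          using autocorrelation[of 1] shift[of 1 2] shift[of 1 3] shift[of 1 4] c01 3
          by (simp add: k5)
        ultimately have "c 3 = 0 \<and> c 4 = 0 \<or> c 2 = 0 \<and> c 4 = 0 \<or> c 2 = 0 \<and> c 3 = 0"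
          by auto
        then show ?thesis
          using c01 3 by (simp add: lt) blast
      qed
    qed
    then obtain k where k: "k < n" "\<And>k'. k' < n \<Longrightarrow> k' \<noteq> k \<Longrightarrow> c k' = 0" by blast
    have "h i l = c k / of_nat n * x l ^ k * h b l" if l: "l < n" for l
    proof -
      have "p l = (\<Sum>k'<n. c k' * x l ^ k') / of_nat n"
        using V.expansion[OF l, of p] by (simp add: c_def)
      also have "(\<Sum>k'<n. c k' * x l ^ k') = (\<Sum>k'<n. if k' = k then c k * x l ^ k else 0)"
        using k by (intro sum.cong refl) auto
      finally have "p l = c k / of_nat n * x l ^ k"
        using k by simp
      moreover have "h i l = p l * h b l"
        using l ab by (simp add: p_def mult.assoc unimodular)
      ultimately show ?thesis by simp
    qed
    with k(1) show ?thesis by blast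
  qed
  then obtain k \<mu> where k: "\<And>i. i < n \<Longrightarrow> k i < n"
    and h: "\<And>i l. i < n \<Longrightarrow> l < n \<Longrightarrow> h i l = \<mu> i * x l ^ k i * h b l"
    by metis
  have "inj_on k {..<n}"
  proof (rule inj_onI, rule ccontr)
    fix i j assume ij: "i \<in> {..<n}" "j \<in> {..<n}" "k i = k j" "i \<noteq> j"
    have "h i l * cnj (h j l) = \<mu> i * cnj (\<mu> j)" if l: "l < n" for l
    proof -
      have "h i l * cnj (h j l) = \<mu> i * cnj (\<mu> j) * ((x l * cnj (x l)) ^ k j * (h b l * cnj (h b l)))"
        using ij l by (simp add: h power_mult_distrib mult_ac)
      then show ?thesis
        using l ab by (simp add: xu unimodular)
    qed
    then have "\<mu> i * cnj (\<mu> j) = 0"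
      using rows_orthogonal[of i j] ij n_pos by simp
    moreover have "\<mu> i \<noteq> 0" "\<mu> j \<noteq> 0"
      using h[of i 0] h[of j 0] unimodular[of i 0] unimodular[of j 0] ij n_pos by auto
    ultimately show False by simp
  qed
  then have k_bij: "bij_betw k {..<n} {..<n}"
    using k by (rule bij_betw_lessThanI)
  \<comment> \<open>\<open>x^n\<close> is orthogonal to \<open>x, \<dots>, x^(n-1)\<close> and is therefore constant, with value \<open>\<kappa>\<close>.\<close>
  define \<kappa> where "\<kappa> = (\<Sum>m<n. x m ^ n) / of_nat n"
  have xn: "x l ^ n = \<kappa>" if l: "l < n" for l
  proof -
    have z: "(\<Sum>m<n. x m ^ n * cnj (x m ^ k)) = 0" if "k < n" "k \<noteq> 0" for k
      using sums[of "n - k"] that by (simp add: xinv x_def[symmetric])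
    have "x l ^ n = (\<Sum>k<n. (\<Sum>m<n. x m ^ n * cnj (x m ^ k)) * x l ^ k) / of_nat n"
      by (rule V.expansion[OF l])
    also have "(\<Sum>k<n. (\<Sum>m<n. x m ^ n * cnj (x m ^ k)) * x l ^ k)
        = (\<Sum>k<n. if k = 0 then (\<Sum>m<n. x m ^ n) else 0)"
      using z by (intro sum.cong refl) auto
    finally show ?thesis
      using n_pos by (simp add: \<kappa>_def)
  qed
  have x0: "x 0 * cnj (x 0) = 1" using xu[of 0] n_pos by simp
  have "\<exists>t<n. x l * cnj (x 0) = cis (2 * pi * real t / real n)" if "l < n" for l
  proof -
    have "(x l * cnj (x 0)) ^ n = (x 0 * cnj (x 0)) ^ n"
      using xn[OF that] xn[of 0] n_pos by (simp add: power_mult_distrib)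
    then show ?thesis
      using cis_root_obtain[OF n_pos] x0 by (metis power_one)
  qed
  then obtain \<tau> where \<tau>: "\<And>l. l < n \<Longrightarrow> \<tau> l < n"
      "\<And>l. l < n \<Longrightarrow> x l * cnj (x 0) = cis (2 * pi * real (\<tau> l) / real n)"
    by metis
  have x\<tau>: "x l = x 0 * cis (2 * pi * real (\<tau> l) / real n)" if "l < n" for l
  proof -
    have "x l = x 0 * cnj (x 0) * x l" by (simp add: x0)
    also have "\<dots> = x 0 * (x l * cnj (x 0))" by (simp only: mult_ac)
    also have "x l * cnj (x 0) = cis (2 * pi * real (\<tau> l) / real n)" by (rule \<tau>(2)[OF that])
    finally show ?thesis .
  qed
  have "inj_on \<tau> {..<n}"
  proof (rule inj_onI, rule ccontr)
    fix l m assume lm: "l \<in> {..<n}" "m \<in> {..<n}" "\<tau> l = \<tau> m" "l \<noteq> m"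
    then have "x l = x m" by (metis x\<tau> lessThan_iff)
    then have "(\<Sum>k<n. x l ^ k * cnj (x m ^ k)) = of_nat n"
      using V.columns_orthogonal[of m m] lm by simp
    then show False
      using V.columns_orthogonal[of l m] lm n_pos by simp
  qed
  then have \<tau>_bij: "bij_betw \<tau> {..<n} {..<n}"
    using \<tau>(1) by (rule bij_betw_lessThanI)
  have h_eq: "h i l = (\<mu> i * x 0 ^ k i) * cis (2 * pi * real (k i * \<tau> l) / real n) * h b l"
    if "i < n" "l < n" for i l
    unfolding h[OF that] x\<tau>[OF that(2)] power_mult_distrib Complex.DeMoivre
    by (simp add: mult_ac)
  have c_unit: "cmod (h b l) = 1" if "l < n" for l
    using ab that by (simp add: unimodular)
  have \<mu>_unit: "cmod (\<mu> i * x 0 ^ k i) = 1" if "i < n" for i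
    using arg_cong[OF h_eq[OF that n_pos], of cmod] that n_pos c_unit[OF n_pos] by (simp add: norm_mult unimodular)
  show ?thesis
    unfolding fourier_rows_def
    by (intro exI[of _ k] exI[of _ \<tau>] exI[of _ "\<lambda>i. \<mu> i * x 0 ^ k i"] exI[of _ "h b"]
        conjI k_bij \<tau>_bij \<mu>_unit c_unit allI impI h_eq)
qed

end

section \<open>Vanishing power sums of unimodular numbers\<close>

text \<open>Conjugation inverts unimodular numbers, so the conjugate of an elementary symmetric polynomial
  \<open>e\<^sub>k\<close> in \<open>m\<close> of them is \<open>e\<^sub>m\<^sub>-\<^sub>k / e\<^sub>m\<close>. Hence the vanishing of the low symmetric polynomials
  forces the vanishing of the high ones, and the polynomial with these roots is \<open>X^m \<plusminus> e\<^sub>m\<close>. The next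
  three lemmas are the cases \<open>m = 3, 4, 5\<close>.\<close>

lemma unimodular_cnj_eq: "cmod z = 1 \<Longrightarrow> cnj z = 1 / z"
  by (metis unimodular_cnj(2) nonzero_eq_divide_eq mult_zero_right zero_neq_one)

lemma unimodular_triple_cube:
  fixes a b c :: complex
  assumes u: "cmod a = 1" "cmod b = 1" "cmod c = 1" and s: "a + b + c = 0"
  shows "a ^ 3 = a * b * c"
proof -
  have nz: "a \<noteq> 0" "b \<noteq> 0" "c \<noteq> 0" using u by auto
  have "1 / a + 1 / b + 1 / c = 0"
    using arg_cong[OF s, of cnj] u by (simp add: unimodular_cnj_eq)
  then have "a * b + b * c + c * a = 0"
    using nz by (simp add: field_simps)
  moreover have "a ^ 3 = a ^ 2 * (a + b + c) - a * (a * b + b * c + c * a) + a * b * c"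
    by (simp add: eval_nat_numeral algebra_simps)
  ultimately show ?thesis using s by simp
qed

lemma twice_eq_zeroD: "2 * z = 0\<^sup>2 - 0 \<Longrightarrow> z = 0" for z :: complex
  by simp

lemma unimodular_quadruple_fourth_power:
  fixes a b c d :: complex
  assumes u: "cmod a = 1" "cmod b = 1" "cmod c = 1" "cmod d = 1"
    and s: "a + b + c + d = 0" "a ^ 2 + b ^ 2 + c ^ 2 + d ^ 2 = 0"
  shows "a ^ 4 = - (a * b * c * d)"
proof -
  have nz: "a \<noteq> 0" "b \<noteq> 0" "c \<noteq> 0" "d \<noteq> 0" using u by auto
  have "1 / a + 1 / b + 1 / c + 1 / d = 0"
    using arg_cong[OF s(1), of cnj] u by (simp add: unimodular_cnj_eq)
  then have "b * c * d + a * c * d + a * b * d + a * b * c = 0"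
    using nz by (simp add: field_simps)
  moreover have "2 * (a*b + a*c + a*d + b*c + b*d + c*d)
      = (a + b + c + d) ^ 2 - (a ^ 2 + b ^ 2 + c ^ 2 + d ^ 2)"
    by (simp add: power2_eq_square algebra_simps)
  then have "a*b + a*c + a*d + b*c + b*d + c*d = 0"
    unfolding s by (rule twice_eq_zeroD)
  moreover have "a ^ 4 = a ^ 3 * (a + b + c + d) - a ^ 2 * (a*b + a*c + a*d + b*c + b*d + c*d)
      + a * (b * c * d + a * c * d + a * b * d + a * b * c) - a * b * c * d"
    by (simp add: eval_nat_numeral algebra_simps)
  ultimately show ?thesis using s(1) by simp
qed

lemma unimodular_quintuple_fifth_power:
  fixes a b c d e :: complex
  assumes u: "cmod a = 1" "cmod b = 1" "cmod c = 1" "cmod d = 1" "cmod e = 1"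
    and s: "a + b + c + d + e = 0" "a ^ 2 + b ^ 2 + c ^ 2 + d ^ 2 + e ^ 2 = 0"
  shows "a ^ 5 = a * b * c * d * e"
proof -
  have nz: "a \<noteq> 0" "b \<noteq> 0" "c \<noteq> 0" "d \<noteq> 0" "e \<noteq> 0" using u by auto
  have "2 * (a*b + a*c + a*d + a*e + b*c + b*d + b*e + c*d + c*e + d*e)
      = (a + b + c + d + e) ^ 2 - (a ^ 2 + b ^ 2 + c ^ 2 + d ^ 2 + e ^ 2)"
    by (simp add: power2_eq_square algebra_simps)
  then have e2: "a*b + a*c + a*d + a*e + b*c + b*d + b*e + c*d + c*e + d*e = 0"
    unfolding s by (rule twice_eq_zeroD)
  have "1 / a + 1 / b + 1 / c + 1 / d + 1 / e = 0"
    using arg_cong[OF s(1), of cnj] u by (simp add: unimodular_cnj_eq)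
  then have e4: "b*c*d*e + a*c*d*e + a*b*d*e + a*b*c*e + a*b*c*d = 0"
    using nz by (simp add: field_simps)
  have "1/(a*b) + 1/(a*c) + 1/(a*d) + 1/(a*e) + 1/(b*c) + 1/(b*d) + 1/(b*e) + 1/(c*d) + 1/(c*e)
      + 1/(d*e) = 0" (is "?c2 = 0")
    using arg_cong[OF e2, of cnj] u by (simp add: unimodular_cnj_eq)
  moreover have "c*d*e + b*d*e + b*c*e + b*c*d + a*d*e + a*c*e + a*c*d + a*b*e + a*b*d + a*b*c
      = a*b*c*d*e * ?c2"
    unfolding distrib_left using nz by simp
  ultimately have e3: "c*d*e + b*d*e + b*c*e + b*c*d + a*d*e + a*c*e + a*c*d + a*b*e + a*b*d + a*b*c = 0"
    by simp
  have "a ^ 5 = a ^ 4 * (a + b + c + d + e)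
      - a ^ 3 * (a*b + a*c + a*d + a*e + b*c + b*d + b*e + c*d + c*e + d*e)
      + a ^ 2 * (c*d*e + b*d*e + b*c*e + b*c*d + a*d*e + a*c*e + a*c*d + a*b*e + a*b*d + a*b*c)
      - a * (b*c*d*e + a*c*d*e + a*b*d*e + a*b*c*e + a*b*c*d) + a*b*c*d*e"
    by (simp add: eval_nat_numeral algebra_simps)
  then show ?thesis using s(1) e2 e3 e4 by simp
qed

lemma sum_lessThan_345:
  fixes f :: "nat \<Rightarrow> complex"
  shows "(\<Sum>k<3. f k) = f 0 + f (Suc 0) + f 2"
    and "(\<Sum>k<4. f k) = f 0 + f (Suc 0) + f 2 + f 3"
    and "(\<Sum>k<5. f k) = f 0 + f (Suc 0) + f 2 + f 3 + f 4"
  by (simp_all add: eval_nat_numeral)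

lemma less_345_iff:
  fixes k :: nat
  shows "k < 3 \<longleftrightarrow> k = 0 \<or> k = Suc 0 \<or> k = 2" 
    and "k < 4 \<longleftrightarrow> k = 0 \<or> k = Suc 0 \<or> k = 2 \<or> k = 3"
    and "k < 5 \<longleftrightarrow> k = 0 \<or> k = Suc 0 \<or> k = 2 \<or> k = 3 \<or> k = 4"
  by auto

text \<open>If \<open>x^n\<close> is constant then \<open>x^k\<close> is a multiple of the conjugate of \<open>x^(n-k)\<close>, so power sums
  up to \<open>n/2\<close> control all of them.\<close>

lemma power_sums_of_constant_power:
  fixes x :: "nat \<Rightarrow> complex"
  assumes u: "\<And>l. l < n \<Longrightarrow> cmod (x l) = 1"
    and c: "\<And>l. l < n \<Longrightarrow> x l ^ n = c"
    and low: "\<And>k. 0 < k \<Longrightarrow> 2 * k \<le> n \<Longrightarrow> (\<Sum>l<n. x l ^ k) = 0"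
    and k: "0 < k" "k < n"
  shows "(\<Sum>l<n. x l ^ k) = 0"
proof (cases "2 * k \<le> n")
  case False
  have "x l ^ k = c * cnj (x l ^ (n - k))" if l: "l < n" for l
  proof -
    have "c * cnj (x l ^ (n - k)) = x l ^ k * (x l * cnj (x l)) ^ (n - k)"
      using k by (simp add: c[OF l, symmetric] power_mult_distrib flip: power_add mult.assoc)
    then show ?thesis using u[OF l] by simp
  qed
  then have "(\<Sum>l<n. x l ^ k) = c * cnj (\<Sum>l<n. x l ^ (n - k))"
    by (simp add: sum_distrib_left)
  then show ?thesis
    using low[of "n - k"] False k by simp
qed (use low k in blast)

context hadamard_array
begin

lemma ratio_unimodular: "a < n \<Longrightarrow> b < n \<Longrightarrow> l < n \<Longrightarrow> cmod (h a l * cnj (h b l)) = 1"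
  by (simp add: norm_mult unimodular)

lemma ratio_square_sum_zero_fourier:
  assumes n: "n \<in> {4, 5}" and ab: "a < n" "b < n" "a \<noteq> b"
    and sq: "(\<Sum>l<n. (h a l * cnj (h b l)) ^ 2) = 0"
  shows fourier_rows
proof -
  define x where "x l = h a l * cnj (h b l)" for l
  have u: "cmod (x l) = 1" if "l < n" for l
    using that ab by (simp add: x_def ratio_unimodular)
  have s1: "(\<Sum>l<n. x l) = 0" using rows_orthogonal[OF ab] by (simp add: x_def)
  have s2: "(\<Sum>l<n. x l ^ 2) = 0" using sq by (simp add: x_def)
  have "\<exists>c. \<forall>l<n. x l ^ n = c"
  proof (cases "n = 4")
    case True
    have e: "x 0 + x (Suc 0) + x 2 + x 3 = 0" and q: "x 0 ^ 2 + x (Suc 0) ^ 2 + x 2 ^ 2 + x 3 ^ 2 = 0"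
      using s1 s2 True by (simp_all only: sum_lessThan_345 One_nat_def)
    have v: "cmod (x 0) = 1" "cmod (x (Suc 0)) = 1" "cmod (x 2) = 1" "cmod (x 3) = 1"
      using u True by simp_all
    have p0: "x 0 ^ 4 = - (x 0 * x (Suc 0) * x 2 * x 3)"
      using e q by (intro unimodular_quadruple_fourth_power v) (simp_all only: add_ac)
    have p1: "x (Suc 0) ^ 4 = - (x (Suc 0) * x 0 * x 2 * x 3)"
      using e q by (intro unimodular_quadruple_fourth_power v) (simp_all only: add_ac)
    have p2: "x 2 ^ 4 = - (x 2 * x 0 * x (Suc 0) * x 3)"
      using e q by (intro unimodular_quadruple_fourth_power v) (simp_all only: add_ac)
    have p3: "x 3 ^ 4 = - (x 3 * x 0 * x (Suc 0) * x 2)"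
      using e q by (intro unimodular_quadruple_fourth_power v) (simp_all only: add_ac)
    have "x l ^ 4 = - (x 0 * x (Suc 0) * x 2 * x 3)" if "l < 4" for l
      using that unfolding less_345_iff by (elim disjE) (simp_all only: p0 p1 p2 p3 mult_ac)
    with True show ?thesis by blast
  next
    case False
    with n have n5: "n = 5" by simp
    have e: "x 0 + x (Suc 0) + x 2 + x 3 + x 4 = 0" and q: "x 0 ^ 2 + x (Suc 0) ^ 2 + x 2 ^ 2 + x 3 ^ 2 + x 4 ^ 2 = 0"
      using s1 s2 n5 by (simp_all only: sum_lessThan_345 One_nat_def)
    have v: "cmod (x 0) = 1" "cmod (x (Suc 0)) = 1" "cmod (x 2) = 1" "cmod (x 3) = 1" "cmod (x 4) = 1"
      using u n5 by simp_all
    have p0: "x 0 ^ 5 = x 0 * x (Suc 0) * x 2 * x 3 * x 4"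
      using e q by (intro unimodular_quintuple_fifth_power v) (simp_all only: add_ac)
    have p1: "x (Suc 0) ^ 5 = x (Suc 0) * x 0 * x 2 * x 3 * x 4"
      using e q by (intro unimodular_quintuple_fifth_power v) (simp_all only: add_ac)
    have p2: "x 2 ^ 5 = x 2 * x 0 * x (Suc 0) * x 3 * x 4"
      using e q by (intro unimodular_quintuple_fifth_power v) (simp_all only: add_ac)
    have p3: "x 3 ^ 5 = x 3 * x 0 * x (Suc 0) * x 2 * x 4"
      using e q by (intro unimodular_quintuple_fifth_power v) (simp_all only: add_ac)
    have p4: "x 4 ^ 5 = x 4 * x 0 * x (Suc 0) * x 2 * x 3"
      using e q by (intro unimodular_quintuple_fifth_power v) (simp_all only: add_ac)
    have "x l ^ 5 = x 0 * x (Suc 0) * x 2 * x 3 * x 4" if "l < 5" for l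
      using that unfolding less_345_iff by (elim disjE) (simp_all only: p0 p1 p2 p3 p4 mult_ac)
    with n5 show ?thesis by blast
  qed
  then obtain c where c: "\<And>l. l < n \<Longrightarrow> x l ^ n = c" by blast
  have "(\<Sum>l<n. x l ^ k) = 0" if "0 < k" "k < n" for k
  proof (rule power_sums_of_constant_power[OF u c _ that])
    fix k assume "0 < k" "2 * k \<le> n"
    then have "k = 1 \<or> k = 2" using n by auto
    then show "(\<Sum>l<n. x l ^ k) = 0" using s1 s2 by auto
  qed
  then show ?thesis
    using row_ratio_fourier[OF _ ab] n by (auto simp: x_def)
qed

lemma order_three_fourier:
  assumes n: "n = 3"
  shows fourier_rows
proof -
  define x where "x l = h 1 l * cnj (h 0 l)" for l
  have u: "cmod (x l) = 1" if "l < n" for l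
    using that n by (simp add: x_def ratio_unimodular)
  have s1: "(\<Sum>l<n. x l) = 0" using rows_orthogonal[of 1 0] n by (simp add: x_def)
  have e: "x 0 + x (Suc 0) + x 2 = 0"
    using s1 n by (simp only: sum_lessThan_345)
  have v: "cmod (x 0) = 1" "cmod (x (Suc 0)) = 1" "cmod (x 2) = 1"
    using u n by simp_all
  have p0: "x 0 ^ 3 = x 0 * x (Suc 0) * x 2"
    using e by (intro unimodular_triple_cube v)
  have p1: "x (Suc 0) ^ 3 = x (Suc 0) * x 0 * x 2"
    using e by (intro unimodular_triple_cube v) (simp only: add_ac)
  have p2: "x 2 ^ 3 = x 2 * x 0 * x (Suc 0)"
    using e by (intro unimodular_triple_cube v) (simp only: add_ac)
  have c: "x l ^ n = x 0 * x (Suc 0) * x 2" if "l < n" for l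
    using that unfolding n less_345_iff by (elim disjE) (simp_all only: p0 p1 p2 mult_ac)
  have "(\<Sum>l<n. x l ^ k) = 0" if "0 < k" "k < n" for k
  proof (rule power_sums_of_constant_power[OF u c _ that])
    fix k assume "0 < k" "2 * k \<le> n"
    then have "k = 1" using n by auto
    then show "(\<Sum>l<n. x l ^ k) = 0" using s1 by auto
  qed
  then show ?thesis
    using row_ratio_fourier[of 1 0] n by (auto simp: x_def)
qed

end

section \<open>Order five: the theorem of Haagerup\<close>

lemma sum_lessThan_five:
  fixes f :: "nat \<Rightarrow> 'a::comm_monoid_add"
  assumes "n = 5" "distinct [a, b, c, d, e]" "a < 5" "b < 5" "c < 5" "d < 5" "e < 5"
  shows "(\<Sum>k<n. f k) = f a + f b + f c + f d + f e"
proof -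
  have "{a, b, c, d, e} = {..<5::nat}"
    using assms by (intro card_subset_eq) auto
  then have "(\<Sum>k<n. f k) = (\<Sum>k\<in>{a, b, c, d, e}. f k)" using assms(1) by simp
  then show ?thesis using assms(2) by (simp add: add_ac)
qed

lemma twice_eq_of_pairwise_sums:
  fixes u v w s :: complex
  assumes "u + v = s" "u + w = s" "v + w = s"
  shows "2 * u = s"
proof -
  have "2 * u = (u + v) + (u + w) - (v + w)" by simp
  then show ?thesis unfolding assms by simp
qed

context hadamard_array
begin

text \<open>Writing \<open>x\<close> for the ratio of row \<open>i\<close> to row \<open>k\<close>, this is the \<open>(m, j)\<close> entry, up to the factor
  \<open>n\<close>, of multiplication by \<open>x\<close> in the basis of the rows; \<open>quad a a b b\<close> is the sum of the squares
  of the ratio of row \<open>a\<close> to row \<open>b\<close>.\<close>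

definition quad :: "nat \<Rightarrow> nat \<Rightarrow> nat \<Rightarrow> nat \<Rightarrow> complex" where
  "quad i j k m = (\<Sum>l<n. h i l * h j l * cnj (h k l) * cnj (h m l))"

lemma quad_swap: "quad j i k m = quad i j k m" "quad i j m k = quad i j k m"
  by (simp_all add: quad_def mult_ac)

lemma cmod_quad_flip: "cmod (quad k m i j) = cmod (quad i j k m)"
proof -
  have "quad k m i j = cnj (quad i j k m)"
    by (simp add: quad_def mult_ac)
  then show ?thesis by simp
qed

lemma quad_cancel:
  assumes "i < n" "j < n" "k < n" "i \<noteq> k"
  shows "quad i j k j = 0"
proof -
  have "h i l * h j l * cnj (h k l) * cnj (h j l) = h i l * cnj (h k l)" if "l < n" for l
  proof -
    have "h i l * h j l * cnj (h k l) * cnj (h j l) = h i l * cnj (h k l) * (h j l * cnj (h j l))"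
      by (simp only: mult_ac)
    then show ?thesis using unimodular_cnj(1)[OF unimodular[OF assms(2) that]] by simp
  qed
  then have "quad i j k j = (\<Sum>l<n. h i l * cnj (h k l))"
    unfolding quad_def by (intro sum.cong) auto
  then show ?thesis
    using rows_orthogonal[of i k] assms by simp
qed

lemma quad_repeated_row:
  assumes "i < n" "j < n" "k < n" "m < n"
    and "j = m \<and> i \<noteq> k \<or> i = m \<and> j \<noteq> k \<or> j = k \<and> i \<noteq> m"
  shows "quad i j k m = 0"
  using assms quad_cancel[of i j k] quad_cancel[of j i k] quad_cancel[of i j m]
    quad_swap[of j i k i] quad_swap[of i j k j] quad_swap[of i j j m]
  by auto

text \<open>The square of the operator of multiplication by \<open>x\<close>, the ratio of rows \<open>a\<close> and \<open>b\<close>, is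
  multiplication by \<open>x^2\<close>, and all diagonal entries of a multiplication operator agree in a basis of
  unimodular vectors.\<close>

lemma quad_square:
  assumes ab: "a < n" "b < n" "j < n"
  shows "(\<Sum>k<n. quad a j b k * quad a k b j) = of_nat n * quad a a b b"
proof -
  have "(\<Sum>k<n. (\<Sum>l<n. (h a l * h j l * cnj (h b l)) * cnj (h k l)) *
      (\<Sum>l<n. h k l * cnj (cnj (h a l) * h j l * h b l)))
      = of_nat n * (\<Sum>l<n. (h a l * h j l * cnj (h b l)) * cnj (cnj (h a l) * h j l * h b l))"
    by (rule parseval)
  moreover have "(h a l * h j l * cnj (h b l)) * cnj (cnj (h a l) * h j l * h b l)
      = h a l * h a l * cnj (h b l) * cnj (h b l)" if "l < n" for l
  proof -
    have "(h a l * h j l * cnj (h b l)) * cnj (cnj (h a l) * h j l * h b l)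
      = h a l * h a l * cnj (h b l) * cnj (h b l) * (h j l * cnj (h j l))"
      by (simp add: mult_ac)
    then show ?thesis using unimodular_cnj(1)[OF unimodular[OF ab(3) that]] by simp
  qed
  then have "(\<Sum>l<n. (h a l * h j l * cnj (h b l)) * cnj (cnj (h a l) * h j l * h b l)) = quad a a b b"
    unfolding quad_def by (intro sum.cong) auto
  moreover have "(\<Sum>l<n. h k l * cnj (cnj (h a l) * h j l * h b l)) = quad a k b j" for k
    unfolding quad_def by (intro sum.cong) (auto simp: mult_ac)
  ultimately show ?thesis
    by (simp add: quad_def)
qed

text \<open>Multiplication by a unimodular function preserves the norm of row \<open>j\<close>.\<close>

lemma quad_norm:
  assumes "a < n" "b < n" "j < n"
  shows "(\<Sum>k<n. (cmod (quad a j b k))\<^sup>2) = (real n)\<^sup>2"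
proof -
  have "(\<Sum>k<n. (cmod (\<Sum>l<n. (h a l * h j l * cnj (h b l)) * cnj (h k l)))\<^sup>2)
      = real n * (\<Sum>l<n. (cmod (h a l * h j l * cnj (h b l)))\<^sup>2)"
    by (rule parseval_norm)
  also have "(\<Sum>l<n. (cmod (h a l * h j l * cnj (h b l)))\<^sup>2) = real n"
    using assms by (simp add: norm_mult unimodular)
  finally show ?thesis
    by (simp add: quad_def power2_eq_square)
qed

text \<open>For \<open>j\<close> among the three rows other than \<open>a\<close> and \<open>b\<close>, all but two terms in \<open>quad_square\<close> vanish.
  This gives three equations for the three symmetric products, in which each pair of products has
  the same sum.\<close>

lemma order_five_quad_product:
  assumes n: "n = 5" and d: "distinct [a, b, c, d, e]" and lt: "a < 5" "b < 5" "c < 5" "d < 5" "e < 5"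
  shows "2 * (quad a c b d * quad a d b c) = 5 * quad a a b b"
proof -
  have d': "distinct [e, d, c, b, a]" using d by auto
  have ltn: "a < n" "b < n" "c < n" "d < n" "e < n" and nn: "(of_nat n :: complex) = 5"
    using lt n by auto
  note sq = quad_square[of a b, unfolded sum_lessThan_five[OF n d lt] nn, OF ltn(1,2)]
  have "quad a c b d * quad a d b c + quad a c b e * quad a e b c = 5 * quad a a b b"
    using sq[OF ltn(3)] d d' ltn by (simp add: quad_repeated_row)
  moreover have "quad a c b d * quad a d b c + quad a d b e * quad a e b d = 5 * quad a a b b"
    using sq[OF ltn(4)] d d' ltn by (simp add: quad_repeated_row mult_ac)
  moreover have "quad a c b e * quad a e b c + quad a d b e * quad a e b d = 5 * quad a a b b"
    using sq[OF ltn(5)] d d' ltn by (simp add: quad_repeated_row mult_ac)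
  ultimately show ?thesis by (rule twice_eq_of_pairwise_sums)
qed

lemma order_five_quad_norm:
  assumes n: "n = 5" and d: "distinct [a, b, c, d, e]" and lt: "a < 5" "b < 5" "c < 5" "d < 5" "e < 5"
  shows "2 * (cmod (quad a c b d) * cmod (quad a d b c)) = 5 * cmod (quad a a b b)"
  using arg_cong[OF order_five_quad_product[OF assms], of cmod] by (simp add: norm_mult)

text \<open>Let \<open>P, Q, R\<close> be the moduli of the three sums that pair off four rows \<open>a, b, p, q\<close>. The
  preceding lemma evaluates \<open>QR\<close> both by the square sum of \<open>a, b\<close> and by that of \<open>p, q\<close>, so disjoint
  pairs of rows have square sums of equal modulus; any two pairs of five rows are joined by a chain of
  disjoint pairs, hence all moduli equal \<open>g\<close>. Then \<open>PQ = QR = PR\<close> and \<open>P = Q = R\<close>. The Parseval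
  identities for the products of rows turn into \<open>g^2 + 3 (25 - 5 g) = 25\<close>, that is \<open>g = 5\<close> or
  \<open>g = 10\<close>, and \<open>g \<le> 5\<close>. For \<open>g = 5\<close> the squares of the ratio are all equal, and five numbers
  \<open>\<plusminus> x\<^sub>0\<close> cannot add up to 0.\<close>

lemma order_five_square_sum_zero:
  assumes n: "n = 5" and d: "distinct [a, b, c, d, e]" and lt: "a < 5" "b < 5" "c < 5" "d < 5" "e < 5"
  shows "quad a a b b = 0"
proof (rule ccontr)
  assume nz: "quad a a b b \<noteq> 0"
  define g where "g = cmod (quad a a b b)"
  have g: "g > 0" using nz by (simp add: g_def)
  have disjoint: "cmod (quad p p q q) = cmod (quad r r s s)"
    if t: "distinct [p, q, r, s, t]" "p < 5" "q < 5" "r < 5" "s < 5" "t < 5" for p q r s t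
  proof -
    have "cmod (quad r p s q) = cmod (quad p r q s)" "cmod (quad r q s p) = cmod (quad p s q r)"
      by (metis quad_swap cmod_quad_flip)+
    moreover have "distinct [r, s, p, q, t]" using t(1) by auto
    ultimately show ?thesis
      using order_five_quad_norm[OF n t] order_five_quad_norm[OF n, of r s p q t] t(2-) by simp
  qed
  have eq: "cmod (quad a a p p) = g" if t: "distinct [a, b, p, q, r]" "p < 5" "q < 5" "r < 5" for p q r
  proof -
    have "distinct [a, b, q, r, p]" "distinct [a, p, q, r, b]" using t(1) by auto
    then show ?thesis
      using disjoint[of a b q r p] disjoint[of a p q r b] lt t(2-) by (simp add: g_def)
  qed
  have v: "(cmod (quad a p b q))\<^sup>2 = 5 * g / 2"
    if t: "distinct [a, b, p, q, r]" "p < 5" "q < 5" "r < 5" for p q r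
  proof -
    let ?P = "cmod (quad a b p q)" and ?Q = "cmod (quad a p b q)" and ?R = "cmod (quad a q b p)"
    have t': "distinct [a, b, q, p, r]" "distinct [a, p, b, q, r]" "distinct [a, q, b, p, r]"
      using t(1) by auto
    have "2 * (?Q * ?R) = 5 * g"
      using order_five_quad_norm[OF n t(1) lt(1,2) t(2-)] by (simp only: g_def)
    moreover have "2 * (?P * ?R) = 5 * g"
      using order_five_quad_norm[OF n t'(2) lt(1) t(2) lt(2) t(3,4)] eq[OF t]
      by (simp only: quad_swap(2)[of a q b p])
    moreover have "2 * (?P * ?Q) = 5 * g"
      using order_five_quad_norm[OF n t'(3) lt(1) t(3) lt(2) t(2,4)] eq[OF t'(1) t(3,2,4)]
      by (simp only: quad_swap(2)[of a b p q] quad_swap(2)[of a p b q])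
    ultimately have P: "?P * ?R = 5 * g / 2" "?P * ?Q = 5 * g / 2" and Q: "?Q * ?R = 5 * g / 2"
      by simp_all
    then have "?P \<noteq> 0" using g by auto
    moreover have "?P * ?R = ?P * ?Q" using P by (rule trans[OF _ sym])
    ultimately have "?R = ?Q" by (simp only: mult_cancel_left) simp
    with Q show ?thesis by (simp add: power2_eq_square)
  qed
  have d': "distinct [e, d, c, b, a]" using d by auto
  have ltn: "a < n" "b < n" "c < n" "d < n" "e < n" and nn: "real n = 5"
    using lt n by auto
  note nrm = quad_norm[unfolded sum_lessThan_five[OF n d lt] nn]
  have bc: "(cmod (quad a c b b))\<^sup>2 = 25 - 5 * g"
    using nrm[OF ltn(1,2,3)] v[of c d e] v[of c e d] d d' lt ltn by (auto simp: quad_repeated_row)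
  have bd: "(cmod (quad a d b b))\<^sup>2 = 25 - 5 * g"
    using nrm[OF ltn(1,2,4)] v[of d c e] v[of d e c] d d' lt ltn by (auto simp: quad_repeated_row)
  have be: "(cmod (quad a e b b))\<^sup>2 = 25 - 5 * g"
    using nrm[OF ltn(1,2,5)] v[of e c d] v[of e d c] d d' lt ltn by (auto simp: quad_repeated_row)
  have fl: "cmod (quad b b a j) = cmod (quad a j b b)" for j
    by (rule cmod_quad_flip)
  have "g\<^sup>2 + (25 - 5 * g) + (25 - 5 * g) + (25 - 5 * g) = 25"
    using nrm[OF ltn(2,1,2)] d d' ltn bc bd be by (simp add: quad_repeated_row fl g_def)
  then have "(g - 5) * (g - 10) = 0"
    by (simp add: algebra_simps power2_eq_square)
  moreover have "g \<le> 5"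
  proof -
    have "g \<le> (\<Sum>l<n. cmod (h a l * h a l * cnj (h b l) * cnj (h b l)))"
      unfolding g_def quad_def by (rule norm_sum)
    then show ?thesis
      using n lt by (simp add: norm_mult unimodular)
  qed
  ultimately have g5: "g = 5" by auto
  then have zero: "quad b b a c = 0" "quad b b a d = 0" "quad b b a e = 0"
    using bc bd be fl[of c] fl[of d] fl[of e] by simp_all
  define \<kappa> where "\<kappa> = quad b b a a / 5"
  have sq: "(h b l * cnj (h a l))\<^sup>2 = \<kappa>" if l: "l < n" for l
  proof -
    have "h b l * h b l * cnj (h a l) = (\<Sum>k<n. quad b b a k * h k l) / of_nat n"
      unfolding quad_def by (rule expansion[OF l])
    also have "(\<Sum>k<n. quad b b a k * h k l) = quad b b a a * h a l"
      unfolding sum_lessThan_five[OF n d lt] using ltn d d' zero by (simp add: quad_repeated_row)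
    also have "\<dots> / of_nat n = \<kappa> * h a l"
      unfolding \<kappa>_def n by simp
    finally have "h b l * h b l * cnj (h a l) * cnj (h a l) = \<kappa> * (h a l * cnj (h a l))"
      by simp
    then show ?thesis
      using unimodular_cnj(1)[OF unimodular[OF ltn(1) l]] by (simp add: power2_eq_square mult_ac)
  qed
  define x where "x l = h b l * cnj (h a l)" for l
  have pm: "x l = x 0 \<or> x l = - x 0" if "l < n" for l
    unfolding x_def power2_eq_iff[symmetric] using sq[OF that] sq[OF n_pos] by simp
  have "x 0 \<noteq> 0"
    using ratio_unimodular[of b a 0] lt n by (auto simp: x_def)
  moreover have "(\<Sum>l<n. x l) = 0"
    using rows_orthogonal[OF ltn(2,1)] d by (auto simp: x_def)
  then have "x 0 + x (Suc 0) + x 2 + x 3 + x 4 = 0"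
    unfolding n sum_lessThan_345 .
  ultimately show False
    using pm[of "Suc 0"] pm[of 2] pm[of 3] pm[of 4] n by auto
qed

lemma order_five_fourier:
  assumes n: "n = 5"
  shows fourier_rows
proof (rule ratio_square_sum_zero_fourier)
  have "quad 1 1 0 0 = 0"
    by (rule order_five_square_sum_zero[OF n, of 1 0 2 3 4]) auto
  then show "(\<Sum>l<n. (h 1 l * cnj (h 0 l))\<^sup>2) = 0"
    by (simp add: quad_def power2_eq_square mult_ac)
qed (use n in auto)

end

section \<open>Order four\<close>

text \<open>The polynomial with these four roots has only even powers of the variable, because the sum of the
  numbers and, by conjugation, the sum of their inverses vanish. So they form two pairs of opposite
  numbers.\<close>

lemma unimodular_quadruple_opposite:
  fixes a b c d :: complex
  assumes u: "cmod a = 1" "cmod b = 1" "cmod c = 1" "cmod d = 1" and s: "a + b + c + d = 0"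
  shows "b = - a \<and> d = - c \<or> c = - a \<and> d = - b \<or> d = - a \<and> c = - b"
proof -
  have nz: "a \<noteq> 0" "b \<noteq> 0" "c \<noteq> 0" "d \<noteq> 0" using u by auto
  have "1 / a + 1 / b + 1 / c + 1 / d = 0"
    using arg_cong[OF s, of cnj] u by (simp add: unimodular_cnj_eq)
  then have "b * c * d + a * c * d + a * b * d + a * b * c = 0"
    using nz by (simp add: field_simps)
  moreover have "(a + b) * (a + c) * (a + d) = a ^ 2 * (a + b + c + d)
      + (b * c * d + a * c * d + a * b * d + a * b * c)"
    by (simp add: power2_eq_square algebra_simps)
  ultimately have "(a + b) * (a + c) * (a + d) = 0" using s by simp
  then have "a + b = 0 \<or> a + c = 0 \<or> a + d = 0" by simp
  then show ?thesis
  proof (elim disjE)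
    assume "a + b = 0"
    moreover have "c + d = (a + b + c + d) - (a + b)" by simp
    ultimately have "a + b = 0" "c + d = 0" using s by simp_all
    then show ?thesis by (simp add: add_eq_0_iff)
  next
    assume "a + c = 0"
    moreover have "b + d = (a + b + c + d) - (a + c)" by simp
    ultimately have "a + c = 0" "b + d = 0" using s by simp_all
    then show ?thesis by (simp add: add_eq_0_iff)
  next
    assume "a + d = 0"
    moreover have "b + c = (a + b + c + d) - (a + d)" by simp
    ultimately have "a + d = 0" "b + c = 0" using s by simp_all
    then show ?thesis by (simp add: add_eq_0_iff)
  qed
qed

text \<open>The quadruples here are \<open>(\<alpha>, -\<alpha>, \<beta>, -\<beta>)\<close> and \<open>(y0, y1, y2, y3)\<close>; the cases are the three
  ways in which the second one splits into opposite pairs.\<close>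

lemma orthogonal_quadruples_aux:
  fixes \<alpha> \<beta> y0 y1 y2 y3 :: complex
  assumes u: "cmod \<alpha> = 1" "cmod \<beta> = 1" "cmod y0 = 1" "cmod y1 = 1" "cmod y2 = 1" "cmod y3 = 1"
    and s: "y0 + y1 + y2 + y3 = 0" and o: "cnj \<alpha> * (y0 - y1) + cnj \<beta> * (y2 - y3) = 0"
  shows "\<alpha>\<^sup>2 = \<beta>\<^sup>2
      \<or> y1\<^sup>2 = y0\<^sup>2 \<and> y2\<^sup>2 = y0\<^sup>2 \<and> y3\<^sup>2 = y0\<^sup>2
      \<or> (y1 * cnj \<alpha>)\<^sup>2 = (y0 * cnj \<alpha>)\<^sup>2 \<and> (y2 * cnj \<beta>)\<^sup>2 = (y0 * cnj \<alpha>)\<^sup>2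
        \<and> (y3 * cnj \<beta>)\<^sup>2 = (y0 * cnj \<alpha>)\<^sup>2"
  using unimodular_quadruple_opposite[OF u(3-6) s]
proof (elim disjE conjE)
  assume y: "y1 = - y0" "y3 = - y2"
  then have "2 * (cnj \<alpha> * y0 + cnj \<beta> * y2) = 0"
    using o by (simp add: algebra_simps)
  then have "y2 * cnj \<beta> = - (y0 * cnj \<alpha>)"
    by (simp only: mult_eq_0_iff) (simp add: add_eq_0_iff mult.commute)
  with y show ?thesis by simp
next
  assume y: "y2 = - y0" "y3 = - y1"
  then have "(cnj \<alpha> - cnj \<beta>) * (y0 - y1) = 0"
    using o by (simp add: algebra_simps)
  then have "cnj \<alpha> = cnj \<beta> \<or> y0 = y1" by simp
  with y show ?thesis by auto
next
  assume y: "y3 = - y0" "y2 = - y1"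
  then have "(cnj \<alpha> + cnj \<beta>) * (y0 - y1) = 0"
    using o by (simp add: algebra_simps)
  then have "cnj \<beta> = cnj (- \<alpha>) \<or> y0 = y1"
    by (simp add: add_eq_0_iff)
  then have "\<beta> = - \<alpha> \<or> y0 = y1" by (simp only: complex_cnj_cancel_iff)
  with y show ?thesis by auto
qed

text \<open>Applied to the ratios of rows 1 and 2 to row 0 this says that among any three rows of a Hadamard
  matrix of order four there are two whose ratio takes, up to a factor, only the values 1 and -1.\<close>

lemma orthogonal_quadruples_special:
  fixes x y :: "nat \<Rightarrow> complex"
  assumes u: "\<And>l. l < 4 \<Longrightarrow> cmod (x l) = 1" "\<And>l. l < 4 \<Longrightarrow> cmod (y l) = 1"
    and s: "(\<Sum>l<4. x l) = 0" "(\<Sum>l<4. y l) = 0" "(\<Sum>l<4. y l * cnj (x l)) = 0"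
  shows "(\<forall>l<4. (x l)\<^sup>2 = (x 0)\<^sup>2) \<or> (\<forall>l<4. (y l)\<^sup>2 = (y 0)\<^sup>2)
      \<or> (\<forall>l<4. (y l * cnj (x l))\<^sup>2 = (y 0 * cnj (x 0))\<^sup>2)"
proof -
  have v: "cmod (x 0) = 1" "cmod (x (Suc 0)) = 1" "cmod (x 2) = 1" "cmod (x 3) = 1"
    and w: "cmod (y 0) = 1" "cmod (y (Suc 0)) = 1" "cmod (y 2) = 1" "cmod (y 3) = 1"
    using u by simp_all
  have sx: "x 0 + x (Suc 0) + x 2 + x 3 = 0" and sy: "y 0 + y (Suc 0) + y 2 + y 3 = 0"
    and sxy: "y 0 * cnj (x 0) + y (Suc 0) * cnj (x (Suc 0)) + y 2 * cnj (x 2) + y 3 * cnj (x 3) = 0"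
    using s unfolding sum_lessThan_345 .
  have all4: "(\<forall>l<4. P l) \<longleftrightarrow> P 0 \<and> P (Suc 0) \<and> P 2 \<and> P 3" for P :: "nat \<Rightarrow> bool"
    by (auto simp: less_345_iff)
  show ?thesis
    using unimodular_quadruple_opposite[OF v sx] unfolding all4
  proof (elim disjE conjE)
    assume x: "x (Suc 0) = - x 0" "x 3 = - x 2"
    have "cnj (x 0) * (y 0 - y (Suc 0)) + cnj (x 2) * (y 2 - y 3) = 0"
      using sxy by (simp add: x algebra_simps)
    from orthogonal_quadruples_aux[OF v(1,3) w(1,2,3,4) _ this] show
      "(x 0)\<^sup>2 = (x 0)\<^sup>2 \<and> (x (Suc 0))\<^sup>2 = (x 0)\<^sup>2 \<and> (x 2)\<^sup>2 = (x 0)\<^sup>2 \<and> (x 3)\<^sup>2 = (x 0)\<^sup>2 \<or>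
       (y 0)\<^sup>2 = (y 0)\<^sup>2 \<and> (y (Suc 0))\<^sup>2 = (y 0)\<^sup>2 \<and> (y 2)\<^sup>2 = (y 0)\<^sup>2 \<and> (y 3)\<^sup>2 = (y 0)\<^sup>2 \<or>
       (y 0 * cnj (x 0))\<^sup>2 = (y 0 * cnj (x 0))\<^sup>2 \<and> (y (Suc 0) * cnj (x (Suc 0)))\<^sup>2 = (y 0 * cnj (x 0))\<^sup>2
       \<and> (y 2 * cnj (x 2))\<^sup>2 = (y 0 * cnj (x 0))\<^sup>2 \<and> (y 3 * cnj (x 3))\<^sup>2 = (y 0 * cnj (x 0))\<^sup>2"
      using sy by (auto simp: x)
  next
    assume x: "x 2 = - x 0" "x 3 = - x (Suc 0)"
    have "cnj (x 0) * (y 0 - y 2) + cnj (x (Suc 0)) * (y (Suc 0) - y 3) = 0"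
      using sxy by (simp add: x algebra_simps)
    from orthogonal_quadruples_aux[OF v(1,2) w(1,3,2,4) _ this] show
      "(x 0)\<^sup>2 = (x 0)\<^sup>2 \<and> (x (Suc 0))\<^sup>2 = (x 0)\<^sup>2 \<and> (x 2)\<^sup>2 = (x 0)\<^sup>2 \<and> (x 3)\<^sup>2 = (x 0)\<^sup>2 \<or>
       (y 0)\<^sup>2 = (y 0)\<^sup>2 \<and> (y (Suc 0))\<^sup>2 = (y 0)\<^sup>2 \<and> (y 2)\<^sup>2 = (y 0)\<^sup>2 \<and> (y 3)\<^sup>2 = (y 0)\<^sup>2 \<or>
       (y 0 * cnj (x 0))\<^sup>2 = (y 0 * cnj (x 0))\<^sup>2 \<and> (y (Suc 0) * cnj (x (Suc 0)))\<^sup>2 = (y 0 * cnj (x 0))\<^sup>2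
       \<and> (y 2 * cnj (x 2))\<^sup>2 = (y 0 * cnj (x 0))\<^sup>2 \<and> (y 3 * cnj (x 3))\<^sup>2 = (y 0 * cnj (x 0))\<^sup>2"
      using sy by (auto simp: x add_ac)
  next
    assume x: "x 3 = - x 0" "x 2 = - x (Suc 0)"
    have "cnj (x 0) * (y 0 - y 3) + cnj (x (Suc 0)) * (y (Suc 0) - y 2) = 0"
      using sxy by (simp add: x algebra_simps)
    from orthogonal_quadruples_aux[OF v(1,2) w(1,4,2,3) _ this] show
      "(x 0)\<^sup>2 = (x 0)\<^sup>2 \<and> (x (Suc 0))\<^sup>2 = (x 0)\<^sup>2 \<and> (x 2)\<^sup>2 = (x 0)\<^sup>2 \<and> (x 3)\<^sup>2 = (x 0)\<^sup>2 \<or>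
       (y 0)\<^sup>2 = (y 0)\<^sup>2 \<and> (y (Suc 0))\<^sup>2 = (y 0)\<^sup>2 \<and> (y 2)\<^sup>2 = (y 0)\<^sup>2 \<and> (y 3)\<^sup>2 = (y 0)\<^sup>2 \<or>
       (y 0 * cnj (x 0))\<^sup>2 = (y 0 * cnj (x 0))\<^sup>2 \<and> (y (Suc 0) * cnj (x (Suc 0)))\<^sup>2 = (y 0 * cnj (x 0))\<^sup>2
       \<and> (y 2 * cnj (x 2))\<^sup>2 = (y 0 * cnj (x 0))\<^sup>2 \<and> (y 3 * cnj (x 3))\<^sup>2 = (y 0 * cnj (x 0))\<^sup>2"
      using sy by (auto simp: x add_ac)
  qed
qed

text \<open>If \<open>y\<close> is the ratio of row \<open>m\<close> to row \<open>k\<close>, this is, up to the factor 16, the product of the entries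
  \<open>(m, k)\<close> and \<open>(k, m)\<close> of the matrix obtained from \<open>diag (1, \<i>, -1, -\<i>)\<close> by conjugation with the unitary
  matrix \<open>h / 2\<close>.\<close>

definition phase_weight :: "(nat \<Rightarrow> complex) \<Rightarrow> complex" where
  "phase_weight y = (\<Sum>l<4. \<i> ^ l * y l) * (\<Sum>l<4. \<i> ^ l * cnj (y l))"

lemma phase_weight_expand:
  "phase_weight y = (y 0 + \<i> * y (Suc 0) - y 2 - \<i> * y 3)
     * (cnj (y 0) + \<i> * cnj (y (Suc 0)) - cnj (y 2) - \<i> * cnj (y 3))"
  by (simp add: phase_weight_def sum_lessThan_345 eval_nat_numeral algebra_simps)

lemma unimodular_real_part:
  assumes "cmod s = 1" "cmod t = 1"
  obtains \<rho> :: real where "s * cnj t + t * cnj s = 2 * of_real \<rho>" "\<bar>\<rho>\<bar> \<le> 1"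
    "s\<^sup>2 + t\<^sup>2 = s * t * (2 * of_real \<rho>)"
proof
  show *: "s * cnj t + t * cnj s = 2 * of_real (Re (s * cnj t))"
    using complex_add_cnj[of "s * cnj t"] by (simp add: mult.commute)
  show "\<bar>Re (s * cnj t)\<bar> \<le> 1"
    using abs_Re_le_cmod[of "s * cnj t"] assms by (simp add: norm_mult)
  have nz: "s \<noteq> 0" "t \<noteq> 0" using assms by auto
  have "s * t * (s * cnj t + t * cnj s) = s\<^sup>2 + t\<^sup>2"
    using nz assms by (simp add: unimodular_cnj_eq power2_eq_square field_simps)
  then show "s\<^sup>2 + t\<^sup>2 = s * t * (2 * of_real (Re (s * cnj t)))"
    by (simp only: *)
qed

text \<open>With \<open>(s, -s, t, -t)\<close> and \<open>(s', -s', t', -t')\<close> as two orthogonal rows, the cosine of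
  the angle between the two components changes its sign from one row to the other.\<close>

lemma special_pair_aux:
  fixes s t s' t' :: complex
  assumes u: "cmod s = 1" "cmod t = 1" "cmod s' = 1" "cmod t' = 1"
    and o: "s * cnj s' + t * cnj t' = 0"
  shows "s' * cnj t' + t' * cnj s' = - (s * cnj t + t * cnj s)"
proof -
  have nz: "s \<noteq> 0" "t \<noteq> 0" "s' \<noteq> 0" "t' \<noteq> 0" using u by auto
  have "s * t' = - (t * s')"
    using o nz u by (simp add: unimodular_cnj_eq field_simps add_eq_0_iff)
  then have "s' / t' = - (s / t)" "t' / s' = - (t / s)"
    using nz by (simp_all add: field_simps)
  then show ?thesis using u by (simp add: unimodular_cnj_eq)
qed

text \<open>After rescaling, \<open>r\<close> is a balanced sign vector. The rows \<open>y\<close> and \<open>z\<close> are orthogonal to \<open>r\<close>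
  and to the constant row, so each of them consists of opposite pairs on the two level sets of \<open>r\<close>. Let \<open>\<rho>\<close>
  be the cosine of the angle between the two pairs of \<open>y\<close>; for \<open>z\<close> it is \<open>-\<rho>\<close>. The weights of
  \<open>r, y, z\<close> are explicit: they are \<open>8\<i>, -4\<i>(1 - \<rho>), -4\<i>(1 + \<rho>)\<close>, or \<open>0, 8\<i>\<rho>, -8\<i>\<rho>\<close>, or
  \<open>-8\<i>, 4\<i>(1 + \<rho>), 4\<i>(1 - \<rho>)\<close>, according to the sign pattern. In each case a coincidence of two
  weights forces \<open>\<rho> = 0\<close>, and the square sum of \<open>y\<close> is proportional to \<open>\<rho>\<close>.\<close>

lemma special_pair_square_sum:
  fixes r y z :: "nat \<Rightarrow> complex"
  assumes u: "\<And>l. l < 4 \<Longrightarrow> cmod (r l) = 1" "\<And>l. l < 4 \<Longrightarrow> cmod (y l) = 1" "\<And>l. l < 4 \<Longrightarrow> cmod (z l) = 1"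
    and r: "(\<Sum>l<4. r l) = 0" "\<And>l. l < 4 \<Longrightarrow> (r l)\<^sup>2 = (r 0)\<^sup>2"
    and y: "(\<Sum>l<4. y l) = 0" "(\<Sum>l<4. y l * cnj (r l)) = 0"
    and z: "(\<Sum>l<4. z l) = 0" "(\<Sum>l<4. z l * cnj (r l)) = 0"
    and yz: "(\<Sum>l<4. y l * cnj (z l)) = 0"
    and W: "phase_weight r = phase_weight y \<or> phase_weight y = phase_weight z \<or> phase_weight r = phase_weight z"
  shows "(\<Sum>l<4. (y l)\<^sup>2) = 0"
proof -
  have w: "cmod (y 0) = 1" "cmod (y (Suc 0)) = 1" "cmod (y 2) = 1" "cmod (y 3) = 1"
    and w': "cmod (z 0) = 1" "cmod (z (Suc 0)) = 1" "cmod (z 2) = 1" "cmod (z 3) = 1"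
    using u by simp_all
  have r0: "r 0 \<noteq> 0" "cnj (r 0) \<noteq> 0" "r 0 * cnj (r 0) = 1" using u(1)[of 0] by auto
  have rs: "r 0 + r (Suc 0) + r 2 + r 3 = 0" and ys: "y 0 + y (Suc 0) + y 2 + y 3 = 0"
    and yr: "y 0 * cnj (r 0) + y (Suc 0) * cnj (r (Suc 0)) + y 2 * cnj (r 2) + y 3 * cnj (r 3) = 0"
    and zs: "z 0 + z (Suc 0) + z 2 + z 3 = 0"
    and zr: "z 0 * cnj (r 0) + z (Suc 0) * cnj (r (Suc 0)) + z 2 * cnj (r 2) + z 3 * cnj (r 3) = 0"
    and yz': "y 0 * cnj (z 0) + y (Suc 0) * cnj (z (Suc 0)) + y 2 * cnj (z 2) + y 3 * cnj (z 3) = 0"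
    using r(1) y z yz unfolding sum_lessThan_345 .
  \<comment> \<open>Orthogonality to the constant row and to the sign vector separates the two level sets.\<close>
  have split: "p = - q \<and> p' = - q'"
    if "p + q + p' + q' = 0" "(p + q - p' - q') * cnj (r 0) = 0"
    for p q p' q' :: complex
  proof -
    have d: "p + q - p' - q' = 0" using that(2) r0 by simp
    have "2 * (p + q) = (p + q + p' + q') + (p + q - p' - q')" by simp
    also have "\<dots> = 0" by (simp only: that(1) d) simp
    finally have pq: "p + q = 0" by (simp only: mult_eq_0_iff) simp
    have "2 * (p' + q') = (p + q + p' + q') - (p + q - p' - q')" by simp
    also have "\<dots> = 0" by (simp only: that(1) d) simp
    finally have "p' + q' = 0" by (simp only: mult_eq_0_iff) simp
    with pq show ?thesis by (simp add: eq_neg_iff_add_eq_0)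
  qed
  have square: "(\<Sum>l<4. (y l)\<^sup>2) = (y 0)\<^sup>2 + (y (Suc 0))\<^sup>2 + (y 2)\<^sup>2 + (y 3)\<^sup>2"
    by (rule sum_lessThan_345)
  have pm: "r l = r 0 \<or> r l = - r 0" if "l < 4" for l
    using r(2)[OF that] by (simp add: power2_eq_iff)
  have "r (Suc 0) = r 0 \<and> r 2 = - r 0 \<and> r 3 = - r 0 \<or> r (Suc 0) = - r 0 \<and> r 2 = r 0 \<and> r 3 = - r 0
      \<or> r (Suc 0) = - r 0 \<and> r 2 = - r 0 \<and> r 3 = r 0"
    using pm[of "Suc 0"] pm[of 2] pm[of 3] rs r0 by auto
  then show ?thesis
  proof (elim disjE conjE)
    assume r: "r (Suc 0) = r 0" "r 2 = - r 0" "r 3 = - r 0"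
    have y: "y (Suc 0) = - y 0" "y 3 = - y 2"
    proof -
      have "y (Suc 0) + y 0 + y 3 + y 2 = 0"
        using ys by (simp only: add_ac)
      moreover have "(y (Suc 0) + y 0 - y 3 - y 2) * cnj (r 0) = y 0 * cnj (r 0) + y (Suc 0) * cnj (r (Suc 0)) + y 2 * cnj (r 2) + y 3 * cnj (r 3)"
        by (simp add: r algebra_simps)
      ultimately show "y (Suc 0) = - y 0" "y 3 = - y 2"
        using split[of "y (Suc 0)" "y 0" "y 3" "y 2"] yr by simp_all
    qed
    have z: "z (Suc 0) = - z 0" "z 3 = - z 2"
    proof -
      have "z (Suc 0) + z 0 + z 3 + z 2 = 0"
        using zs by (simp only: add_ac)
      moreover have "(z (Suc 0) + z 0 - z 3 - z 2) * cnj (r 0) = z 0 * cnj (r 0) + z (Suc 0) * cnj (r (Suc 0)) + z 2 * cnj (r 2) + z 3 * cnj (r 3)"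
        by (simp add: r algebra_simps)
      ultimately show "z (Suc 0) = - z 0" "z 3 = - z 2"
        using split[of "z (Suc 0)" "z 0" "z 3" "z 2"] zr by simp_all
    qed
    obtain \<rho> where \<rho>: "y 0 * cnj (y 2) + y 2 * cnj (y 0) = 2 * of_real \<rho>" "\<bar>\<rho>\<bar> \<le> 1"
      "(y 0)\<^sup>2 + (y 2)\<^sup>2 = y 0 * y 2 * (2 * of_real \<rho>)"
      using unimodular_real_part[OF w(1,3)] by metis
    have "2 * (y 0 * cnj (z 0) + y 2 * cnj (z 2)) = y 0 * cnj (z 0) + y (Suc 0) * cnj (z (Suc 0)) + y 2 * cnj (z 2) + y 3 * cnj (z 3)"
      by (simp add: y z)
    then have "2 * (y 0 * cnj (z 0) + y 2 * cnj (z 2)) = 0"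
      by (simp only: yz')
    then have zz: "z 0 * cnj (z 2) + z 2 * cnj (z 0) = - (2 * of_real \<rho>)"
      unfolding \<rho>(1)[symmetric] by (intro special_pair_aux w w') (simp only: mult_eq_0_iff, simp)
    have "phase_weight r = 8 * \<i> * (r 0 * cnj (r 0))"
      by (simp add: phase_weight_expand r algebra_simps)
    then have Wr: "phase_weight r = 8 * \<i>" using r0 by simp
    have W_eq: "phase_weight v = - 2 * \<i> * (v 0 * cnj (v 0) + v 2 * cnj (v 2) - (v 0 * cnj (v 2) + v 2 * cnj (v 0)))"
      if "v (Suc 0) = - v 0" "v 3 = - v 2" for v
      by (simp add: phase_weight_expand that algebra_simps)
    have "phase_weight y = - 2 * \<i> * (1 + 1 - 2 * of_real \<rho>)"
      by (simp only: W_eq[OF y] \<rho>(1) unimodular_cnj(1)[OF w(1)] unimodular_cnj(1)[OF w(3)])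
    moreover have "phase_weight z = - 2 * \<i> * (1 + 1 - - (2 * of_real \<rho>))"
      by (simp only: W_eq[OF z] zz unimodular_cnj(1)[OF w'(1)] unimodular_cnj(1)[OF w'(3)])
    ultimately have "\<rho> = 0"
      using W \<rho>(2) by (auto simp: Wr complex_eq_iff)
    then have "(y 2)\<^sup>2 = - (y 0)\<^sup>2"
      using \<rho>(3) by (simp add: add_eq_0_iff)
    then show ?thesis unfolding square y by simp
  next
    assume r: "r (Suc 0) = - r 0" "r 2 = r 0" "r 3 = - r 0"
    have y: "y 2 = - y 0" "y 3 = - y (Suc 0)"
    proof -
      have "y 2 + y 0 + y 3 + y (Suc 0) = 0"
        using ys by (simp only: add_ac)
      moreover have "(y 2 + y 0 - y 3 - y (Suc 0)) * cnj (r 0) = y 0 * cnj (r 0) + y (Suc 0) * cnj (r (Suc 0)) + y 2 * cnj (r 2) + y 3 * cnj (r 3)"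
        by (simp add: r algebra_simps)
      ultimately show "y 2 = - y 0" "y 3 = - y (Suc 0)"
        using split[of "y 2" "y 0" "y 3" "y (Suc 0)"] yr by simp_all
    qed
    have z: "z 2 = - z 0" "z 3 = - z (Suc 0)"
    proof -
      have "z 2 + z 0 + z 3 + z (Suc 0) = 0"
        using zs by (simp only: add_ac)
      moreover have "(z 2 + z 0 - z 3 - z (Suc 0)) * cnj (r 0) = z 0 * cnj (r 0) + z (Suc 0) * cnj (r (Suc 0)) + z 2 * cnj (r 2) + z 3 * cnj (r 3)"
        by (simp add: r algebra_simps)
      ultimately show "z 2 = - z 0" "z 3 = - z (Suc 0)"
        using split[of "z 2" "z 0" "z 3" "z (Suc 0)"] zr by simp_all
    qed
    obtain \<rho> where \<rho>: "y 0 * cnj (y (Suc 0)) + y (Suc 0) * cnj (y 0) = 2 * of_real \<rho>" "\<bar>\<rho>\<bar> \<le> 1"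
      "(y 0)\<^sup>2 + (y (Suc 0))\<^sup>2 = y 0 * y (Suc 0) * (2 * of_real \<rho>)"
      using unimodular_real_part[OF w(1,2)] by metis
    have "2 * (y 0 * cnj (z 0) + y (Suc 0) * cnj (z (Suc 0))) = y 0 * cnj (z 0) + y (Suc 0) * cnj (z (Suc 0)) + y 2 * cnj (z 2) + y 3 * cnj (z 3)"
      by (simp add: y z)
    then have "2 * (y 0 * cnj (z 0) + y (Suc 0) * cnj (z (Suc 0))) = 0"
      by (simp only: yz')
    then have zz: "z 0 * cnj (z (Suc 0)) + z (Suc 0) * cnj (z 0) = - (2 * of_real \<rho>)"
      unfolding \<rho>(1)[symmetric] by (intro special_pair_aux w w') (simp only: mult_eq_0_iff, simp)
    have Wr: "phase_weight r = 0"
      by (simp add: phase_weight_expand r algebra_simps)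
    have W_eq: "phase_weight v = 4 * (v 0 * cnj (v 0) - v (Suc 0) * cnj (v (Suc 0)))
        + 4 * \<i> * (v 0 * cnj (v (Suc 0)) + v (Suc 0) * cnj (v 0))"
      if "v 2 = - v 0" "v 3 = - v (Suc 0)" for v
      by (simp add: phase_weight_expand that algebra_simps)
    have "phase_weight y = 4 * (1 - 1) + 4 * \<i> * (2 * of_real \<rho>)"
      by (simp only: W_eq[OF y] \<rho>(1) unimodular_cnj(1)[OF w(1)] unimodular_cnj(1)[OF w(2)])
    moreover have "phase_weight z = 4 * (1 - 1) + 4 * \<i> * - (2 * of_real \<rho>)"
      by (simp only: W_eq[OF z] zz unimodular_cnj(1)[OF w'(1)] unimodular_cnj(1)[OF w'(2)])
    ultimately have "\<rho> = 0"
      using W \<rho>(2) by (auto simp: Wr complex_eq_iff)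
    then have "(y (Suc 0))\<^sup>2 = - (y 0)\<^sup>2"
      using \<rho>(3) by (simp add: add_eq_0_iff)
    then show ?thesis unfolding square y by simp
  next
    assume r: "r (Suc 0) = - r 0" "r 2 = - r 0" "r 3 = r 0"
    have y: "y 3 = - y 0" "y 2 = - y (Suc 0)"
    proof -
      have "y 3 + y 0 + y 2 + y (Suc 0) = 0"
        using ys by (simp only: add_ac)
      moreover have "(y 3 + y 0 - y 2 - y (Suc 0)) * cnj (r 0) = y 0 * cnj (r 0) + y (Suc 0) * cnj (r (Suc 0)) + y 2 * cnj (r 2) + y 3 * cnj (r 3)"
        by (simp add: r algebra_simps)
      ultimately show "y 3 = - y 0" "y 2 = - y (Suc 0)"
        using split[of "y 3" "y 0" "y 2" "y (Suc 0)"] yr by simp_all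
    qed
    have z: "z 3 = - z 0" "z 2 = - z (Suc 0)"
    proof -
      have "z 3 + z 0 + z 2 + z (Suc 0) = 0"
        using zs by (simp only: add_ac)
      moreover have "(z 3 + z 0 - z 2 - z (Suc 0)) * cnj (r 0) = z 0 * cnj (r 0) + z (Suc 0) * cnj (r (Suc 0)) + z 2 * cnj (r 2) + z 3 * cnj (r 3)"
        by (simp add: r algebra_simps)
      ultimately show "z 3 = - z 0" "z 2 = - z (Suc 0)"
        using split[of "z 3" "z 0" "z 2" "z (Suc 0)"] zr by simp_all
    qed
    obtain \<rho> where \<rho>: "y 0 * cnj (y (Suc 0)) + y (Suc 0) * cnj (y 0) = 2 * of_real \<rho>" "\<bar>\<rho>\<bar> \<le> 1"
      "(y 0)\<^sup>2 + (y (Suc 0))\<^sup>2 = y 0 * y (Suc 0) * (2 * of_real \<rho>)"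
      using unimodular_real_part[OF w(1,2)] by metis
    have "2 * (y 0 * cnj (z 0) + y (Suc 0) * cnj (z (Suc 0))) = y 0 * cnj (z 0) + y (Suc 0) * cnj (z (Suc 0)) + y 2 * cnj (z 2) + y 3 * cnj (z 3)"
      by (simp add: y z)
    then have "2 * (y 0 * cnj (z 0) + y (Suc 0) * cnj (z (Suc 0))) = 0"
      by (simp only: yz')
    then have zz: "z 0 * cnj (z (Suc 0)) + z (Suc 0) * cnj (z 0) = - (2 * of_real \<rho>)"
      unfolding \<rho>(1)[symmetric] by (intro special_pair_aux w w') (simp only: mult_eq_0_iff, simp)
    have "phase_weight r = - 8 * \<i> * (r 0 * cnj (r 0))"
      by (simp add: phase_weight_expand r algebra_simps)
    then have Wr: "phase_weight r = - 8 * \<i>" using r0 by simp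
    have W_eq: "phase_weight v = 2 * \<i> * (v 0 * cnj (v 0) + v (Suc 0) * cnj (v (Suc 0))
        + (v 0 * cnj (v (Suc 0)) + v (Suc 0) * cnj (v 0)))"
      if "v 3 = - v 0" "v 2 = - v (Suc 0)" for v
      by (simp add: phase_weight_expand that algebra_simps)
    have "phase_weight y = 2 * \<i> * (1 + 1 + 2 * of_real \<rho>)"
      by (simp only: W_eq[OF y] \<rho>(1) unimodular_cnj(1)[OF w(1)] unimodular_cnj(1)[OF w(2)])
    moreover have "phase_weight z = 2 * \<i> * (1 + 1 + - (2 * of_real \<rho>))"
      by (simp only: W_eq[OF z] zz unimodular_cnj(1)[OF w'(1)] unimodular_cnj(1)[OF w'(2)])
    ultimately have "\<rho> = 0"
      using W \<rho>(2) by (auto simp: Wr complex_eq_iff)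
    then have "(y (Suc 0))\<^sup>2 = - (y 0)\<^sup>2"
      using \<rho>(3) by (simp add: add_eq_0_iff)
    then show ?thesis unfolding square y by simp
  qed
qed

lemma phase_weight_ratio_commute:
  "phase_weight (\<lambda>l. h a l * cnj (h b l)) = phase_weight (\<lambda>l. h b l * cnj (h a l))"
  by (simp add: phase_weight_def mult_ac)

context hadamard_array
begin

lemma ratio_product:
  assumes "l < n" "a < n" "b < n" "c < n"
  shows "(h b l * cnj (h a l)) * cnj (h c l * cnj (h a l)) = h b l * cnj (h c l)"
proof -
  have "(h b l * cnj (h a l)) * cnj (h c l * cnj (h a l)) = h b l * cnj (h c l) * (h a l * cnj (h a l))"
    by (simp add: mult_ac)
  then show ?thesis
    using unimodular_cnj(1)[OF unimodular[OF assms(2,1)]] by simp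
qed

lemma ratio_orthogonal:
  assumes "a < n" "p < n" "q < n" "p \<noteq> q"
  shows "(\<Sum>l<n. (h p l * cnj (h a l)) * cnj (h q l * cnj (h a l))) = 0"
proof -
  have "(\<Sum>l<n. (h p l * cnj (h a l)) * cnj (h q l * cnj (h a l))) = (\<Sum>l<n. h p l * cnj (h q l))"
    using assms by (intro sum.cong refl ratio_product) auto
  then show ?thesis
    unfolding rows_orthogonal[OF assms(2-4)] .
qed

text \<open>The two cyclic neighbours of \<open>a\<close> are among \<open>b, c, d\<close>, so the hypothesis makes two of the three
  weights at \<open>a\<close> equal.\<close>

lemma special_pair_fourier:
  assumes n: "n = 4" and d: "distinct [a, b, c, d]" and lt: "a < 4" "b < 4" "c < 4" "d < 4"
    and special: "\<And>l. l < 4 \<Longrightarrow> (h b l * cnj (h a l))\<^sup>2 = (h b 0 * cnj (h a 0))\<^sup>2"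
    and cyclic: "\<And>m. m < 4 \<Longrightarrow> phase_weight (\<lambda>l. h m l * cnj (h ((m + 1) mod 4) l))
      = phase_weight (\<lambda>l. h m l * cnj (h ((m + 3) mod 4) l))"
  shows fourier_rows
proof (rule ratio_square_sum_zero_fourier)
  have ltn: "a < n" "b < n" "c < n" "d < n" using lt n by auto
  have prod: "(\<Sum>l<4. (h p l * cnj (h a l)) * cnj (h q l * cnj (h a l))) = 0"
    if "p < n" "q < n" "p \<noteq> q" for p q
    using ratio_orthogonal[OF ltn(1) that] unfolding n .
  have W: "phase_weight (\<lambda>l. h b l * cnj (h a l)) = phase_weight (\<lambda>l. h c l * cnj (h a l))
      \<or> phase_weight (\<lambda>l. h c l * cnj (h a l)) = phase_weight (\<lambda>l. h d l * cnj (h a l))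
      \<or> phase_weight (\<lambda>l. h b l * cnj (h a l)) = phase_weight (\<lambda>l. h d l * cnj (h a l))"
  proof -
    have "(a + 1) mod 4 \<in> {b, c, d}" "(a + 3) mod 4 \<in> {b, c, d}" "(a + 1) mod 4 \<noteq> (a + 3) mod 4"
      using lt d by (auto simp: less_345_iff)
    moreover have "phase_weight (\<lambda>l. h ((a + 1) mod 4) l * cnj (h a l))
        = phase_weight (\<lambda>l. h ((a + 3) mod 4) l * cnj (h a l))"
      using cyclic[OF lt(1)] phase_weight_ratio_commute[of h a "(a + 1) mod 4"]
        phase_weight_ratio_commute[of h a "(a + 3) mod 4"] by metis
    ultimately show ?thesis by auto
  qed
  have orth: "(\<Sum>l<4. h p l * cnj (h a l)) = 0" if "p < n" "p \<noteq> a" for p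
    using rows_orthogonal[OF that(1) ltn(1) that(2)] n by simp
  have "(\<Sum>l<4. (h c l * cnj (h a l))\<^sup>2) = 0"
    using d ltn n
    by (intro special_pair_square_sum[where r = "\<lambda>l. h b l * cnj (h a l)" and z = "\<lambda>l. h d l * cnj (h a l)"]
        orth prod special W ratio_unimodular) auto
  then show "(\<Sum>l<n. (h c l * cnj (h a l))\<^sup>2) = 0"
    using n by simp
qed (use assms in auto)

lemma order_four_fourier:
  assumes n: "n = 4"
    and cyclic: "\<And>m. m < 4 \<Longrightarrow> phase_weight (\<lambda>l. h m l * cnj (h ((m + 1) mod 4) l))
      = phase_weight (\<lambda>l. h m l * cnj (h ((m + 3) mod 4) l))"
  shows fourier_rows
proof -
  have lt: "0 < n" "1 < n" "2 < n" using n by auto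
  have r21: "h 2 l * cnj (h 0 l) * cnj (h 1 l * cnj (h 0 l)) = h 2 l * cnj (h 1 l)" if "l < 4" for l
    using that n by (intro ratio_product) auto
  have "(\<Sum>l<4. h 1 l * cnj (h 0 l)) = 0" "(\<Sum>l<4. h 2 l * cnj (h 0 l)) = 0"
    "(\<Sum>l<4. h 2 l * cnj (h 0 l) * cnj (h 1 l * cnj (h 0 l))) = 0"
    using rows_orthogonal[OF lt(2,1)] rows_orthogonal[OF lt(3,1)] ratio_orthogonal[OF lt(1,3,2)]
    unfolding n by simp_all
  moreover have "cmod (h 1 l * cnj (h 0 l)) = 1" "cmod (h 2 l * cnj (h 0 l)) = 1" if "l < 4" for l
    using ratio_unimodular[OF lt(2,1)] ratio_unimodular[OF lt(3,1)] that n by simp_all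
  ultimately consider
    "\<forall>l<4. (h 1 l * cnj (h 0 l))\<^sup>2 = (h 1 0 * cnj (h 0 0))\<^sup>2"
    | "\<forall>l<4. (h 2 l * cnj (h 0 l))\<^sup>2 = (h 2 0 * cnj (h 0 0))\<^sup>2"
    | "\<forall>l<4. (h 2 l * cnj (h 0 l) * cnj (h 1 l * cnj (h 0 l)))\<^sup>2
         = (h 2 0 * cnj (h 0 0) * cnj (h 1 0 * cnj (h 0 0)))\<^sup>2"
    using orthogonal_quadruples_special[of "\<lambda>l. h 1 l * cnj (h 0 l)" "\<lambda>l. h 2 l * cnj (h 0 l)"] by blast
  then show ?thesis
  proof cases
    case 1
    show ?thesis
    proof (rule special_pair_fourier[OF n, where a = 0 and b = 1 and c = 2 and d = 3])
      show "(h 1 l * cnj (h 0 l))\<^sup>2 = (h 1 0 * cnj (h 0 0))\<^sup>2" if "l < 4" for l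
        using 1 that by blast
    qed (simp_all only: cyclic, simp_all)
  next
    case 2
    show ?thesis
    proof (rule special_pair_fourier[OF n, where a = 0 and b = 2 and c = 1 and d = 3])
      show "(h 2 l * cnj (h 0 l))\<^sup>2 = (h 2 0 * cnj (h 0 0))\<^sup>2" if "l < 4" for l
        using 2 that by blast
    qed (simp_all only: cyclic, simp_all)
  next
    case 3
    have sq: "(h 2 l * cnj (h 1 l))\<^sup>2 = (h 2 0 * cnj (h 1 0))\<^sup>2" if "l < 4" for l
      using 3 that r21[OF that] r21[of 0] by (metis zero_less_numeral)
    show ?thesis
    proof (rule special_pair_fourier[OF n, where a = 1 and b = 2 and c = 0 and d = 3])
      show "(h 2 l * cnj (h 1 l))\<^sup>2 = (h 2 0 * cnj (h 1 0))\<^sup>2" if "l < 4" for l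
        using sq that by blast
    qed (simp_all only: cyclic, simp_all)
  qed
qed

end

section \<open>Adjoints, Euclidean norm and unitary matrices\<close>

lemma mat_adjoint_carrier [simp]: "A \<in> carrier_mat n m \<Longrightarrow> mat_adjoint A \<in> carrier_mat m n"
  by (auto simp: mat_adjoint_def)

lemma mat_adjoint_index [simp]:
  fixes A :: "complex mat"
  shows "i < dim_col A \<Longrightarrow> j < dim_row A \<Longrightarrow> mat_adjoint A $$ (i, j) = cnj (A $$ (j, i))"
  by (simp add: mat_adjoint_def mat_of_rows_index)

lemma mat_adjoint_dim [simp]:
  "dim_row (mat_adjoint A) = dim_col A" "dim_col (mat_adjoint A) = dim_row A"
  by (simp_all add: mat_adjoint_def)

lemma cscalar_prod_sum:
  fixes v w :: "complex vec"
  shows "w \<in> carrier_vec n \<Longrightarrow> v \<bullet>c w = (\<Sum>i<n. v $ i * cnj (w $ i))"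
  by (auto simp: scalar_prod_def atLeast0LessThan)

lemma mult_mat_vec_sum:
  fixes A :: "complex mat"
  assumes "A \<in> carrier_mat n m" "v \<in> carrier_vec m" "i < n"
  shows "(A *\<^sub>v v) $ i = (\<Sum>j<m. A $$ (i, j) * v $ j)"
  using assms by (auto simp: scalar_prod_def atLeast0LessThan)

lemma mat_adjoint_mult:
  fixes A B :: "complex mat"
  assumes "A \<in> carrier_mat n m" "B \<in> carrier_mat m k"
  shows "mat_adjoint (A * B) = mat_adjoint B * mat_adjoint A"
  using assms by (intro eq_matI) (auto simp: scalar_prod_def mult.commute)

lemma cscalar_prod_adjoint:
  fixes A :: "complex mat"
  assumes A: "A \<in> carrier_mat n m" and v: "v \<in> carrier_vec m" and w: "w \<in> carrier_vec n"
  shows "(A *\<^sub>v v) \<bullet>c w = v \<bullet>c (mat_adjoint A *\<^sub>v w)"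
proof -
  have "(A *\<^sub>v v) \<bullet>c w = (\<Sum>i<n. \<Sum>j<m. A $$ (i, j) * v $ j * cnj (w $ i))"
    using A v by (simp add: cscalar_prod_sum[OF w] mult_mat_vec_sum[OF A v] sum_distrib_right del: index_mult_mat_vec)
  also have "\<dots> = (\<Sum>j<m. \<Sum>i<n. A $$ (i, j) * v $ j * cnj (w $ i))"
    by (rule sum.swap)
  also have "\<dots> = (\<Sum>j<m. v $ j * cnj ((mat_adjoint A *\<^sub>v w) $ j))"
    using A by (intro sum.cong refl)
      (simp add: mult_mat_vec_sum[OF mat_adjoint_carrier[OF A] w] sum_distrib_left mult_ac del: index_mult_mat_vec)
  also have "\<dots> = v \<bullet>c (mat_adjoint A *\<^sub>v w)"
    using A w by (intro cscalar_prod_sum[symmetric] mult_mat_vec_carrier[of _ m n]) auto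
  finally show ?thesis .
qed

lemma cscalar_prod_cnj:
  fixes v w :: "complex vec"
  assumes "v \<in> carrier_vec n" "w \<in> carrier_vec n"
  shows "w \<bullet>c v = cnj (v \<bullet>c w)"
  by (simp add: cscalar_prod_sum[OF assms(1)] cscalar_prod_sum[OF assms(2)] mult.commute)

lemma cscalar_prod_self:
  fixes v :: "complex vec"
  assumes "v \<in> carrier_vec n"
  shows "v \<bullet>c v = of_real ((euclidean_norm v)\<^sup>2)"
  using assms by (simp add: cscalar_prod_sum[OF assms] euclidean_norm_def sum_nonneg complex_norm_square[symmetric]
      del: of_real_power)

lemma euclidean_norm_nonneg [simp]: "0 \<le> euclidean_norm v"
  by (simp add: euclidean_norm_def sum_nonneg)

lemma euclidean_norm_smult: "euclidean_norm (c \<cdot>\<^sub>v v) = cmod c * euclidean_norm v"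
  by (simp add: euclidean_norm_def norm_mult power_mult_distrib real_sqrt_mult flip: sum_distrib_left)

lemma euclidean_norm_eq_0:
  assumes "v \<in> carrier_vec n" "euclidean_norm v = 0"
  shows "v = 0\<^sub>v n"
proof (rule eq_vecI)
  fix i assume i: "i < dim_vec (0\<^sub>v n :: complex vec)"
  have "(\<Sum>i<n. (cmod (v $ i))\<^sup>2) = 0"
    using assms by (simp add: euclidean_norm_def)
  then have "(cmod (v $ i))\<^sup>2 = 0"
    using i by (subst (asm) sum_nonneg_eq_0_iff) auto
  then show "v $ i = 0\<^sub>v n $ i" using i by simp
qed (use assms in auto)

text \<open>Polarization: test vectors with two nonzero entries 1 and \<open>c\<close>, for \<open>c = 1\<close> and \<open>c = \<i>\<close>.\<close>

lemma quadratic_form_zero: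
  fixes Q :: "complex mat"
  assumes Q: "Q \<in> carrier_mat n n"
    and zero: "\<And>v. v \<in> carrier_vec n \<Longrightarrow> (Q *\<^sub>v v) \<bullet>c v = 0"
  shows "Q = 0\<^sub>m n n"
proof -
  have form: "(\<Sum>k<n. (\<Sum>l<n. Q $$ (k, l) * f l) * cnj (f k)) = 0" for f
  proof -
    have v: "vec n f \<in> carrier_vec n" by simp
    show ?thesis
      using zero[OF v] by (simp add: cscalar_prod_sum[OF v] mult_mat_vec_sum[OF Q v] del: index_mult_mat_vec)
  qed
  have diag: "Q $$ (i, i) = 0" if "i < n" for i
    using form[of "\<lambda>k. if k = i then 1 else 0"] that
    by (simp add: if_distrib[of cnj] if_distrib[of "(*) _"] cong: if_cong)
  have off: "c * Q $$ (i, j) + cnj c * Q $$ (j, i) = 0" if ij: "i < n" "j < n" "i \<noteq> j" for i j c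
  proof -
    have inner: "(\<Sum>l<n. Q $$ (k, l) * ((if l = i then 1 else 0) + (if l = j then c else 0)))
        = Q $$ (k, i) + Q $$ (k, j) * c" for k
      using ij by (simp add: distrib_left sum.distrib if_distrib[of "(*) _"] cong: if_cong)
    have "(\<Sum>k<n. (Q $$ (k, i) + Q $$ (k, j) * c) * cnj ((if k = i then 1 else 0) + (if k = j then c else 0))) = 0"
      using form[of "\<lambda>l. (if l = i then 1 else 0) + (if l = j then c else 0)"] unfolding inner .
    then have "Q $$ (i, i) + Q $$ (i, j) * c + (Q $$ (j, i) + Q $$ (j, j) * c) * cnj c = 0"
      using ij by (simp add: distrib_left sum.distrib if_distrib[of "(*) _"] if_distrib[of cnj] cong: if_cong)
    then show ?thesis using diag ij by (simp add: mult.commute)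
  qed
  have "Q $$ (i, j) = 0" if ij: "i < n" "j < n" "i \<noteq> j" for i j
    using off[OF ij, of 1] off[OF ij, of \<i>] by (simp add: add_eq_0_iff)
  with diag have "Q $$ (i, j) = 0" if "i < n" "j < n" for i j
    using that by (cases "i = j") auto
  then show ?thesis
    using Q by (intro eq_matI) auto
qed

lemma isometry_imp_unitary:
  assumes B: "B \<in> carrier_mat n n"
    and iso: "\<And>v. v \<in> carrier_vec n \<Longrightarrow> euclidean_norm (B *\<^sub>v v) = euclidean_norm v"
  shows "unitary_mat n B"
proof -
  define Q where "Q = mat_adjoint B * B - 1\<^sub>m n"
  have BB: "mat_adjoint B * B \<in> carrier_mat n n" using B by auto
  have "Q = 0\<^sub>m n n"
  proof (rule quadratic_form_zero)
    show "Q \<in> carrier_mat n n" unfolding Q_def by (rule minus_carrier_mat) simp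
    fix v :: "complex vec" assume v: "v \<in> carrier_vec n"
    have Bv: "B *\<^sub>v v \<in> carrier_vec n" using B v by simp
    have BBv: "mat_adjoint B *\<^sub>v (B *\<^sub>v v) \<in> carrier_vec n"
      by (rule mult_mat_vec_carrier[OF mat_adjoint_carrier[OF B] Bv])
    have "Q *\<^sub>v v = mat_adjoint B *\<^sub>v (B *\<^sub>v v) - v"
      unfolding Q_def minus_mult_distrib_mat_vec[OF BB one_carrier_mat v]
      using v assoc_mult_mat_vec[OF mat_adjoint_carrier[OF B] B v] by simp
    then have "(Q *\<^sub>v v) \<bullet>c v = (mat_adjoint B *\<^sub>v (B *\<^sub>v v)) \<bullet>c v - v \<bullet>c v"
      using minus_scalar_prod_distrib[OF BBv v carrier_vec_conjugate[OF v]] by simp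
    also have "(mat_adjoint B *\<^sub>v (B *\<^sub>v v)) \<bullet>c v = cnj (v \<bullet>c (mat_adjoint B *\<^sub>v (B *\<^sub>v v)))"
      by (rule cscalar_prod_cnj[OF v BBv])
    also have "v \<bullet>c (mat_adjoint B *\<^sub>v (B *\<^sub>v v)) = (B *\<^sub>v v) \<bullet>c (B *\<^sub>v v)"
      by (rule cscalar_prod_adjoint[OF B v Bv, symmetric])
    finally show "(Q *\<^sub>v v) \<bullet>c v = 0"
      by (simp add: cscalar_prod_self[OF v] cscalar_prod_self[OF Bv] iso[OF v])
  qed
  have "mat_adjoint B * B = 1\<^sub>m n"
  proof (rule eq_matI)
    fix i j assume ij: "i < dim_row (1\<^sub>m n :: complex mat)" "j < dim_col (1\<^sub>m n :: complex mat)"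
    then have "Q $$ (i, j) = (mat_adjoint B * B) $$ (i, j) - 1\<^sub>m n $$ (i, j)"
      unfolding Q_def by (simp del: index_mult_mat index_one_mat)
    then show "(mat_adjoint B * B) $$ (i, j) = 1\<^sub>m n $$ (i, j)"
      using ij \<open>Q = 0\<^sub>m n n\<close> by (simp del: index_mult_mat)
  qed (use B in auto)
  moreover from this have "B * mat_adjoint B = 1\<^sub>m n"
    by (rule mat_mult_left_right_inverse[rotated 2]) (use B in auto)
  ultimately show ?thesis using B by (simp add: unitary_mat_def)
qed

text \<open>The operator norm is a supremum in the reals, so the point is that the set of values is bounded
  above; a crude bound by the absolute values of the entries is enough.\<close>

lemma operator_norm_bound:
  assumes B: "B \<in> carrier_mat n n" and v: "v \<in> carrier_vec n"
  shows "euclidean_norm (B *\<^sub>v v) \<le> operator_norm B * euclidean_norm v"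
proof -
  let ?S = "{v \<in> carrier_vec (dim_col B). euclidean_norm v \<le> 1}"
  have "bdd_above ((\<lambda>v. euclidean_norm (B *\<^sub>v v)) ` ?S)"
  proof (rule bdd_aboveI2)
    fix u assume u: "u \<in> ?S"
    then have uc: "u \<in> carrier_vec n" and u1: "euclidean_norm u \<le> 1" using B by auto
    have entry: "cmod (u $ i) \<le> 1" if "i < n" for i
    proof -
      have "(cmod (u $ i))\<^sup>2 \<le> (\<Sum>i<n. (cmod (u $ i))\<^sup>2)"
        using that by (intro member_le_sum) auto
      also have "\<dots> = (euclidean_norm u)\<^sup>2"
        using uc by (simp add: euclidean_norm_def sum_nonneg)
      also have "\<dots> \<le> 1" using u1 by (simp add: power_le_one)
      finally show ?thesis by (simp add: power2_le_imp_le[of _ 1, simplified])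
    qed
    have "cmod ((B *\<^sub>v u) $ i) \<le> (\<Sum>j<n. cmod (B $$ (i, j)))" if "i < n" for i
    proof -
      have "cmod ((B *\<^sub>v u) $ i) \<le> (\<Sum>j<n. cmod (B $$ (i, j) * u $ j))"
        unfolding mult_mat_vec_sum[OF B uc that] by (rule norm_sum)
      also have "\<dots> \<le> (\<Sum>j<n. cmod (B $$ (i, j)))"
        using entry by (intro sum_mono) (simp add: norm_mult mult_left_le)
      finally show ?thesis .
    qed
    then show "euclidean_norm (B *\<^sub>v u) \<le> sqrt (\<Sum>i<n. (\<Sum>j<n. cmod (B $$ (i, j)))\<^sup>2)"
      unfolding euclidean_norm_def using B by (intro real_sqrt_le_mono) (auto intro!: sum_mono power_mono)
  qed
  then have unit_bound: "euclidean_norm (B *\<^sub>v u) \<le> operator_norm B" if "u \<in> ?S" for u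
    unfolding operator_norm_def using that by (rule cSUP_upper[rotated])
  show ?thesis
  proof (cases "euclidean_norm v = 0")
    case True
    then have "v = 0\<^sub>v n" using euclidean_norm_eq_0[OF v] by simp
    then have "B *\<^sub>v v = 0\<^sub>v n" using B by (intro eq_vecI) auto
    then show ?thesis unfolding True by (simp add: euclidean_norm_def)
  next
    case False
    define c where "c = complex_of_real (1 / euclidean_norm v)"
    have c: "cmod c = 1 / euclidean_norm v"
      unfolding c_def norm_of_real by simp
    have "euclidean_norm (c \<cdot>\<^sub>v v) = 1"
      using False by (simp add: euclidean_norm_smult c)
    then have "euclidean_norm (B *\<^sub>v (c \<cdot>\<^sub>v v)) \<le> operator_norm B"
      using v B by (intro unit_bound) auto
    moreover have "B *\<^sub>v (c \<cdot>\<^sub>v v) = c \<cdot>\<^sub>v (B *\<^sub>v v)"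
      using B v by (simp add: mult_mat_vec)
    ultimately have "euclidean_norm (B *\<^sub>v v) / euclidean_norm v \<le> operator_norm B"
      by (simp add: euclidean_norm_smult c)
    moreover have "0 < euclidean_norm v"
      using False euclidean_norm_nonneg[of v] by linarith
    ultimately show ?thesis by (simp add: divide_le_eq)
  qed
qed

text \<open>In \<open>|v| = |B^k v| \<le> |B v| \<le> |v|\<close> equality holds throughout.\<close>

lemma power_id_contraction_unitary:
  assumes n: "0 < k" and B: "B \<in> carrier_mat n n" and norm: "operator_norm B \<le> 1" and pow: "B ^\<^sub>m k = 1\<^sub>m n"
  shows "unitary_mat n B"
proof (rule isometry_imp_unitary[OF B])
  have contr: "euclidean_norm (B *\<^sub>v v) \<le> euclidean_norm v" if "v \<in> carrier_vec n" for v
    using operator_norm_bound[OF B that] norm mult_right_mono[OF norm euclidean_norm_nonneg[of v]] by simp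
  have pow_contr: "euclidean_norm (B ^\<^sub>m m *\<^sub>v v) \<le> euclidean_norm v" if "v \<in> carrier_vec n" for m v
    using that
  proof (induction m arbitrary: v)
    case (Suc m)
    have "B ^\<^sub>m Suc m *\<^sub>v v = B ^\<^sub>m m *\<^sub>v (B *\<^sub>v v)"
      using B Suc.prems by (simp add: assoc_mult_mat_vec[of _ n n _ n])
    also have "euclidean_norm \<dots> \<le> euclidean_norm (B *\<^sub>v v)"
      using B Suc.prems by (intro Suc.IH) simp
    also have "\<dots> \<le> euclidean_norm v" by (rule contr[OF Suc.prems])
    finally show ?case .
  qed (use B in simp)
  fix v :: "complex vec" assume v: "v \<in> carrier_vec n"
  obtain m where m: "k = Suc m" using n by (cases k) auto
  have "v = B ^\<^sub>m k *\<^sub>v v" using v by (simp add: pow)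
  also have "\<dots> = B ^\<^sub>m m *\<^sub>v (B *\<^sub>v v)"
    unfolding m using B v by (simp add: assoc_mult_mat_vec[of _ n n _ n])
  finally have "euclidean_norm v \<le> euclidean_norm (B *\<^sub>v v)"
    using pow_contr[of "B *\<^sub>v v" m] B v by simp
  with contr[OF v] show "euclidean_norm (B *\<^sub>v v) = euclidean_norm v" by simp
qed

section \<open>Characteristic polynomials in the pencil\<close>

lemma invertible_mat_iff_det:
  fixes M :: "complex mat"
  assumes M: "M \<in> carrier_mat n n"
  shows "invertible_mat M \<longleftrightarrow> det M \<noteq> 0"
proof
  assume "invertible_mat M"
  then obtain B where B: "M * B = 1\<^sub>m (dim_row M)" "B * M = 1\<^sub>m (dim_row B)"
    unfolding invertible_mat_def inverts_mat_def by blast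
  from B M have BC: "B \<in> carrier_mat n n"
    by (metis carrier_matD carrier_matI index_mult_mat(2,3) index_one_mat(2,3))
  have "det M * det B = det (M * B)" using M BC by (simp add: det_mult)
  also have "\<dots> = 1" using B M by simp
  finally show "det M \<noteq> 0" by auto
next
  assume d: "det M \<noteq> 0"
  define B where "B = (1 / det M) \<cdot>\<^sub>m adj_mat M"
  note adj = adj_mat[OF M]
  have scale: "(1 / det M) \<cdot>\<^sub>m (det M \<cdot>\<^sub>m 1\<^sub>m n) = (1\<^sub>m n :: complex mat)"
    using d by (intro eq_matI) auto
  have "M * B = 1\<^sub>m n"
    unfolding B_def mult_smult_distrib[OF M adj(1)] adj(2) by (rule scale)
  moreover have "B * M = 1\<^sub>m n"
    unfolding B_def mult_smult_assoc_mat[OF adj(1) M] adj(3) by (rule scale)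
  moreover have "B \<in> carrier_mat n n" using adj by (simp add: B_def)
  ultimately show "invertible_mat M"
    using M unfolding invertible_mat_def inverts_mat_def square_mat.simps
    by (intro conjI exI[of _ B]) auto
qed

lemma poly_eq_monom_minus_const:
  fixes p :: "complex poly"
  assumes "degree p = n" "lead_coeff p = 1" "0 < n" "q \<noteq> 0"
    and roots: "\<And>\<mu>. \<mu> \<noteq> 0 \<Longrightarrow> poly p \<mu> = 0 \<longleftrightarrow> \<mu> ^ n = q"
  shows "p = monom 1 n - [:q:]"
proof (rule ccontr)
  let ?r = "monom 1 n - [:q:] :: complex poly"
  assume "p \<noteq> ?r"
  then have nz: "p - ?r \<noteq> 0" by simp
  have "coeff (p - ?r) k = 0" if "k \<ge> n" for k
  proof (cases "k = n")
    case True
    then show ?thesis using assms(1-3) by (cases n) (auto simp: coeff_pCons)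
  next
    case False
    then show ?thesis using that assms(1) coeff_eq_0[of p k] by (cases k) (auto simp: coeff_pCons)
  qed
  with nz have deg: "degree (p - ?r) < n"
    by (meson leading_coeff_0_iff not_le)
  have "{\<mu>. \<mu> ^ n = q} \<subseteq> {\<mu>. poly (p - ?r) \<mu> = 0}"
    using roots assms(3,4) by (auto simp: poly_monom)
  then have "card {\<mu>. \<mu> ^ n = q} \<le> card {\<mu>. poly (p - ?r) \<mu> = 0}"
    by (rule card_mono[OF poly_roots_finite[OF nz]])
  also have "\<dots> \<le> degree (p - ?r)"
    using card_poly_roots_bound[OF nz] .
  finally show False
    using deg card_nth_roots[OF assms(4,3)] by simp
qed

text \<open>A nonzero number \<open>\<mu>\<close> is an eigenvalue of \<open>x A + y B + z A B\<close> if and only if \<open>(x, y, z) / \<mu>\<close> lies in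
  the joint spectrum. For \<open>q \<noteq> 0\<close> this gives \<open>n\<close> distinct roots of a polynomial of degree \<open>n\<close>.\<close>

lemma char_poly_pencil:
  assumes n: "0 < n" and A: "A \<in> carrier_mat n n" and B: "B \<in> carrier_mat n n"
    and spec: "proper_joint_spectrum n [A, B, A * B] =
           {[x, y, z] | x y z. x ^ n + y ^ n + (-1) ^ (n - 1) * z ^ n = 1}"
    and q: "q = x ^ n + y ^ n + (-1) ^ (n - 1) * z ^ n" "q \<noteq> 0"
  shows "char_poly (x \<cdot>\<^sub>m A + y \<cdot>\<^sub>m B + z \<cdot>\<^sub>m (A * B)) = monom 1 n - [:q:]"
proof -
  define M where "M = x \<cdot>\<^sub>m A + y \<cdot>\<^sub>m B + z \<cdot>\<^sub>m (A * B)"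
  have M: "M \<in> carrier_mat n n" using A B by (simp add: M_def)
  have "poly (char_poly M) \<mu> = 0 \<longleftrightarrow> \<mu> ^ n = q" if l: "\<mu> \<noteq> 0" for \<mu>
  proof -
    let ?P = "matrix_pencil n [x / \<mu>, y / \<mu>, z / \<mu>] [A, B, A * B]"
    have P: "?P = (x / \<mu>) \<cdot>\<^sub>m A + (y / \<mu>) \<cdot>\<^sub>m B + (z / \<mu>) \<cdot>\<^sub>m (A * B) - 1\<^sub>m n"
      using A B by (intro matrix_pencil_triple) auto
    have PC: "?P \<in> carrier_mat n n" unfolding P by (rule minus_carrier_mat) simp
    have "char_matrix M \<mu> = \<mu> \<cdot>\<^sub>m ?P"
      unfolding P char_matrix_def M_def using A B l
      by (intro eq_matI) (auto simp: field_simps)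
    then have "poly (char_poly M) \<mu> = 0 \<longleftrightarrow> det (\<mu> \<cdot>\<^sub>m ?P) = 0"
      using eigenvalue_root_char_poly[OF M, of \<mu>] eigenvalue_det[OF M, of \<mu>] by metis
    also have "\<dots> \<longleftrightarrow> det ?P = 0" using l by simp
    also have "\<dots> \<longleftrightarrow> [x / \<mu>, y / \<mu>, z / \<mu>] \<in> proper_joint_spectrum n [A, B, A * B]"
      using invertible_mat_iff_det[OF PC] unfolding proper_joint_spectrum_def by simp
    also have "\<dots> \<longleftrightarrow> (x / \<mu>) ^ n + (y / \<mu>) ^ n + (-1) ^ (n - 1) * (z / \<mu>) ^ n = 1"
      unfolding spec by simp
    also have "\<dots> \<longleftrightarrow> q / \<mu> ^ n = 1"
      unfolding q(1) by (simp add: power_divide add_divide_distrib)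
    also have "\<dots> \<longleftrightarrow> \<mu> ^ n = q" using l by (auto simp: field_simps)
    finally show ?thesis .
  qed
  then show ?thesis
    unfolding M_def[symmetric] using degree_monic_char_poly[OF M] n q(2)
    by (intro poly_eq_monom_minus_const) auto
qed

lemma mult_pow_mat_commute:
  fixes M :: "'a::semiring_1 mat"
  assumes M: "M \<in> carrier_mat n n"
  shows "M * M ^\<^sub>m k = M ^\<^sub>m k * M"
proof (induction k)
  case (Suc k)
  have "M * M ^\<^sub>m Suc k = (M * M ^\<^sub>m k) * M"
    using M by (simp add: assoc_mult_mat[of _ n n _ n _ n])
  then show ?case using Suc by simp
qed (use M in simp)

text \<open>The instance of the Cayley-Hamilton theorem for \<open>X^n - q\<close>. Let \<open>K d\<close> collect the coefficients of
  degree \<open>d\<close> in the adjugate of \<open>X - M\<close>. Comparing coefficients in \<open>(X - M) adj (X - M) = X^n - q\<close>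
  gives \<open>K d = M K (d+1)\<close> except at \<open>d = n - 1\<close>, where 1 is added. Since the adjugate has bounded
  degree, descending from high degrees gives \<open>K (n-1) = 1\<close>, then \<open>K 0 = M^(n-1)\<close>, and the constant
  coefficient gives \<open>M (K 0) = q\<close>.\<close>

lemma pow_mat_of_char_poly:
  fixes M :: "complex mat"
  assumes n: "0 < n" and M: "M \<in> carrier_mat n n" and p: "char_poly M = monom 1 n - [:q:]"
  shows "M ^\<^sub>m n = q \<cdot>\<^sub>m 1\<^sub>m n"
proof -
  define C where "C = char_poly_matrix M"
  have C: "C \<in> carrier_mat n n" using M by (simp add: C_def)
  note adj = adj_mat[OF C]
  define K where "K d = mat n n (\<lambda>(i, j). coeff (adj_mat C $$ (i, j)) d)" for d
  have K: "K d \<in> carrier_mat n n" for d by (simp add: K_def)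
  have entry: "pCons 0 (adj_mat C $$ (i, j)) - (\<Sum>k<n. Polynomial.smult (M $$ (i, k)) (adj_mat C $$ (k, j)))
      = (if i = j then char_poly M else 0)" if ij: "i < n" "j < n" for i j
  proof -
    have "(C * adj_mat C) $$ (i, j) = (\<Sum>k<n. C $$ (i, k) * adj_mat C $$ (k, j))"
      using ij C adj(1) by (simp add: scalar_prod_def atLeast0LessThan)
    also have "\<dots> = (\<Sum>k<n. (if k = i then pCons 0 (adj_mat C $$ (k, j)) else 0)
        - Polynomial.smult (M $$ (i, k)) (adj_mat C $$ (k, j)))"
      using ij M by (intro sum.cong refl) (auto simp: C_def char_poly_matrix_def algebra_simps)
    also have "\<dots> = pCons 0 (adj_mat C $$ (i, j)) - (\<Sum>k<n. Polynomial.smult (M $$ (i, k)) (adj_mat C $$ (k, j)))"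
      using ij by (simp add: sum_subtractf)
    finally have "pCons 0 (adj_mat C $$ (i, j)) - (\<Sum>k<n. Polynomial.smult (M $$ (i, k)) (adj_mat C $$ (k, j)))
        = (det C \<cdot>\<^sub>m 1\<^sub>m n) $$ (i, j)"
      unfolding adj(2) by (rule sym)
    also have "\<dots> = (if i = j then char_poly M else 0)"
      using ij by (simp add: char_poly_def C_def[symmetric])
    finally show ?thesis .
  qed
  have coeff_entry: "(case d of 0 \<Rightarrow> 0 | Suc d' \<Rightarrow> K d' $$ (i, j)) - (M * K d) $$ (i, j)
      = (if i = j then coeff (char_poly M) d else 0)" if ij: "i < n" "j < n" for i j d
    using arg_cong[OF entry[OF ij], of "\<lambda>p. coeff p d"] ij M
    by (auto simp: K_def scalar_prod_def atLeast0LessThan coeff_sum coeff_pCons split: nat.splits)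
  have recurrence: "K d = (if Suc d = n then M * K (Suc d) + 1\<^sub>m n else M * K (Suc d))" for d
  proof (rule eq_matI)
    fix i j
    assume "i < dim_row (if Suc d = n then M * K (Suc d) + 1\<^sub>m n else M * K (Suc d))"
      "j < dim_col (if Suc d = n then M * K (Suc d) + 1\<^sub>m n else M * K (Suc d))"
    then have ij: "i < n" "j < n" using M K[of "Suc d"] by (auto split: if_splits)
    show "K d $$ (i, j) = (if Suc d = n then M * K (Suc d) + 1\<^sub>m n else M * K (Suc d)) $$ (i, j)"
      using coeff_entry[OF ij, of "Suc d"] ij M K[of "Suc d"] unfolding p
      by (auto simp: algebra_simps simp del: index_mult_mat)
  qed (simp_all add: K_def M[THEN carrier_matD(1)])
  have zero_beyond: "K d = 0\<^sub>m n n" if "n \<le> d" for d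
  proof -
    define D where "D = d + Suc (Max ((\<lambda>(i, j). degree (adj_mat C $$ (i, j))) ` ({..<n} \<times> {..<n})))"
    have KD: "K D = 0\<^sub>m n n"
    proof (rule eq_matI)
      fix i j assume "i < dim_row (0\<^sub>m n n :: complex mat)" "j < dim_col (0\<^sub>m n n :: complex mat)"
      then have ij: "i < n" "j < n" by auto
      then have "degree (adj_mat C $$ (i, j)) \<le> Max ((\<lambda>(i, j). degree (adj_mat C $$ (i, j))) ` ({..<n} \<times> {..<n}))"
        by (intro Max_ge) (auto intro: rev_image_eqI[of "(i, j)"])
      then have "degree (adj_mat C $$ (i, j)) < D" by (simp add: D_def)
      then show "K D $$ (i, j) = 0\<^sub>m n n $$ (i, j)"
        using ij by (simp add: K_def coeff_eq_0)
    qed (simp_all add: K_def)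
    have "d \<le> D" by (simp add: D_def)
    then show ?thesis
      using that
    proof (induction rule: inc_induct)
      case base
      show ?case by (rule KD)
    next
      case (step m)
      then show ?case using recurrence[of m] M by simp
    qed
  qed
  have "K (n - 1 - k) = M ^\<^sub>m k" if "k < n" for k
    using that
  proof (induction k)
    case 0
    then show ?case using recurrence[of "n - 1"] zero_beyond[of n] n M by simp
  next
    case (Suc k)
    then have "Suc (n - 1 - Suc k) = n - 1 - k" "Suc (n - 1 - Suc k) \<noteq> n" by auto
    then show ?case using recurrence[of "n - 1 - Suc k"] Suc mult_pow_mat_commute[OF M, of k] by simp
  qed
  from this[of "n - 1"] have K0: "K 0 = M ^\<^sub>m (n - 1)" using n by simp
  have "M * K 0 = q \<cdot>\<^sub>m 1\<^sub>m n"
  proof (rule eq_matI)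
    fix i j assume "i < dim_row (q \<cdot>\<^sub>m 1\<^sub>m n)" "j < dim_col (q \<cdot>\<^sub>m 1\<^sub>m n)"
    then have ij: "i < n" "j < n" by auto
    show "(M * K 0) $$ (i, j) = (q \<cdot>\<^sub>m 1\<^sub>m n) $$ (i, j)"
      using coeff_entry[OF ij, of 0] ij n unfolding p by (auto simp del: index_mult_mat simp: add_eq_0_iff)
  qed (use M K in auto)
  moreover have "M * M ^\<^sub>m (n - 1) = M ^\<^sub>m n"
    using mult_pow_mat_commute[OF M, of "n - 1"] n by (cases n) auto
  ultimately show ?thesis by (simp add: K0)
qed

section \<open>Orthonormal eigenbases\<close>

text \<open>The defect \<open>w = A\<^sup>* v - cnj \<mu> v\<close> is again an eigenvector for \<open>\<mu>\<close>, because \<open>A\<close> commutes with its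
  adjoint; then the inner product of \<open>w\<close> with \<open>A\<^sup>* v\<close> equals that of \<open>A w = \<mu> w\<close> with \<open>v\<close>, so \<open>w\<close> is
  orthogonal to itself.\<close>

lemma normal_adjoint_eigenvector:
  fixes A :: "complex mat"
  assumes A: "A \<in> carrier_mat n n" and normal: "A * mat_adjoint A = mat_adjoint A * A"
    and v: "v \<in> carrier_vec n" and Av: "A *\<^sub>v v = \<mu> \<cdot>\<^sub>v v"
  shows "mat_adjoint A *\<^sub>v v = cnj \<mu> \<cdot>\<^sub>v v"
proof -
  note A' = mat_adjoint_carrier[OF A]
  define a where "a = mat_adjoint A *\<^sub>v v"
  define w where "w = a - cnj \<mu> \<cdot>\<^sub>v v"
  have a: "a \<in> carrier_vec n" unfolding a_def by (rule mult_mat_vec_carrier[OF A' v])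
  have w: "w \<in> carrier_vec n" using a v by (simp add: w_def)
  have "A *\<^sub>v a = mat_adjoint A *\<^sub>v (A *\<^sub>v v)"
    unfolding a_def using assoc_mult_mat_vec[OF A A' v] assoc_mult_mat_vec[OF A' A v] normal by simp
  also have "\<dots> = \<mu> \<cdot>\<^sub>v a"
    unfolding Av a_def by (rule mult_mat_vec[OF A' v])
  finally have Aa: "A *\<^sub>v a = \<mu> \<cdot>\<^sub>v a" .
  have "A *\<^sub>v w = A *\<^sub>v a - A *\<^sub>v (cnj \<mu> \<cdot>\<^sub>v v)"
    unfolding w_def using v by (intro mult_minus_distrib_mat_vec[OF A a]) simp
  also have "A *\<^sub>v (cnj \<mu> \<cdot>\<^sub>v v) = cnj \<mu> \<cdot>\<^sub>v (\<mu> \<cdot>\<^sub>v v)"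
    unfolding mult_mat_vec[OF A v] Av ..
  finally have Aw: "A *\<^sub>v w = \<mu> \<cdot>\<^sub>v w"
    unfolding Aa w_def using a v by (intro eq_vecI) (auto simp: algebra_simps)
  have "w \<bullet>c w = w \<bullet>c a - w \<bullet>c (cnj \<mu> \<cdot>\<^sub>v v)"
    using a v by (simp add: cscalar_prod_sum[of _ n] w_def algebra_simps sum_subtractf)
  also have "w \<bullet>c a = (A *\<^sub>v w) \<bullet>c v"
    unfolding a_def by (rule cscalar_prod_adjoint[OF A w v, symmetric])
  also have "\<dots> = w \<bullet>c (cnj \<mu> \<cdot>\<^sub>v v)"
    unfolding Aw using w v by (simp add: cscalar_prod_sum[of _ n] mult_ac)
  finally have "euclidean_norm w = 0"
    using cscalar_prod_self[OF w] by simp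
  then have w0: "w = 0\<^sub>v n" by (rule euclidean_norm_eq_0[OF w])
  show ?thesis
  proof (rule eq_vecI)
    fix i assume i: "i < dim_vec (cnj \<mu> \<cdot>\<^sub>v v)"
    have "w $ i = 0" using w0 i v by simp
    then show "(mat_adjoint A *\<^sub>v v) $ i = (cnj \<mu> \<cdot>\<^sub>v v) $ i"
      using i v a unfolding a_def[symmetric] by (simp add: w_def)
  qed (use A v in auto)
qed

lemma normal_eigenvectors_orthogonal:
  fixes A :: "complex mat"
  assumes A: "A \<in> carrier_mat n n" and normal: "A * mat_adjoint A = mat_adjoint A * A"
    and v: "v \<in> carrier_vec n" "A *\<^sub>v v = \<mu> \<cdot>\<^sub>v v"
    and w: "w \<in> carrier_vec n" "A *\<^sub>v w = \<nu> \<cdot>\<^sub>v w" and ne: "\<mu> \<noteq> \<nu>"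
  shows "v \<bullet>c w = 0"
proof -
  have "\<mu> * (v \<bullet>c w) = (A *\<^sub>v v) \<bullet>c w"
    using v w by (simp add: cscalar_prod_sum[of _ n] sum_distrib_left mult_ac)
  also have "\<dots> = v \<bullet>c (mat_adjoint A *\<^sub>v w)"
    by (rule cscalar_prod_adjoint[OF A v(1) w(1)])
  also have "\<dots> = \<nu> * (v \<bullet>c w)"
    unfolding normal_adjoint_eigenvector[OF A normal w]
    using v w by (simp add: cscalar_prod_sum[of _ n] sum_distrib_left mult_ac)
  finally show ?thesis using ne by simp
qed

lemma orthonormal_eigenbasis_exists:
  fixes A :: "complex mat"
  assumes A: "A \<in> carrier_mat n n" and normal: "A * mat_adjoint A = mat_adjoint A * A"
    and ev: "\<And>j. j < n \<Longrightarrow> eigenvalue A (\<omega> j)" and inj: "inj_on \<omega> {..<n}"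
  shows "\<exists>e. orthonormal_basis n e \<and> (\<forall>j<n. A *\<^sub>v e j = \<omega> j \<cdot>\<^sub>v e j)"
proof -
  have "\<exists>v. v \<in> carrier_vec n \<and> A *\<^sub>v v = \<omega> j \<cdot>\<^sub>v v \<and> v \<bullet>c v = 1" if j: "j < n" for j
  proof -
    obtain v where v: "v \<in> carrier_vec n" "v \<noteq> 0\<^sub>v n" "A *\<^sub>v v = \<omega> j \<cdot>\<^sub>v v"
      using ev[OF j] A unfolding eigenvalue_def eigenvector_def by auto
    define c where "c = complex_of_real (1 / euclidean_norm v)"
    have nz: "euclidean_norm v \<noteq> 0" using euclidean_norm_eq_0[OF v(1)] v(2) by blast
    have c: "cmod c = 1 / euclidean_norm v" unfolding c_def norm_of_real by simp
    have cv: "c \<cdot>\<^sub>v v \<in> carrier_vec n" using v by simp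
    have "A *\<^sub>v (c \<cdot>\<^sub>v v) = \<omega> j \<cdot>\<^sub>v (c \<cdot>\<^sub>v v)"
      unfolding mult_mat_vec[OF A v(1)] v(3) by (intro eq_vecI) auto
    moreover have "(c \<cdot>\<^sub>v v) \<bullet>c (c \<cdot>\<^sub>v v) = 1"
      unfolding cscalar_prod_self[OF cv] using nz by (simp add: euclidean_norm_smult c)
    ultimately show ?thesis using cv by blast
  qed
  then obtain e where e: "\<And>j. j < n \<Longrightarrow> e j \<in> carrier_vec n" "\<And>j. j < n \<Longrightarrow> A *\<^sub>v e j = \<omega> j \<cdot>\<^sub>v e j"
    "\<And>j. j < n \<Longrightarrow> e j \<bullet>c e j = 1"
    by metis
  have "e i \<bullet>c e j = 0" if "i < n" "j < n" "i \<noteq> j" for i j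
    using that inj e by (intro normal_eigenvectors_orthogonal[OF A normal, of _ "\<omega> i" _ "\<omega> j"]) (auto simp: inj_on_eq_iff)
  then show ?thesis
    using e unfolding orthonormal_basis_def by (intro exI[of _ e]) auto
qed

definition basis_mat :: "nat \<Rightarrow> (nat \<Rightarrow> complex vec) \<Rightarrow> complex mat" where
  "basis_mat n e = mat n n (\<lambda>(i, j). e j $ i)"

lemma basis_mat_carrier [simp]: "basis_mat n e \<in> carrier_mat n n"
  by (simp add: basis_mat_def)

lemma basis_mat_dim [simp]: "dim_row (basis_mat n e) = n" "dim_col (basis_mat n e) = n"
  by (simp_all add: basis_mat_def)

lemma col_basis_mat: "j < n \<Longrightarrow> e j \<in> carrier_vec n \<Longrightarrow> col (basis_mat n e) j = e j"
  by (intro eq_vecI) (auto simp: basis_mat_def)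

lemma adjoint_basis_mat_mult:
  assumes e: "\<And>i. i < n \<Longrightarrow> e i \<in> carrier_vec n" and M: "M \<in> carrier_mat n n"
    and f: "\<And>i. i < n \<Longrightarrow> f i \<in> carrier_vec n" and kl: "k < n" "l < n"
  shows "(mat_adjoint (basis_mat n e) * M * basis_mat n f) $$ (k, l) = (M *\<^sub>v f l) \<bullet>c e k"
proof -
  let ?E = "basis_mat n e" and ?F = "basis_mat n f"
  have "(mat_adjoint ?E * M * ?F) $$ (k, l) = (mat_adjoint ?E * (M * ?F)) $$ (k, l)"
    using assoc_mult_mat[OF mat_adjoint_carrier[OF basis_mat_carrier] M basis_mat_carrier] by simp
  also have "\<dots> = row (mat_adjoint ?E) k \<bullet> (M *\<^sub>v f l)"
  proof -
    have "col (M * ?F) l = M *\<^sub>v f l"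
      using col_mult2[OF M basis_mat_carrier kl(2)] col_basis_mat[where e = f, OF kl(2) f[OF kl(2)]] by simp
    moreover have "k < dim_row (mat_adjoint ?E)" "l < dim_col (M * ?F)"
      using kl by (simp_all add: basis_mat_def)
    ultimately show ?thesis by (metis index_mult_mat(1))
  qed
  also have "\<dots> = (\<Sum>i<n. cnj (e k $ i) * (M *\<^sub>v f l) $ i)"
    using kl M unfolding scalar_prod_def
    by (intro sum.cong) (auto simp: basis_mat_def simp del: index_mult_mat_vec)
  also have "\<dots> = (M *\<^sub>v f l) \<bullet>c e k"
    by (simp add: cscalar_prod_sum[OF e[OF kl(1)]] mult.commute del: index_mult_mat_vec)
  finally show ?thesis .
qed

lemma basis_mat_unitary:
  assumes "orthonormal_basis n e"
  shows "unitary_mat n (basis_mat n e)"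
proof -
  let ?E = "basis_mat n e"
  have e: "\<And>i. i < n \<Longrightarrow> e i \<in> carrier_vec n"
    "\<And>i j. i < n \<Longrightarrow> j < n \<Longrightarrow> e i \<bullet>c e j = (if i = j then 1 else 0)"
    using assms by (auto simp: orthonormal_basis_def)
  have "mat_adjoint ?E * 1\<^sub>m n * ?E = 1\<^sub>m n"
  proof (rule eq_matI)
    fix i j assume "i < dim_row (1\<^sub>m n :: complex mat)" "j < dim_col (1\<^sub>m n :: complex mat)"
    then have ij: "i < n" "j < n" by auto
    have "(mat_adjoint ?E * 1\<^sub>m n * ?E) $$ (i, j) = (1\<^sub>m n *\<^sub>v e j) \<bullet>c e i"
      using e(1) ij by (intro adjoint_basis_mat_mult) auto
    then show "(mat_adjoint ?E * 1\<^sub>m n * ?E) $$ (i, j) = 1\<^sub>m n $$ (i, j)"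
      using ij e by simp
  qed simp_all
  then have "mat_adjoint ?E * ?E = 1\<^sub>m n"
    using right_mult_one_mat[OF mat_adjoint_carrier[OF basis_mat_carrier[of n e]]] by simp
  moreover from this have "?E * mat_adjoint ?E = 1\<^sub>m n"
    by (rule mat_mult_left_right_inverse[rotated 2]) auto
  ultimately show ?thesis by (simp add: unitary_mat_def)
qed

lemma unitary_of_eigenbasis:
  fixes A :: "complex mat"
  assumes A: "A \<in> carrier_mat n n" and normal: "A * mat_adjoint A = mat_adjoint A * A"
    and e: "orthonormal_basis n e" "\<And>j. j < n \<Longrightarrow> A *\<^sub>v e j = \<omega> j \<cdot>\<^sub>v e j"
    and unit: "\<And>j. j < n \<Longrightarrow> cmod (\<omega> j) = 1"
  shows "unitary_mat n A"
proof -
  let ?E = "basis_mat n e"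
  note A' = mat_adjoint_carrier[OF A]
  have ec: "e j \<in> carrier_vec n" if "j < n" for j using e(1) that by (auto simp: orthonormal_basis_def)
  have U: "unitary_mat n ?E" by (rule basis_mat_unitary[OF e(1)])
  have AA: "mat_adjoint A * A \<in> carrier_mat n n" by (rule mult_carrier_mat[OF A' A])
  have "mat_adjoint A * A * ?E = ?E"
  proof (rule mat_col_eqI)
    fix j assume "j < dim_col ?E"
    then have j: "j < n" by (simp add: basis_mat_def)
    have "col (mat_adjoint A * A * ?E) j = (mat_adjoint A * A) *\<^sub>v e j"
      using col_mult2[OF AA basis_mat_carrier j] col_basis_mat[where e = e, OF j ec[OF j]] by simp
    also have "\<dots> = mat_adjoint A *\<^sub>v (\<omega> j \<cdot>\<^sub>v e j)"
      using assoc_mult_mat_vec[OF A' A ec[OF j]] e(2)[OF j] by simp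
    also have "\<dots> = \<omega> j \<cdot>\<^sub>v (cnj (\<omega> j) \<cdot>\<^sub>v e j)"
      unfolding mult_mat_vec[OF A' ec[OF j]] normal_adjoint_eigenvector[OF A normal ec[OF j] e(2)[OF j]] ..
    also have "\<dots> = e j"
      using unit[OF j] by (simp add: smult_smult_assoc complex_norm_square[symmetric])
    finally show "col (mat_adjoint A * A * ?E) j = col ?E j"
      by (simp add: col_basis_mat[where e = e, OF j ec[OF j]])
  qed (use A in \<open>auto simp: basis_mat_def\<close>)
  then have "mat_adjoint A * A * (?E * mat_adjoint ?E) = ?E * mat_adjoint ?E"
    using assoc_mult_mat[OF AA basis_mat_carrier mat_adjoint_carrier[OF basis_mat_carrier[of n e]]] by metis
  then have AA1: "mat_adjoint A * A = 1\<^sub>m n"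
    using U right_mult_one_mat[OF AA] by (simp add: unitary_mat_def)
  with normal show ?thesis using A by (simp add: unitary_mat_def)
qed

text \<open>The polynomial \<open>X^n - 1\<close> is prime to its derivative.\<close>

lemma spectrum_order_roots_of_unity:
  fixes A :: "complex mat"
  assumes n: "0 < n" and A: "A \<in> carrier_mat n n" and p: "char_poly A = monom 1 n - [:1:]"
  shows "spectrum A = {w. w ^ n = 1}" "\<forall>w\<in>spectrum A. order w (char_poly A) = 1"
proof -
  have root: "poly (char_poly A) w = 0 \<longleftrightarrow> w ^ n = 1" for w
    by (simp add: p poly_monom)
  show sp: "spectrum A = {w. w ^ n = 1}"
    using eigenvalue_root_char_poly[OF A] root by (auto simp: spectrum_def)
  have "rsquarefree (char_poly A)"
    unfolding rsquarefree_roots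
  proof (intro allI notI, elim conjE)
    fix w assume "poly (char_poly A) w = 0" "poly (pderiv (char_poly A)) w = 0"
    then have "w ^ n = 1" "of_nat n * w ^ (n - 1) = 0"
      by (simp_all add: root) (simp add: p pderiv_diff pderiv_monom poly_monom pderiv_pCons)
    then show False using n by (cases "w = 0") (auto simp: power_0_left)
  qed
  moreover have "order w (char_poly A) \<noteq> 0" if "w ^ n = 1" for w
    using root[of w] that order_root[of "char_poly A" w] \<open>rsquarefree (char_poly A)\<close>
    by (auto simp: rsquarefree_def)
  ultimately show "\<forall>w\<in>spectrum A. order w (char_poly A) = 1"
    unfolding sp rsquarefree_def One_nat_def by (metis mem_Collect_eq)
qed

section \<open>Unbiasedness from bi-affine determinants\<close>

definition unity_root :: "nat \<Rightarrow> nat \<Rightarrow> complex" where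
  "unity_root n j = cis (2 * pi * real j / real n)"

lemma unity_root_power:
  assumes "0 < n"
  shows "unity_root n j ^ n = 1"
proof -
  have "real n * (2 * pi * real j / real n) = 2 * pi * real j"
    using assms by simp
  then show ?thesis
    unfolding unity_root_def Complex.DeMoivre by (simp only:) (rule cis_multiple_2pi, simp)
qed

lemma cmod_unity_root [simp]: "cmod (unity_root n j) = 1"
  by (simp add: unity_root_def)

lemma unity_root_inj: "0 < n \<Longrightarrow> inj_on (unity_root n) {..<n}"
  using bij_betw_roots_unity[of n] by (simp add: bij_betw_def unity_root_def[abs_def])

text \<open>The derivative of \<open>X^n - 1\<close> at a root, computed from the factorization.\<close>

lemma prod_unity_root_differences:
  assumes n: "0 < n" and i: "i < n"
  shows "(\<Prod>k\<in>{..<n} - {i}. unity_root n i - unity_root n k) = of_nat n * unity_root n i ^ (n - 1)"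
proof -
  let ?\<omega> = "unity_root n"
  define p where "p = (\<Prod>k<n. [:- ?\<omega> k, 1:])"
  define r where "r = (\<Prod>k\<in>{..<n} - {i}. [:- ?\<omega> k, 1:])"
  have "p = monom 1 n - [:1:]"
  proof (rule poly_eq_monom_minus_const)
    show "degree p = n" unfolding p_def by (subst degree_prod_eq_sum_degree) auto
    show "lead_coeff p = 1" unfolding p_def by (simp add: lead_coeff_prod)
    show "poly p \<mu> = 0 \<longleftrightarrow> \<mu> ^ n = 1" for \<mu>
    proof -
      have "poly p \<mu> = 0 \<longleftrightarrow> \<mu> \<in> ?\<omega> ` {..<n}"
        by (auto simp: p_def poly_prod)
      also have "?\<omega> ` {..<n} = {z. z ^ n = 1}"
        using bij_betw_roots_unity[OF n] by (simp add: bij_betw_def unity_root_def[abs_def])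
      finally show ?thesis by simp
    qed
  qed (use n in auto)
  moreover have "p = [:- ?\<omega> i, 1:] * r"
    unfolding p_def r_def using i by (intro prod.remove) auto
  ultimately have "pderiv ([:- ?\<omega> i, 1:] * r) = pderiv (monom 1 n - [:1:])" by simp
  then have "poly (pderiv ([:- ?\<omega> i, 1:] * r)) (?\<omega> i) = poly (pderiv (monom 1 n - [:1:])) (?\<omega> i)"
    by simp
  then have "poly r (?\<omega> i) = of_nat n * ?\<omega> i ^ (n - 1)"
    unfolding pderiv_mult by (simp add: pderiv_pCons pderiv_diff pderiv_monom poly_monom)
  then show ?thesis by (simp add: r_def poly_prod)
qed

lemma cofactor_cong:
  assumes X: "X \<in> carrier_mat n n" and Y: "Y \<in> carrier_mat n n"
    and eq: "\<And>k l. k < n \<Longrightarrow> l < n \<Longrightarrow> k \<noteq> i \<Longrightarrow> l \<noteq> j \<Longrightarrow> X $$ (k, l) = Y $$ (k, l)"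
  shows "cofactor X i j = cofactor Y i j"
proof -
  have "mat_delete X i j = mat_delete Y i j"
    unfolding mat_delete_def using X Y by (intro cong_mat) (auto intro!: eq)
  then show ?thesis by (simp add: cofactor_def)
qed

lemma det_single_column_entry:
  fixes X :: "'a::comm_ring_1 mat"
  assumes X: "X \<in> carrier_mat n n" and ij: "i < n" "j < n"
    and zero: "\<And>k. k < n \<Longrightarrow> k \<noteq> i \<Longrightarrow> X $$ (k, j) = 0"
  shows "det X = X $$ (i, j) * cofactor X i j"
proof -
  have "det X = (\<Sum>k<n. X $$ (k, j) * cofactor X k j)"
    by (rule laplace_expansion_column[OF X ij(2)])
  also have "\<dots> = (\<Sum>k<n. if k = i then X $$ (i, j) * cofactor X i j else 0)"
    using zero by (intro sum.cong) auto
  finally show ?thesis using ij by simp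
qed

lemma det_row_column_scaled:
  fixes X :: "'a::comm_ring_1 mat"
  assumes X: "X \<in> carrier_mat n n"
  shows "det (mat n n (\<lambda>(k, l). a k * X $$ (k, l) * b l)) = (\<Prod>k<n. a k) * det X * (\<Prod>l<n. b l)"
proof -
  let ?D = "\<lambda>f. mat n n (\<lambda>(k, l). if k = l then f k else (0::'a))"
  have dD: "det (?D f) = (\<Prod>k<n. f k)" for f
    by (subst det_upper_triangular[of _ n]) (auto simp: prod_list_diag_prod atLeast0LessThan)
  have "mat n n (\<lambda>(k, l). a k * X $$ (k, l) * b l) = ?D a * X * ?D b"
    using X by (intro eq_matI) (auto simp: scalar_prod_def if_distrib[of "\<lambda>x. x * _"] if_distrib[of "(*) _"] cong: if_cong)
  moreover have "det (?D a * X * ?D b) = det (?D a) * det X * det (?D b)"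
    using det_mult[OF mult_carrier_mat[OF _ X, of "?D a" n], of "?D b"] det_mult[of "?D a" n X] X by simp
  ultimately show ?thesis
    by (simp only: dD)
qed

text \<open>The cofactor is the determinant of the matrix whose column \<open>j\<close> is replaced by the \<open>i\<close>-th unit
  vector. In this form the scaling is a multiplication by diagonal matrices, whose entries at \<open>i\<close>
  and \<open>j\<close> are set to 1.\<close>

lemma cofactor_row_column_scaled:
  fixes X :: "'a::comm_ring_1 mat"
  assumes X: "X \<in> carrier_mat n n" and ij: "i < n" "j < n"
    and Y: "Y \<in> carrier_mat n n"
    and eq: "\<And>k l. k < n \<Longrightarrow> l < n \<Longrightarrow> k \<noteq> i \<Longrightarrow> l \<noteq> j \<Longrightarrow> Y $$ (k, l) = a k * X $$ (k, l) * b l"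
  shows "cofactor Y i j = (\<Prod>k\<in>{..<n} - {i}. a k) * (\<Prod>l\<in>{..<n} - {j}. b l) * cofactor X i j"
proof -
  define X' where "X' = mat n n (\<lambda>(k, l). if l = j then if k = i then 1 else 0 else X $$ (k, l))"
  have X': "X' \<in> carrier_mat n n" by (simp add: X'_def)
  define a' where "a' = a(i := 1)"
  define b' where "b' = b(j := 1)"
  define Y' where "Y' = mat n n (\<lambda>(k, l). a' k * X' $$ (k, l) * b' l)"
  have Y': "Y' \<in> carrier_mat n n" by (simp add: Y'_def)
  have "det X' = cofactor X' i j"
    using det_single_column_entry[OF X' ij] ij by (simp add: X'_def)
  also have "\<dots> = cofactor X i j"
    by (rule cofactor_cong[OF X' X]) (simp add: X'_def)
  finally have dX: "det X' = cofactor X i j" .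
  have "cofactor Y i j = cofactor Y' i j"
    by (rule cofactor_cong[OF Y Y']) (simp add: Y'_def X'_def eq a'_def b'_def)
  also have "\<dots> = det Y'"
    using det_single_column_entry[OF Y' ij] ij by (simp add: Y'_def X'_def a'_def b'_def)
  also have "\<dots> = (\<Prod>k<n. a' k) * det X' * (\<Prod>l<n. b' l)"
    unfolding Y'_def by (rule det_row_column_scaled[OF X'])
  also have "(\<Prod>k<n. a' k) = (\<Prod>k\<in>{..<n} - {i}. a k)"
    using ij by (subst prod.remove[of _ i]) (auto simp: a'_def intro!: prod.cong)
  also have "(\<Prod>l<n. b' l) = (\<Prod>l\<in>{..<n} - {j}. b l)"
    using ij by (subst prod.remove[of _ j]) (auto simp: b'_def intro!: prod.cong)
  finally show ?thesis by (simp add: dX)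
qed

text \<open>The adjugate of a unitary matrix is its determinant times its adjoint.\<close>

lemma cofactor_unitary:
  assumes U: "unitary_mat n C" and ij: "i < n" "j < n"
  shows "cofactor C i j = det C * cnj (C $$ (i, j))"
proof -
  have C: "C \<in> carrier_mat n n" and CC: "C * mat_adjoint C = 1\<^sub>m n"
    using U by (auto simp: unitary_mat_def)
  note adj = adj_mat[OF C]
  have "adj_mat C = adj_mat C * (C * mat_adjoint C)"
    using adj by (simp add: CC)
  also have "\<dots> = (adj_mat C * C) * mat_adjoint C"
    by (rule assoc_mult_mat[OF adj(1) C mat_adjoint_carrier[OF C], symmetric])
  also have "\<dots> = det C \<cdot>\<^sub>m mat_adjoint C"
    unfolding adj(3) using mult_smult_assoc_mat[OF one_carrier_mat mat_adjoint_carrier[OF C]]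
      left_mult_one_mat[OF mat_adjoint_carrier[OF C]] by simp
  finally have "adj_mat C $$ (j, i) = det C * cnj (C $$ (i, j))"
    using ij C by simp
  then show ?thesis using ij C by (simp add: adj_mat_def)
qed

lemma det_mat_tendsto:
  fixes X :: "complex \<Rightarrow> nat \<Rightarrow> nat \<Rightarrow> complex"
  assumes "\<And>k l. k < n \<Longrightarrow> l < n \<Longrightarrow> ((\<lambda>s. X s k l) \<longlongrightarrow> Y k l) F"
  shows "((\<lambda>s. det (mat n n (\<lambda>(k, l). X s k l))) \<longlongrightarrow> det (mat n n (\<lambda>(k, l). Y k l))) F"
proof -
  have *: "det (mat n n (\<lambda>(k, l). Z k l)) = (\<Sum>p\<in>{p. p permutes {0..<n}}. signof p * (\<Prod>i = 0..<n. Z i (p i)))"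
    for Z :: "nat \<Rightarrow> nat \<Rightarrow> complex"
  proof -
    have "det (mat n n (\<lambda>(k, l). Z k l))
        = (\<Sum>p\<in>{p. p permutes {0..<n}}. signof p * (\<Prod>i = 0..<n. mat n n (\<lambda>(k, l). Z k l) $$ (i, p i)))"
      by (rule det_def') simp
    also have "\<dots> = (\<Sum>p\<in>{p. p permutes {0..<n}}. signof p * (\<Prod>i = 0..<n. Z i (p i)))"
    proof (intro sum.cong refl arg_cong2[of _ _ _ _ "(*)"] prod.cong)
      fix p i assume "p \<in> {p. p permutes {0..<n}}" "i \<in> {0..<n}"
      then have "p i < n" using permutes_in_image[of p "{0..<n}" i] by auto
      then show "mat n n (\<lambda>(k, l). Z k l) $$ (i, p i) = Z i (p i)"
        using \<open>i \<in> {0..<n}\<close> by simp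
    qed
    finally show ?thesis .
  qed
  show ?thesis
    unfolding *
  proof (intro tendsto_sum tendsto_mult tendsto_const tendsto_prod)
    fix p i assume "p \<in> {p. p permutes {0..<n}}" "i \<in> {0..<n}"
    then show "((\<lambda>s. X s i (p i)) \<longlongrightarrow> Y i (p i)) F"
      using permutes_in_image[of p "{0..<n}" i] by (intro assms) auto
  qed
qed

text \<open>Choose the bi-affine function \<open>(X - \<omega>\<^sub>i) (Y - \<omega>\<^sub>j) + s\<close>. Row \<open>i\<close> of the resulting matrix is \<open>s\<close> times row
  \<open>i\<close> of \<open>C\<close>, and \<open>G s\<close> is the matrix with this factor removed. Hence \<open>s det (G s)\<close> equals
  \<open>det C ((\<theta> + s)^n - 1)\<close> with \<open>\<theta> = \<omega>\<^sub>i \<omega>\<^sub>j\<close>, and in the limit \<open>det (G 0) = det C n \<theta>^(n-1)\<close>.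
  In \<open>G 0\<close> the column \<open>j\<close> has only the entry \<open>C\<^sub>i\<^sub>j\<close>, and the complementary minor is that of \<open>C\<close> with rows and
  columns rescaled by differences of roots of unity, whose products have modulus \<open>n\<close>. As \<open>C\<close> is
  unitary, the minor is \<open>det C cnj C\<^sub>i\<^sub>j\<close>, and taking moduli gives \<open>|C\<^sub>i\<^sub>j|^2 n^2 = n\<close>.\<close>

lemma unbiased_of_biaffine_determinants:
  assumes n: "0 < n" and U: "unitary_mat n C" and ij: "i < n" "j < n"
    and det: "\<And>u v y z. v ^ n + y ^ n + (-1) ^ (n - 1) * z ^ n \<noteq> 0 \<Longrightarrow>
      det (mat n n (\<lambda>(k, l). C $$ (k, l) * (u + v * unity_root n k + y * unity_root n l
          + z * unity_root n k * unity_root n l)))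
      = det C * (u ^ n + z ^ n + (-1) ^ (n - 1) * (v ^ n + y ^ n))"
  shows "(cmod (C $$ (i, j)))\<^sup>2 = 1 / real n"
proof -
  let ?\<omega> = "unity_root n"
  define \<theta> where "\<theta> = ?\<omega> i * ?\<omega> j"
  have C: "C \<in> carrier_mat n n" and CC: "C * mat_adjoint C = 1\<^sub>m n"
    using U by (auto simp: unitary_mat_def)
  have dC: "det C \<noteq> 0"
    using arg_cong[OF CC, of det] det_mult[OF C mat_adjoint_carrier[OF C]] by auto
  have \<theta>: "\<theta> ^ n = 1" "cmod \<theta> = 1"
    using n by (simp_all add: \<theta>_def power_mult_distrib unity_root_power norm_mult)
  have \<omega>1: "?\<omega> k ^ n = 1" for k using n by (rule unity_root_power)
  define f where "f s k l = (?\<omega> k - ?\<omega> i) * (?\<omega> l - ?\<omega> j) + s" for s k l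
  define X where "X s k l = (if k = i then C $$ (i, l) else C $$ (k, l) * f s k l)" for s k l
  define G where "G s = mat n n (\<lambda>(k, l). X s k l)" for s
  have sgn: "(-1) ^ (n - 1) * (-1) ^ n = (-1 :: complex)"
    using n by (cases n) (simp_all flip: power_add)
  have sG: "s * det (G s) = det C * ((\<theta> + s) ^ n - 1)" for s
  proof -
    have "mat n n (\<lambda>(k, l). C $$ (k, l) * f s k l) = multrow i s (G s)"
      by (intro eq_matI) (auto simp: G_def X_def f_def)
    then have "det (mat n n (\<lambda>(k, l). C $$ (k, l) * f s k l)) = s * det (G s)"
      using ij by (simp add: det_multrow[of i n] G_def)
    moreover have "f s k l = (\<theta> + s) + (- ?\<omega> j) * ?\<omega> k + (- ?\<omega> i) * ?\<omega> l + 1 * ?\<omega> k * ?\<omega> l" for k l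
      by (simp add: f_def \<theta>_def algebra_simps)
    moreover have pw: "(- ?\<omega> k) ^ n = (-1) ^ n" for k
      using \<omega>1[of k] by (subst power_minus) simp
    \<comment> \<open>The value is \<open>(-1)^n\<close>, so the determinant identity applies.\<close>
    have "(- ?\<omega> j) ^ n + (- ?\<omega> i) ^ n + (-1) ^ (n - 1) * 1 ^ n \<noteq> 0"
    proof
      assume "(- ?\<omega> j) ^ n + (- ?\<omega> i) ^ n + (-1) ^ (n - 1) * 1 ^ n = 0"
      then have "(-1) ^ (n - 1) * ((-1) ^ n + (-1) ^ n + (-1) ^ (n - 1)) = (0::complex)"
        by (simp add: pw)
      then have "-1 + -1 + (1::complex) = 0"
        unfolding distrib_left sgn by (simp flip: power_add mult_2)
      then show False by simp
    qed
    note det[OF this, of "\<theta> + s"]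
    moreover have "(\<theta> + s) ^ n + 1 ^ n + (-1) ^ (n - 1) * ((- ?\<omega> j) ^ n + (- ?\<omega> i) ^ n) = (\<theta> + s) ^ n - 1"
      by (simp only: pw distrib_left sgn) simp
    ultimately show ?thesis by simp
  qed
  have "((\<lambda>s. det (G s)) \<longlongrightarrow> det (G 0)) (at 0)"
    unfolding G_def
  proof (rule det_mat_tendsto)
    show "((\<lambda>s. X s k l) \<longlongrightarrow> X 0 k l) (at 0)" for k l
      unfolding X_def f_def by (cases "k = i") (auto intro!: tendsto_eq_intros)
  qed
  moreover have "((\<lambda>s. det (G s)) \<longlongrightarrow> det C * (of_nat n * \<theta> ^ (n - 1))) (at 0)"
  proof -
    have "((\<lambda>x. x ^ n) has_field_derivative of_nat n * \<theta> ^ (n - 1)) (at \<theta>)"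
      by (auto intro!: derivative_eq_intros)
    then have "((\<lambda>s. ((\<theta> + s) ^ n - \<theta> ^ n) / s) \<longlongrightarrow> of_nat n * \<theta> ^ (n - 1)) (at 0)"
      unfolding DERIV_def .
    then have "((\<lambda>s. det C * (((\<theta> + s) ^ n - \<theta> ^ n) / s)) \<longlongrightarrow> det C * (of_nat n * \<theta> ^ (n - 1))) (at 0)"
      by (intro tendsto_mult tendsto_const)
    moreover have "det C * (((\<theta> + s) ^ n - \<theta> ^ n) / s) = det (G s)" if "s \<noteq> 0" for s
      using sG[of s] that by (simp add: \<theta> field_simps)
    then have "eventually (\<lambda>s. det C * (((\<theta> + s) ^ n - \<theta> ^ n) / s) = det (G s)) (at 0)"
      unfolding eventually_at_filter by (intro always_eventually allI impI)
    ultimately show ?thesis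
      by (rule Lim_transform_eventually)
  qed
  ultimately have "det (G 0) = det C * (of_nat n * \<theta> ^ (n - 1))"
    by (rule tendsto_unique[rotated]) simp
  moreover have "det (G 0) = G 0 $$ (i, j) * cofactor (G 0) i j"
    using ij by (intro det_single_column_entry[of _ n]) (auto simp: G_def X_def f_def)
  moreover have "G 0 $$ (i, j) = C $$ (i, j)" using ij by (simp add: G_def X_def)
  moreover have "cofactor (G 0) i j = (\<Prod>k\<in>{..<n} - {i}. ?\<omega> k - ?\<omega> i) * (\<Prod>l\<in>{..<n} - {j}. ?\<omega> l - ?\<omega> j) * cofactor C i j"
    using ij by (intro cofactor_row_column_scaled[OF C]) (auto simp: G_def X_def f_def)
  ultimately have "det C * (C $$ (i, j) * cnj (C $$ (i, j))
      * (\<Prod>k\<in>{..<n} - {i}. ?\<omega> k - ?\<omega> i) * (\<Prod>l\<in>{..<n} - {j}. ?\<omega> l - ?\<omega> j)) = det C * (of_nat n * \<theta> ^ (n - 1))"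
    by (simp add: cofactor_unitary[OF U ij] mult_ac)
  then have "cmod (C $$ (i, j) * cnj (C $$ (i, j))
      * (\<Prod>k\<in>{..<n} - {i}. ?\<omega> k - ?\<omega> i) * (\<Prod>l\<in>{..<n} - {j}. ?\<omega> l - ?\<omega> j)) = cmod (of_nat n * \<theta> ^ (n - 1))"
    using dC by simp
  moreover have "cmod (\<Prod>k\<in>{..<n} - {p}. ?\<omega> k - ?\<omega> p) = real n" if "p < n" for p
  proof -
    have "cmod (\<Prod>k\<in>{..<n} - {p}. ?\<omega> k - ?\<omega> p) = cmod (\<Prod>k\<in>{..<n} - {p}. ?\<omega> p - ?\<omega> k)"
      by (simp add: norm_minus_commute flip: prod_norm)
    then show ?thesis
      unfolding prod_unity_root_differences[OF n that] by (simp add: norm_mult norm_power)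
  qed
  ultimately have "(cmod (C $$ (i, j)))\<^sup>2 * real n * real n = real n"
    using ij \<theta>(2) by (simp add: norm_mult norm_power power2_eq_square)
  then show ?thesis using n by (simp add: field_simps)
qed

section \<open>The overlap of the two eigenbases\<close>

lemma form_add:
  fixes X Y :: "complex mat"
  assumes "X \<in> carrier_mat n n" "Y \<in> carrier_mat n n" "v \<in> carrier_vec n" "w \<in> carrier_vec n"
  shows "((X + Y) *\<^sub>v v) \<bullet>c w = (X *\<^sub>v v) \<bullet>c w + (Y *\<^sub>v v) \<bullet>c w"
  using assms by (simp add: cscalar_prod_sum[of _ n] mult_mat_vec_sum[of _ n n] algebra_simps sum.distrib
      del: index_mult_mat_vec)

lemma form_smult:
  fixes X :: "complex mat"
  assumes "X \<in> carrier_mat n n" "v \<in> carrier_vec n" "w \<in> carrier_vec n"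
  shows "((c \<cdot>\<^sub>m X) *\<^sub>v v) \<bullet>c w = c * ((X *\<^sub>v v) \<bullet>c w)"
  using assms by (simp add: cscalar_prod_sum[of _ n] mult_mat_vec_sum[of _ n n] sum_distrib_left sum_distrib_right mult_ac
      del: index_mult_mat_vec)

lemma form_eigen:
  fixes A B :: "complex mat"
  assumes A: "A \<in> carrier_mat n n" and B: "B \<in> carrier_mat n n"
    and v: "v \<in> carrier_vec n" and w: "w \<in> carrier_vec n"
    and Aw: "mat_adjoint A *\<^sub>v w = cnj \<alpha> \<cdot>\<^sub>v w" and Bv: "B *\<^sub>v v = \<beta> \<cdot>\<^sub>v v"
  shows "((u \<cdot>\<^sub>m 1\<^sub>m n + (x \<cdot>\<^sub>m A + y \<cdot>\<^sub>m B + z \<cdot>\<^sub>m (A * B))) *\<^sub>v v) \<bullet>c w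
    = (v \<bullet>c w) * (u + x * \<alpha> + y * \<beta> + z * \<alpha> * \<beta>)"
proof -
  have "(A *\<^sub>v v) \<bullet>c w = v \<bullet>c (cnj \<alpha> \<cdot>\<^sub>v w)"
    unfolding Aw[symmetric] by (rule cscalar_prod_adjoint[OF A v w])
  also have "\<dots> = \<alpha> * (v \<bullet>c w)"
    using v w by (simp add: cscalar_prod_sum[of _ n] sum_distrib_left mult_ac)
  finally have Av: "(A *\<^sub>v v) \<bullet>c w = \<alpha> * (v \<bullet>c w)" .
  have Bvw: "(B *\<^sub>v v) \<bullet>c w = \<beta> * (v \<bullet>c w)"
    unfolding Bv using v w by (simp add: cscalar_prod_sum[of _ n] sum_distrib_left mult_ac)
  have "((A * B) *\<^sub>v v) \<bullet>c w = (\<beta> \<cdot>\<^sub>v (A *\<^sub>v v)) \<bullet>c w"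
    unfolding assoc_mult_mat_vec[OF A B v] Bv mult_mat_vec[OF A v] ..
  also have "\<dots> = \<beta> * ((A *\<^sub>v v) \<bullet>c w)"
    using A v w by (simp add: cscalar_prod_sum[of _ n] sum_distrib_left mult_ac del: index_mult_mat_vec)
  finally have ABv: "((A * B) *\<^sub>v v) \<bullet>c w = \<beta> * (\<alpha> * (v \<bullet>c w))"
    unfolding Av .
  have AB: "A * B \<in> carrier_mat n n" by (rule mult_carrier_mat[OF A B])
  have M2: "x \<cdot>\<^sub>m A + y \<cdot>\<^sub>m B \<in> carrier_mat n n" using A B by simp
  have M3: "x \<cdot>\<^sub>m A + y \<cdot>\<^sub>m B + z \<cdot>\<^sub>m (A * B) \<in> carrier_mat n n" using M2 AB by simp
  have "((u \<cdot>\<^sub>m 1\<^sub>m n + (x \<cdot>\<^sub>m A + y \<cdot>\<^sub>m B + z \<cdot>\<^sub>m (A * B))) *\<^sub>v v) \<bullet>c w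
    = u * ((1\<^sub>m n *\<^sub>v v) \<bullet>c w) + (x * ((A *\<^sub>v v) \<bullet>c w) + y * ((B *\<^sub>v v) \<bullet>c w) + z * (((A * B) *\<^sub>v v) \<bullet>c w))"
    using M2 M3 A B AB v w by (simp only: form_add[of _ n] form_smult[of _ n] smult_carrier_mat one_carrier_mat)
  then show ?thesis
    using v by (simp add: Av Bvw ABv algebra_simps)
qed

text \<open>The value of \<open>char_poly_pencil\<close> at \<open>-u\<close>.\<close>

lemma det_pencil:
  assumes n: "0 < n" and A: "A \<in> carrier_mat n n" and B: "B \<in> carrier_mat n n"
    and spec: "proper_joint_spectrum n [A, B, A * B] =
           {[x, y, z] | x y z. x ^ n + y ^ n + (-1) ^ (n - 1) * z ^ n = 1}"
    and q: "x ^ n + y ^ n + (-1) ^ (n - 1) * z ^ n \<noteq> 0"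
  shows "det (u \<cdot>\<^sub>m 1\<^sub>m n + (x \<cdot>\<^sub>m A + y \<cdot>\<^sub>m B + z \<cdot>\<^sub>m (A * B)))
      = u ^ n + z ^ n + (-1) ^ (n - 1) * (x ^ n + y ^ n)"
proof -
  define M where "M = x \<cdot>\<^sub>m A + y \<cdot>\<^sub>m B + z \<cdot>\<^sub>m (A * B)"
  have M: "M \<in> carrier_mat n n" using A B by (simp add: M_def)
  have "char_matrix M (- u) = u \<cdot>\<^sub>m 1\<^sub>m n + M"
    using M by (intro eq_matI) (auto simp: char_matrix_def)
  then have "poly (char_poly M) (- u) = det ((-1) \<cdot>\<^sub>m (u \<cdot>\<^sub>m 1\<^sub>m n + M))"
    unfolding char_poly_matrix[OF M] by (intro arg_cong[of _ _ det] eq_matI) auto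
  also have "\<dots> = (-1) ^ n * det (u \<cdot>\<^sub>m 1\<^sub>m n + M)"
    using M by simp
  finally have "(-1) ^ n * (- u) ^ n - (-1) ^ n * (x ^ n + y ^ n + (-1) ^ (n - 1) * z ^ n)
      = (-1) ^ n * ((-1) ^ n * det (u \<cdot>\<^sub>m 1\<^sub>m n + M))"
    using char_poly_pencil[OF n A B spec refl q] by (simp add: M_def poly_monom algebra_simps)
  moreover have "(-1) ^ n * ((-1) ^ n * d) = d" for d :: complex
    by (simp flip: mult.assoc power_mult_distrib)
  moreover have "(-1) ^ n * (- u) ^ n = u ^ n"
    by (simp flip: power_mult_distrib)
  ultimately have "det (u \<cdot>\<^sub>m 1\<^sub>m n + M) = u ^ n - (-1) ^ n * (x ^ n + y ^ n + (-1) ^ (n - 1) * z ^ n)"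
    by metis
  also have "(-1) ^ n = - ((-1) ^ (n - 1) :: complex)"
    using n by (cases n) auto
  also have "- ((-1) ^ (n - 1)) * (x ^ n + y ^ n + (-1) ^ (n - 1) * z ^ n)
      = - ((-1) ^ (n - 1) * (x ^ n + y ^ n)) - z ^ n"
    by (simp add: distrib_left flip: mult.assoc power_mult_distrib)
  finally show ?thesis
    unfolding M_def[symmetric] by simp
qed

definition overlap_mat :: "nat \<Rightarrow> (nat \<Rightarrow> complex vec) \<Rightarrow> (nat \<Rightarrow> complex vec) \<Rightarrow> complex mat" where
  "overlap_mat n e \<zeta> = mat_adjoint (basis_mat n e) * basis_mat n \<zeta>"

lemma overlap_mat_index:
  assumes "orthonormal_basis n e" "orthonormal_basis n \<zeta>" "k < n" "l < n"
  shows "overlap_mat n e \<zeta> $$ (k, l) = \<zeta> l \<bullet>c e k"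
proof -
  have "(mat_adjoint (basis_mat n e) * 1\<^sub>m n * basis_mat n \<zeta>) $$ (k, l) = (1\<^sub>m n *\<^sub>v \<zeta> l) \<bullet>c e k"
    using assms by (intro adjoint_basis_mat_mult) (auto simp: orthonormal_basis_def)
  then show ?thesis
    using assms right_mult_one_mat[OF mat_adjoint_carrier[OF basis_mat_carrier[of n e]]]
    by (simp add: overlap_mat_def orthonormal_basis_def del: index_mult_mat(1))
qed

lemma unitary_mat_mult:
  assumes "unitary_mat n U" "unitary_mat n V"
  shows "unitary_mat n (U * V)"
proof -
  have U: "U \<in> carrier_mat n n" "mat_adjoint U * U = 1\<^sub>m n" and V: "V \<in> carrier_mat n n" "mat_adjoint V * V = 1\<^sub>m n"
    using assms by (auto simp: unitary_mat_def)
  note U' = mat_adjoint_carrier[OF U(1)] and V' = mat_adjoint_carrier[OF V(1)]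
  have UV: "U * V \<in> carrier_mat n n" using U V by simp
  have "mat_adjoint (U * V) * (U * V) = mat_adjoint V * (mat_adjoint U * (U * V))"
    unfolding mat_adjoint_mult[OF U(1) V(1)] by (rule assoc_mult_mat[OF V' U' UV])
  also have "mat_adjoint U * (U * V) = V"
    using assoc_mult_mat[OF U' U(1) V(1)] U(2) V(1) by simp
  finally have 1: "mat_adjoint (U * V) * (U * V) = 1\<^sub>m n" using V by simp
  moreover from 1 have "(U * V) * mat_adjoint (U * V) = 1\<^sub>m n"
    by (rule mat_mult_left_right_inverse[rotated 2]) (use UV in auto)
  ultimately show ?thesis using UV by (simp add: unitary_mat_def)
qed

lemma mat_adjoint_adjoint [simp]: "mat_adjoint (mat_adjoint A) = (A :: complex mat)"
  by (intro eq_matI) auto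

lemma unitary_mat_adjoint: "unitary_mat n U \<Longrightarrow> unitary_mat n (mat_adjoint U)"
  by (simp add: unitary_mat_def)

lemma overlap_mat_unitary:
  "orthonormal_basis n e \<Longrightarrow> orthonormal_basis n \<zeta> \<Longrightarrow> unitary_mat n (overlap_mat n e \<zeta>)"
  unfolding overlap_mat_def by (intro unitary_mat_mult unitary_mat_adjoint basis_mat_unitary)

text \<open>Multiplying \<open>u + v A + y B + z A B\<close> from the left by the adjoint eigenbasis of \<open>A\<close> and from the right by the
  eigenbasis of \<open>B\<close> scales the entry \<open>(k, l)\<close> of the overlap matrix by
  \<open>u + v \<omega>\<^sub>k + y \<omega>\<^sub>l + z \<omega>\<^sub>k \<omega>\<^sub>l\<close>.\<close>

lemma eigenbases_unbiased:
  assumes n: "0 < n" and A: "A \<in> carrier_mat n n" and B: "B \<in> carrier_mat n n"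
    and spec: "proper_joint_spectrum n [A, B, A * B] =
           {[x, y, z] | x y z. x ^ n + y ^ n + (-1) ^ (n - 1) * z ^ n = 1}"
    and normal: "A * mat_adjoint A = mat_adjoint A * A"
    and e: "orthonormal_basis n e" "\<And>j. j < n \<Longrightarrow> A *\<^sub>v e j = unity_root n j \<cdot>\<^sub>v e j"
    and \<zeta>: "orthonormal_basis n \<zeta>" "\<And>j. j < n \<Longrightarrow> B *\<^sub>v \<zeta> j = unity_root n j \<cdot>\<^sub>v \<zeta> j"
    and ij: "i < n" "j < n"
  shows "(cmod (overlap_mat n e \<zeta> $$ (i, j)))\<^sup>2 = 1 / real n"
proof (rule unbiased_of_biaffine_determinants[OF n overlap_mat_unitary[OF e(1) \<zeta>(1)] ij])
  fix u v y z :: complex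
  assume q: "v ^ n + y ^ n + (-1) ^ (n - 1) * z ^ n \<noteq> 0"
  let ?E = "basis_mat n e" and ?V = "basis_mat n \<zeta>" and ?C = "overlap_mat n e \<zeta>"
  define T where "T = u \<cdot>\<^sub>m 1\<^sub>m n + (v \<cdot>\<^sub>m A + y \<cdot>\<^sub>m B + z \<cdot>\<^sub>m (A * B))"
  have T: "T \<in> carrier_mat n n" using A B by (simp add: T_def)
  have ec: "e k \<in> carrier_vec n" if "k < n" for k using e(1) that by (auto simp: orthonormal_basis_def)
  have \<zeta>c: "\<zeta> k \<in> carrier_vec n" if "k < n" for k using \<zeta>(1) that by (auto simp: orthonormal_basis_def)
  note E' = mat_adjoint_carrier[OF basis_mat_carrier[of n e]]
  have "mat n n (\<lambda>(k, l). ?C $$ (k, l) * (u + v * unity_root n k + y * unity_root n l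
          + z * unity_root n k * unity_root n l)) = mat_adjoint ?E * T * ?V"
  proof (rule eq_matI)
    fix k l assume "k < dim_row (mat_adjoint ?E * T * ?V)" "l < dim_col (mat_adjoint ?E * T * ?V)"
    then have kl: "k < n" "l < n" by simp_all
    have "(mat_adjoint ?E * T * ?V) $$ (k, l) = (T *\<^sub>v \<zeta> l) \<bullet>c e k"
      using kl by (intro adjoint_basis_mat_mult ec \<zeta>c T)
    also have "\<dots> = (\<zeta> l \<bullet>c e k) * (u + v * unity_root n k + y * unity_root n l + z * unity_root n k * unity_root n l)"
      unfolding T_def using kl
      by (intro form_eigen[OF A B \<zeta>c ec] normal_adjoint_eigenvector[OF A normal ec] e(2) \<zeta>(2))
    finally show "mat n n (\<lambda>(k, l). ?C $$ (k, l) * (u + v * unity_root n k + y * unity_root n l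
          + z * unity_root n k * unity_root n l)) $$ (k, l) = (mat_adjoint ?E * T * ?V) $$ (k, l)"
      using kl by (simp add: overlap_mat_index[OF e(1) \<zeta>(1)] del: index_mult_mat(1))
  qed simp_all
  also have "det (mat_adjoint ?E * T * ?V) = det (mat_adjoint ?E) * det T * det ?V"
    using det_mult[OF mult_carrier_mat[OF E' T] basis_mat_carrier[of n \<zeta>]] det_mult[OF E' T] by simp
  also have "\<dots> = det ?C * det T"
    using det_mult[OF E' basis_mat_carrier[of n \<zeta>]] by (simp add: overlap_mat_def)
  also have "det T = u ^ n + z ^ n + (-1) ^ (n - 1) * (v ^ n + y ^ n)"
    unfolding T_def by (rule det_pencil[OF n A B spec q])
  finally show "det (mat n n (\<lambda>(k, l). ?C $$ (k, l) * (u + v * unity_root n k + y * unity_root n l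
          + z * unity_root n k * unity_root n l)))
      = det ?C * (u ^ n + z ^ n + (-1) ^ (n - 1) * (v ^ n + y ^ n))" .
qed

text \<open>The defining equations of the transition matrix \<open>C\<close> amount to \<open>V C = E\<close> for the matrices of basis
  vectors, and \<open>V\<close> is unitary.\<close>

lemma transition_mat_eq_overlap:
  assumes e: "orthonormal_basis n e" and \<zeta>: "orthonormal_basis n \<zeta>"
  shows "transition_mat n e \<zeta> = overlap_mat n \<zeta> e"
proof -
  let ?E = "basis_mat n e" and ?V = "basis_mat n \<zeta>"
  have ec: "e k \<in> carrier_vec n" if "k < n" for k using e that by (auto simp: orthonormal_basis_def)
  have \<zeta>c: "\<zeta> k \<in> carrier_vec n" if "k < n" for k using \<zeta> that by (auto simp: orthonormal_basis_def)
  have V: "?V * mat_adjoint ?V = 1\<^sub>m n" "mat_adjoint ?V * ?V = 1\<^sub>m n"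
    using basis_mat_unitary[OF \<zeta>] by (auto simp: unitary_mat_def)
  note V' = mat_adjoint_carrier[OF basis_mat_carrier[of n \<zeta>]]
  have coords: "(\<forall>r<n. e r = finsum_vec TYPE(complex) n (\<lambda>j. C $$ (j, r) \<cdot>\<^sub>v \<zeta> j) {..<n}) \<longleftrightarrow> ?V * C = ?E"
    if C: "C \<in> carrier_mat n n" for C
  proof -
    have entry: "finsum_vec TYPE(complex) n (\<lambda>j. C $$ (j, r) \<cdot>\<^sub>v \<zeta> j) {..<n} $ i = (?V * C) $$ (i, r)"
      if "i < n" "r < n" for i r
    proof -
      have "finsum_vec TYPE(complex) n (\<lambda>j. C $$ (j, r) \<cdot>\<^sub>v \<zeta> j) {..<n} $ i = (\<Sum>j<n. C $$ (j, r) * \<zeta> j $ i)"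
        using that \<zeta>c by (subst index_finsum_vec) (auto intro!: sum.cong simp: \<zeta>c[THEN carrier_vecD])
      then show ?thesis
        using that C by (simp add: scalar_prod_def atLeast0LessThan basis_mat_def mult.commute)
    qed
    have dim: "finsum_vec TYPE(complex) n (\<lambda>j. C $$ (j, r) \<cdot>\<^sub>v \<zeta> j) {..<n} \<in> carrier_vec n" for r
      using \<zeta>c by (intro finsum_vec_closed) auto
    have "(\<forall>r<n. e r = finsum_vec TYPE(complex) n (\<lambda>j. C $$ (j, r) \<cdot>\<^sub>v \<zeta> j) {..<n})
        \<longleftrightarrow> (\<forall>r<n. \<forall>i<n. e r $ i = (?V * C) $$ (i, r))"
    proof (intro all_cong1 imp_cong refl)
      fix r assume r: "r < n"
      let ?F = "finsum_vec TYPE(complex) n (\<lambda>j. C $$ (j, r) \<cdot>\<^sub>v \<zeta> j) {..<n}"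
      show "e r = ?F \<longleftrightarrow> (\<forall>i<n. e r $ i = (?V * C) $$ (i, r))"
      proof
        assume "\<forall>i<n. e r $ i = (?V * C) $$ (i, r)"
        then show "e r = ?F"
          using entry[OF _ r] carrier_vecD[OF dim[of r]] carrier_vecD[OF ec[OF r]] by (intro eq_vecI) auto
      qed (use entry[OF _ r] in auto)
    qed
    also have "\<dots> \<longleftrightarrow> ?V * C = ?E"
    proof
      assume *: "\<forall>r<n. \<forall>i<n. e r $ i = (?V * C) $$ (i, r)"
      show "?V * C = ?E"
        using C * by (intro eq_matI) (simp_all add: basis_mat_def del: index_mult_mat(1))
    qed (auto simp: basis_mat_def)
    finally show ?thesis .
  qed
  show ?thesis
    unfolding transition_mat_def
  proof (rule the_equality)
    have "?V * overlap_mat n \<zeta> e = (?V * mat_adjoint ?V) * ?E"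
      unfolding overlap_mat_def by (rule assoc_mult_mat[OF basis_mat_carrier V' basis_mat_carrier, symmetric])
    then show "overlap_mat n \<zeta> e \<in> carrier_mat n n \<and>
        (\<forall>r<n. e r = finsum_vec TYPE(complex) n (\<lambda>j. overlap_mat n \<zeta> e $$ (j, r) \<cdot>\<^sub>v \<zeta> j) {..<n})"
      using coords[of "overlap_mat n \<zeta> e"] overlap_mat_unitary[OF \<zeta> e] V by (simp add: unitary_mat_def)
  next
    fix C assume C: "C \<in> carrier_mat n n \<and> (\<forall>r<n. e r = finsum_vec TYPE(complex) n (\<lambda>j. C $$ (j, r) \<cdot>\<^sub>v \<zeta> j) {..<n})"
    then have "?V * C = ?E" using coords by blast
    then have "overlap_mat n \<zeta> e = (mat_adjoint ?V * ?V) * C"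
      unfolding overlap_mat_def using assoc_mult_mat[OF V' basis_mat_carrier[of n \<zeta>], of C n] C by simp
    then show "C = overlap_mat n \<zeta> e" using V C left_mult_one_mat[of C n n] by simp
  qed
qed

lemma scaled_unitary_hadamard:
  assumes U: "unitary_mat n W" and m: "\<And>i j. i < n \<Longrightarrow> j < n \<Longrightarrow> (cmod (W $$ (i, j)))\<^sup>2 = 1 / real n"
  shows "complex_hadamard n (complex_of_real (sqrt (real n)) \<cdot>\<^sub>m W)"
proof -
  let ?h = "complex_of_real (sqrt (real n)) \<cdot>\<^sub>m W"
  have W: "W \<in> carrier_mat n n" "W * mat_adjoint W = 1\<^sub>m n" using U by (auto simp: unitary_mat_def)
  have "cmod (?h $$ (i, j)) = 1" if "i < n" "j < n" for i j
  proof -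
    have "cmod (W $$ (i, j)) = sqrt (1 / real n)"
      using m[OF that] by (metis norm_ge_zero real_sqrt_unique)
    then show ?thesis
      using that W by (simp add: norm_mult real_sqrt_divide)
  qed
  moreover have "row ?h i \<bullet>c row ?h j = 0" if "i < n" "j < n" "i \<noteq> j" for i j
  proof -
    have "0 = (W * mat_adjoint W) $$ (i, j)" using that W by simp
    also have "\<dots> = (\<Sum>l<n. W $$ (i, l) * cnj (W $$ (j, l)))"
      using that W(1) by (simp add: scalar_prod_def atLeast0LessThan)
    finally have 0: "(\<Sum>l<n. W $$ (i, l) * cnj (W $$ (j, l))) = 0" by simp
    have "row ?h i \<bullet>c row ?h j
        = (\<Sum>l<n. complex_of_real (sqrt (real n)) * complex_of_real (sqrt (real n)) * (W $$ (i, l) * cnj (W $$ (j, l))))"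
      using that W(1) by (subst cscalar_prod_sum[of _ n]) (auto intro!: sum.cong)
    then show ?thesis by (simp add: 0 flip: sum_distrib_left)
  qed
  ultimately show ?thesis using W by (simp add: complex_hadamard_def)
qed

section \<open>The pair in orders three, four and five\<close>

lemma unity_root_four_power: "unity_root 4 j = \<i> ^ j"
proof -
  have "unity_root 4 j = cis (real j * (pi / 2))" by (simp add: unity_root_def mult_ac)
  also have "\<dots> = cis (pi / 2) ^ j" by (rule Complex.DeMoivre[symmetric])
  finally show ?thesis by simp
qed

lemma unity_root_four: "unity_root 4 0 = 1" "unity_root 4 (Suc 0) = \<i>" "unity_root 4 2 = -1" "unity_root 4 3 = - \<i>"
  unfolding unity_root_four_power by (simp_all add: eval_nat_numeral)

lemma D_mat_index: "i < n \<Longrightarrow> j < n \<Longrightarrow> D_mat n $$ (i, j) = (if i = j then unity_root n i else 0)"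
  by (simp add: D_mat_def unity_root_def)

lemma D_mat_carrier [simp]: "D_mat n \<in> carrier_mat n n"
  by (simp add: D_mat_def)

lemma D_mat_dim [simp]: "dim_row (D_mat n) = n" "dim_col (D_mat n) = n"
  by (simp_all add: D_mat_def)

lemma pow_mat_four:
  fixes X :: "complex mat"
  assumes X: "X \<in> carrier_mat n n"
  shows "X ^\<^sub>m 4 = (X * X) * (X * X)"
proof -
  have XX: "X * X \<in> carrier_mat n n" using X by simp
  have "X ^\<^sub>m 4 = X * X * X * X"
    using X by (simp add: eval_nat_numeral)
  also have "\<dots> = (X * X) * (X * X)"
    by (rule assoc_mult_mat[OF XX X X])
  finally show ?thesis .
qed

lemma mat_mult_index_sum:
  fixes X Y :: "complex mat"
  assumes "X \<in> carrier_mat n n" "Y \<in> carrier_mat n n" "i < n" "j < n"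
  shows "(X * Y) $$ (i, j) = (\<Sum>k<n. X $$ (i, k) * Y $$ (k, j))"
  using assms by (simp add: scalar_prod_def atLeast0LessThan)

text \<open>The matrix \<open>A\<close> stands for the first operator in an eigenbasis of the second, which becomes the diagonal
  matrix \<open>D\<close>. With \<open>S = A^2 + D^2\<close> and \<open>Q = A D + D A\<close> the hypotheses are \<open>(S + Q)^2 = (S - Q)^2 = 2\<close>,
  so \<open>S^2 + Q^2 = 2\<close>. On the diagonal \<open>S^2\<close> already contributes 2, hence \<open>Q^2\<close> has zero diagonal:
  \<open>\<Sum>\<^sub>k A\<^sub>m\<^sub>k A\<^sub>k\<^sub>m (\<omega>\<^sub>m + \<omega>\<^sub>k)^2 = 0\<close>. The factor \<open>(\<omega>\<^sub>m + \<omega>\<^sub>k)^2\<close> vanishes for \<open>k = m + 2\<close> and takes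
  opposite values at \<open>m + 1\<close> and \<open>m + 3\<close>.\<close>

lemma order_four_cyclic:
  fixes A :: "complex mat"
  assumes A: "A \<in> carrier_mat 4 4" and A4: "A ^\<^sub>m 4 = 1\<^sub>m 4"
    and plus: "(A + 1 \<cdot>\<^sub>m D_mat 4) ^\<^sub>m 4 = 2 \<cdot>\<^sub>m 1\<^sub>m 4"
    and minus: "(A + (-1) \<cdot>\<^sub>m D_mat 4) ^\<^sub>m 4 = 2 \<cdot>\<^sub>m 1\<^sub>m 4"
    and diag: "\<And>m. m < 4 \<Longrightarrow> A $$ (m, m) = 0" "\<And>m. m < 4 \<Longrightarrow> (A * A) $$ (m, m) = 0"
    and m: "m < 4"
  shows "A $$ (m, (m + 1) mod 4) * A $$ ((m + 1) mod 4, m) = A $$ (m, (m + 3) mod 4) * A $$ ((m + 3) mod 4, m)"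
proof -
  let ?\<omega> = "unity_root 4"
  define s where "s k l = (A * A) $$ (k, l) + (if k = l then (?\<omega> k)\<^sup>2 else 0)" for k l
  define q where "q k l = A $$ (k, l) * (?\<omega> k + ?\<omega> l)" for k l
  have AA: "A * A \<in> carrier_mat 4 4" using A by simp
  have pw: "(\<Sum>k<4. (s m k + c * q m k) * (s k m + c * q k m)) = 2"
    if c: "c\<^sup>2 = 1" and X4: "(A + c \<cdot>\<^sub>m D_mat 4) ^\<^sub>m 4 = 2 \<cdot>\<^sub>m 1\<^sub>m 4" for c
  proof -
    define X where "X = A + c \<cdot>\<^sub>m D_mat 4"
    have X: "X \<in> carrier_mat 4 4" using A by (simp add: X_def)
    have XX: "X * X \<in> carrier_mat 4 4" using X by simp
    have e: "X $$ (k, l) = A $$ (k, l) + (if k = l then c * ?\<omega> k else 0)" if "k < 4" "l < 4" for k l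
      using that A by (simp add: X_def D_mat_index)
    have X2: "(X * X) $$ (k, l) = s k l + c * q k l" if kl: "k < 4" "l < 4" for k l
    proof -
      have "(X * X) $$ (k, l) = (\<Sum>j<4. (A $$ (k, j) + (if k = j then c * ?\<omega> k else 0))
          * (A $$ (j, l) + (if j = l then c * ?\<omega> j else 0)))"
        unfolding mat_mult_index_sum[OF X X kl] using kl by (intro sum.cong refl) (simp add: e)
      also have "\<dots> = (\<Sum>j<4. A $$ (k, j) * A $$ (j, l) + (if j = k then c * ?\<omega> k * A $$ (k, l) else 0)
          + (if j = l then c * ?\<omega> l * A $$ (k, l) else 0) + (if j = k then if k = l then c\<^sup>2 * (?\<omega> k)\<^sup>2 else 0 else 0))"
        by (intro sum.cong refl) (auto simp: algebra_simps power2_eq_square)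
      also have "\<dots> = (A * A) $$ (k, l) + c * ?\<omega> k * A $$ (k, l) + c * ?\<omega> l * A $$ (k, l)
          + (if k = l then c\<^sup>2 * (?\<omega> k)\<^sup>2 else 0)"
        unfolding mat_mult_index_sum[OF A A kl] using kl by (simp add: sum.distrib)
      finally show ?thesis by (simp add: s_def q_def c algebra_simps)
    qed
    have "(\<Sum>k<4. (X * X) $$ (m, k) * (X * X) $$ (k, m)) = (2 \<cdot>\<^sub>m 1\<^sub>m 4 :: complex mat) $$ (m, m)"
      unfolding mat_mult_index_sum[OF XX XX m m, symmetric] pow_mat_four[OF X, symmetric]
      unfolding X_def X4 ..
    then show ?thesis
      using m by (simp add: X2)
  qed
  have "(\<Sum>k<4. s m k * s k m) = (\<Sum>k<4. (A * A) $$ (m, k) * (A * A) $$ (k, m)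
      + (if k = m then 2 * (?\<omega> m)\<^sup>2 * (A * A) $$ (m, m) + (?\<omega> m)\<^sup>2 * (?\<omega> m)\<^sup>2 else 0))"
    by (intro sum.cong refl) (auto simp: s_def algebra_simps)
  also have "\<dots> = (\<Sum>k<4. (A * A) $$ (m, k) * (A * A) $$ (k, m)) + (?\<omega> m)\<^sup>2 * (?\<omega> m)\<^sup>2"
    using m by (simp add: sum.distrib diag(2) del: index_mult_mat)
  also have "(\<Sum>k<4. (A * A) $$ (m, k) * (A * A) $$ (k, m)) = 1"
    unfolding mat_mult_index_sum[OF AA AA m m, symmetric] pow_mat_four[OF A, symmetric] A4 using m by simp
  also have "(?\<omega> m)\<^sup>2 * (?\<omega> m)\<^sup>2 = 1"
    using unity_root_power[of 4 m] by (simp flip: power_add)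
  finally have ss: "(\<Sum>k<4. s m k * s k m) = 2" by simp
  have "(\<Sum>k<4. (s m k + 1 * q m k) * (s k m + 1 * q k m)) + (\<Sum>k<4. (s m k + (-1) * q m k) * (s k m + (-1) * q k m))
      = 2 * (\<Sum>k<4. s m k * s k m) + 2 * (\<Sum>k<4. q m k * q k m)"
    unfolding sum.distrib[symmetric] sum_distrib_left by (intro sum.cong refl) (simp add: algebra_simps)
  moreover have "(\<Sum>k<4. (s m k + 1 * q m k) * (s k m + 1 * q k m)) = 2"
    by (rule pw[OF _ plus]) simp
  moreover have "(\<Sum>k<4. (s m k + (-1) * q m k) * (s k m + (-1) * q k m)) = 2"
    by (rule pw[OF _ minus]) simp
  ultimately have "(\<Sum>k<4. q m k * q k m) = 0"
    by (simp only: ss) simp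
  then have "q m 0 * q 0 m + q m (Suc 0) * q (Suc 0) m + q m 2 * q 2 m + q m 3 * q 3 m = 0"
    by (simp add: sum_lessThan_345)
  moreover define w where "w k = A $$ (m, k) * A $$ (k, m)" for k
  moreover have "q m k * q k m = w k * (?\<omega> m + ?\<omega> k)\<^sup>2" for k
    by (simp add: q_def w_def power2_eq_square algebra_simps)
  ultimately have weights: "w 0 * (?\<omega> m + 1)\<^sup>2 + w (Suc 0) * (?\<omega> m + \<i>)\<^sup>2 + w 2 * (?\<omega> m + -1)\<^sup>2
      + w 3 * (?\<omega> m + - \<i>)\<^sup>2 = 0"
    by (simp only: unity_root_four)
  have w0: "w m = 0" using diag(1)[OF m] by (simp add: w_def)
  have two_i: "(1 + \<i>)\<^sup>2 = 2 * \<i>" "(\<i> + 1)\<^sup>2 = 2 * \<i>" "(1 + - \<i>)\<^sup>2 = - (2 * \<i>)" "(\<i> + -1)\<^sup>2 = - (2 * \<i>)"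
     "(- 1 + - \<i>)\<^sup>2 = 2 * \<i>" "(- \<i> + - 1)\<^sup>2 = 2 * \<i>" "(- 1 + \<i>)\<^sup>2 = - (2 * \<i>)" "(- \<i> + 1)\<^sup>2 = - (2 * \<i>)"
    by (simp_all add: power2_eq_square algebra_simps)
  have cancel: "p = p'" if "p * (2 * \<i>) + p' * - (2 * \<i>) = 0" for p p' :: complex
  proof -
    have "(p - p') * (2 * \<i>) = 0" using that by (simp add: algebra_simps)
    then show ?thesis by simp
  qed
  have "m = 0 \<or> m = Suc 0 \<or> m = 2 \<or> m = 3" using m by auto
  then have "w ((m + 1) mod 4) = w ((m + 3) mod 4)"
  proof (elim disjE)
    assume m: "m = 0"
    have "w 1 = w 3"
      by (rule cancel) (use weights w0 in \<open>simp add: m unity_root_four two_i[simplified]\<close>)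
    then show ?thesis by (simp add: m)
  next
    assume m: "m = Suc 0"
    have "w 0 = w 2"
      by (rule cancel) (use weights w0 in \<open>simp add: m unity_root_four two_i[simplified]\<close>)
    then show ?thesis by (simp add: m numeral_2_eq_2)
  next
    assume m: "m = 2"
    have "w 3 = w 1"
      by (rule cancel) (use weights w0 in \<open>simp add: m unity_root_four two_i[simplified]\<close>)
    then show ?thesis by (simp add: m)
  next
    assume m: "m = 3"
    have "w 0 = w 2"
      by (rule cancel) (use weights w0 in \<open>simp add: m unity_root_four two_i[simplified]\<close>)
    then show ?thesis by (simp add: m)
  qed
  then show ?thesis by (simp add: w_def)
qed

text \<open>The permutations act on the rows and columns below \<open>n\<close> and are extended by the identity. The second
  permutation matrix carries the inverse of \<open>\<tau>\<close>, since it multiplies the Fourier matrix from the right.\<close>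

lemma (in hadamard_array) hadamard_similar_of_fourier_rows:
  assumes fr: fourier_rows and H: "H \<in> carrier_mat n n" "\<And>i l. i < n \<Longrightarrow> l < n \<Longrightarrow> H $$ (i, l) = h i l"
  shows "hadamard_similar n (fourier_mat n) H"
proof -
  obtain k \<tau> \<mu> c where k: "bij_betw k {..<n} {..<n}" and \<tau>: "bij_betw \<tau> {..<n} {..<n}"
    and \<mu>: "\<And>i. i < n \<Longrightarrow> cmod (\<mu> i) = 1" and c: "\<And>l. l < n \<Longrightarrow> cmod (c l) = 1"
    and h: "\<And>i l. i < n \<Longrightarrow> l < n \<Longrightarrow> h i l = \<mu> i * cis (2 * pi * real (k i * \<tau> l) / real n) * c l"
    using fr unfolding fourier_rows_def by blast
  define p where "p i = (if i < n then k i else i)" for i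
  define t where "t i = (if i < n then \<tau> i else i)" for i
  have p: "p permutes {..<n}"
    by (rule bij_imp_permutes) (use k in \<open>auto simp: p_def bij_betw_def inj_on_def image_def\<close>)
  have t: "t permutes {..<n}"
    by (rule bij_imp_permutes) (use \<tau> in \<open>auto simp: t_def bij_betw_def inj_on_def image_def\<close>)
  define L1 where "L1 = mat n n (\<lambda>(i, j). if i = j then \<mu> i else 0)"
  define P1 where "P1 = mat n n (\<lambda>(i, j). if j = p i then (1 :: complex) else 0)"
  define P2 where "P2 = mat n n (\<lambda>(i, j). if j = inv_into UNIV t i then (1 :: complex) else 0)"
  define L2 where "L2 = mat n n (\<lambda>(i, j). if i = j then c i else 0)"
  have carr: "L1 \<in> carrier_mat n n" "P1 \<in> carrier_mat n n" "fourier_mat n \<in> carrier_mat n n"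
    "P2 \<in> carrier_mat n n" "L2 \<in> carrier_mat n n"
    by (simp_all add: L1_def P1_def P2_def L2_def fourier_mat_def)
  have pn: "p i < n" if "i < n" for i using permutes_in_image[OF p, of i] that by simp
  have tn: "t i < n" if "i < n" for i using permutes_in_image[OF t, of i] that by simp
  have LP: "(L1 * P1) $$ (i, m) = (if m = p i then \<mu> i else 0)" if "i < n" "m < n" for i m
  proof -
    have "(L1 * P1) $$ (i, m) = (\<Sum>j<n. if j = i then (if m = p i then \<mu> i else 0) else 0)"
      unfolding mat_mult_index_sum[OF carr(1,2) that] using that
      by (intro sum.cong refl) (auto simp: L1_def P1_def)
    then show ?thesis using that by simp
  qed
  have LP': "L1 * P1 \<in> carrier_mat n n" by (rule mult_carrier_mat[OF carr(1,2)])
  have LPF: "(L1 * P1 * fourier_mat n) $$ (i, m) = \<mu> i * fourier_mat n $$ (p i, m)" if "i < n" "m < n" for i m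
  proof -
    have "(L1 * P1 * fourier_mat n) $$ (i, m) = (\<Sum>j<n. if j = p i then \<mu> i * fourier_mat n $$ (p i, m) else 0)"
      unfolding mat_mult_index_sum[OF LP' carr(3) that] using that
      by (intro sum.cong refl) (auto simp: LP simp del: index_mult_mat)
    then show ?thesis using pn that by simp
  qed
  have LPF': "L1 * P1 * fourier_mat n \<in> carrier_mat n n" by (rule mult_carrier_mat[OF LP' carr(3)])
  have LPFP: "(L1 * P1 * fourier_mat n * P2) $$ (i, l) = \<mu> i * fourier_mat n $$ (p i, t l)" if "i < n" "l < n" for i l
  proof -
    have "l = inv_into UNIV t j \<longleftrightarrow> j = t l" for j
      using permutes_inverses[OF t] by metis
    then have "(L1 * P1 * fourier_mat n * P2) $$ (i, l) = (\<Sum>j<n. if j = t l then \<mu> i * fourier_mat n $$ (p i, t l) else 0)"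
      unfolding mat_mult_index_sum[OF LPF' carr(4) that] using that
      by (intro sum.cong refl) (auto simp: LPF P2_def simp del: index_mult_mat)
    then show ?thesis using tn that by simp
  qed
  have LPFP': "L1 * P1 * fourier_mat n * P2 \<in> carrier_mat n n" by (rule mult_carrier_mat[OF LPF' carr(4)])
  have "H = L1 * P1 * fourier_mat n * P2 * L2"
  proof (rule eq_matI)
    fix i l assume "i < dim_row (L1 * P1 * fourier_mat n * P2 * L2)" "l < dim_col (L1 * P1 * fourier_mat n * P2 * L2)"
    then have il: "i < n" "l < n" by (simp_all add: L1_def L2_def)
    have "(L1 * P1 * fourier_mat n * P2 * L2) $$ (i, l) = (\<Sum>j<n. if j = l then \<mu> i * fourier_mat n $$ (p i, t l) * c l else 0)"
      unfolding mat_mult_index_sum[OF LPFP' carr(5) il] using il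
      by (intro sum.cong refl) (auto simp: LPFP L2_def simp del: index_mult_mat)
    also have "\<dots> = \<mu> i * fourier_mat n $$ (k i, \<tau> l) * c l"
      using il by (simp add: p_def t_def)
    also have "\<dots> = h i l"
      using il bij_betwE[OF k] bij_betwE[OF \<tau>] by (simp add: fourier_mat_def h[OF il] mult.commute)
    finally show "H $$ (i, l) = (L1 * P1 * fourier_mat n * P2 * L2) $$ (i, l)"
      using H(2)[OF il] by simp
  qed (use H in \<open>simp_all add: L1_def L2_def\<close>)
  moreover have "unimodular_diagonal_mat n L1" "unimodular_diagonal_mat n L2"
    using \<mu> c by (auto simp: unimodular_diagonal_mat_def diagonal_mat_def L1_def L2_def)
  moreover have "permutation_mat n P1" "permutation_mat n P2"
    using p permutes_inv[OF t] by (auto simp: permutation_mat_def P1_def P2_def)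
  ultimately show ?thesis
    unfolding hadamard_similar_def by blast
qed

lemma hadamard_array_of_complex_hadamard:
  assumes n: "0 < n" and H: "complex_hadamard n H"
  shows "hadamard_array n (\<lambda>i l. H $$ (i, l))"
proof
  show "cmod (H $$ (i, l)) = 1" if "i < n" "l < n" for i l
    using H that by (simp add: complex_hadamard_def)
  fix i j assume ij: "i < n" "j < n" "i \<noteq> j"
  have Hc: "H \<in> carrier_mat n n" using H by (simp add: complex_hadamard_def)
  have "row H i \<bullet>c row H j = 0" using H ij by (simp add: complex_hadamard_def)
  then show "(\<Sum>l<n. H $$ (i, l) * cnj (H $$ (j, l))) = 0"
    using ij Hc by (simp add: cscalar_prod_sum[of _ n])
qed (rule n)

lemma adjoint_overlap_mat: "mat_adjoint (overlap_mat n e \<zeta>) = overlap_mat n \<zeta> e"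
  unfolding overlap_mat_def
  by (simp add: mat_adjoint_mult[OF mat_adjoint_carrier[OF basis_mat_carrier[of n e]] basis_mat_carrier[of n \<zeta>]])

lemma overlap_mat_carrier [simp]: "overlap_mat n e \<zeta> \<in> carrier_mat n n"
  unfolding overlap_mat_def by (rule mult_carrier_mat[OF mat_adjoint_carrier[OF basis_mat_carrier] basis_mat_carrier])

lemma change_of_basis:
  assumes M: "M \<in> carrier_mat n n" and e: "orthonormal_basis n e"
  shows "mat_adjoint (basis_mat n \<zeta>) * M * basis_mat n \<zeta>
      = overlap_mat n \<zeta> e * (mat_adjoint (basis_mat n e) * M * basis_mat n e) * overlap_mat n e \<zeta>"
proof -
  let ?P = "basis_mat n e" and ?Q = "basis_mat n \<zeta>"
  note c = basis_mat_carrier[of n e] mat_adjoint_carrier[OF basis_mat_carrier[of n e]]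
    basis_mat_carrier[of n \<zeta>] mat_adjoint_carrier[OF basis_mat_carrier[of n \<zeta>]]
  have PP: "?P * mat_adjoint ?P = 1\<^sub>m n" using basis_mat_unitary[OF e] by (simp add: unitary_mat_def)
  have cancel: "?P * (mat_adjoint ?P * X) = X" if "X \<in> carrier_mat n n" for X
    using assoc_mult_mat[OF c(1,2) that] PP left_mult_one_mat[OF that] by simp
  have "overlap_mat n \<zeta> e * (mat_adjoint ?P * M * ?P) * overlap_mat n e \<zeta>
      = mat_adjoint ?Q * (?P * (mat_adjoint ?P * (M * (?P * (mat_adjoint ?P * ?Q)))))"
    unfolding overlap_mat_def using c M
    by (simp add: assoc_mult_mat[of _ n n _ n _ n] mult_carrier_mat[of _ n n _ n])
  also have "\<dots> = mat_adjoint ?Q * (M * ?Q)"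
    using c M by (simp add: cancel mult_carrier_mat[of _ n n _ n])
  also have "\<dots> = mat_adjoint ?Q * M * ?Q"
    by (rule assoc_mult_mat[OF c(4) M c(3), symmetric])
  finally show ?thesis ..
qed

lemma eigenbasis_diagonalizes:
  assumes A: "A \<in> carrier_mat n n" and e: "orthonormal_basis n e" "\<And>j. j < n \<Longrightarrow> A *\<^sub>v e j = unity_root n j \<cdot>\<^sub>v e j"
  shows "mat_adjoint (basis_mat n e) * A * basis_mat n e = D_mat n"
proof (rule eq_matI)
  fix k l assume "k < dim_row (D_mat n)" "l < dim_col (D_mat n)"
  then have kl: "k < n" "l < n" by simp_all
  have ec: "e j \<in> carrier_vec n" if "j < n" for j using e(1) that by (auto simp: orthonormal_basis_def)
  have "(mat_adjoint (basis_mat n e) * A * basis_mat n e) $$ (k, l) = (A *\<^sub>v e l) \<bullet>c e k"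
    by (intro adjoint_basis_mat_mult ec A kl)
  also have "\<dots> = unity_root n l * (e l \<bullet>c e k)"
    unfolding e(2)[OF kl(2)] by (rule smult_scalar_prod_distrib[OF ec[OF kl(2)] carrier_vec_conjugate[OF ec[OF kl(1)]]])
  also have "\<dots> = D_mat n $$ (k, l)"
    using e(1) kl by (auto simp: orthonormal_basis_def D_mat_index)
  finally show "(mat_adjoint (basis_mat n e) * A * basis_mat n e) $$ (k, l) = D_mat n $$ (k, l)" .
qed simp_all

lemma conjugated_diagonal_index:
  assumes W: "W \<in> carrier_mat n n" and ij: "i < n" "j < n"
  shows "(W * mat n n (\<lambda>(i, j). if i = j then d i else 0) * mat_adjoint W) $$ (i, j)
      = (\<Sum>l<n. d l * (W $$ (i, l) * cnj (W $$ (j, l))))"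
proof -
  let ?D = "mat n n (\<lambda>(i, j). if i = j then d i else (0 :: complex))"
  have D: "?D \<in> carrier_mat n n" by simp
  have WD: "W * ?D \<in> carrier_mat n n" by (rule mult_carrier_mat[OF W D])
  have WDi: "(W * ?D) $$ (i, l) = W $$ (i, l) * d l" if "l < n" for l
  proof -
    have "(W * ?D) $$ (i, l) = (\<Sum>k<n. if k = l then W $$ (i, l) * d l else 0)"
      unfolding mat_mult_index_sum[OF W D ij(1) that] using that by (intro sum.cong refl) auto
    then show ?thesis using that by simp
  qed
  show ?thesis
    unfolding mat_mult_index_sum[OF WD mat_adjoint_carrier[OF W] ij]
    using W ij by (intro sum.cong refl) (simp add: WDi del: index_mult_mat(1))
qed

lemma square_of_conjugated:
  fixes X :: "complex mat"
  assumes W: "unitary_mat n W" and X: "X \<in> carrier_mat n n"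
  shows "(W * X * mat_adjoint W) * (W * X * mat_adjoint W) = W * (X * X) * mat_adjoint W"
proof -
  have Wc: "W \<in> carrier_mat n n" and WW: "mat_adjoint W * W = 1\<^sub>m n" using W by (auto simp: unitary_mat_def)
  note W' = mat_adjoint_carrier[OF Wc]
  have cancel: "mat_adjoint W * (W * Y) = Y" if "Y \<in> carrier_mat n n" for Y
    using assoc_mult_mat[OF W' Wc that] WW left_mult_one_mat[OF that] by simp
  show ?thesis
    using Wc W' X by (simp add: assoc_mult_mat[of _ n n _ n _ n] mult_carrier_mat[of _ n n _ n] cancel)
qed

text \<open>In the eigenbasis of \<open>B\<close> the matrix \<open>A\<close> becomes \<open>\<alpha> = W D W\<^sup>*\<close>, where \<open>W\<close> is the overlap matrix.
  Since all entries of \<open>W\<close> have modulus \<open>1/2\<close>, the diagonals of \<open>\<alpha>\<close> and \<open>\<alpha>^2\<close> are averages of the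
  fourth roots of unity and of their squares, hence 0.\<close>

lemma order_four_pair_fourier:
  assumes A: "A \<in> carrier_mat 4 4" and B: "B \<in> carrier_mat 4 4"
    and spec: "proper_joint_spectrum 4 [A, B, A * B] =
           {[x, y, z] | x y z. x ^ 4 + y ^ 4 + (-1) ^ (4 - 1) * z ^ 4 = 1}"
    and e: "orthonormal_basis 4 e" "\<And>j. j < 4 \<Longrightarrow> A *\<^sub>v e j = unity_root 4 j \<cdot>\<^sub>v e j"
    and \<zeta>: "orthonormal_basis 4 \<zeta>" "\<And>j. j < 4 \<Longrightarrow> B *\<^sub>v \<zeta> j = unity_root 4 j \<cdot>\<^sub>v \<zeta> j"
    and unbiased: "\<And>i j. i < 4 \<Longrightarrow> j < 4 \<Longrightarrow> (cmod (overlap_mat 4 \<zeta> e $$ (i, j)))\<^sup>2 = 1 / 4"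
    and h: "hadamard_array 4 h" "\<And>i l. i < 4 \<Longrightarrow> l < 4 \<Longrightarrow> h i l = 2 * overlap_mat 4 \<zeta> e $$ (i, l)"
  shows "hadamard_array.fourier_rows 4 h"
proof -
  let ?W = "overlap_mat 4 \<zeta> e" and ?V = "basis_mat 4 \<zeta>" and ?\<omega> = "unity_root 4"
  interpret hadamard_array 4 h by (rule h(1))
  have Wc: "?W \<in> carrier_mat 4 4" by simp
  have WU: "unitary_mat 4 ?W" by (rule overlap_mat_unitary[OF \<zeta>(1) e(1)])
  define \<alpha> where "\<alpha> = mat_adjoint ?V * A * ?V"
  note V' = mat_adjoint_carrier[OF basis_mat_carrier[of 4 \<zeta>]]
  have \<alpha>c: "\<alpha> \<in> carrier_mat 4 4" unfolding \<alpha>_def by (rule mult_carrier_mat[OF mult_carrier_mat[OF V' A] basis_mat_carrier])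
  have dA: "mat_adjoint (basis_mat 4 e) * A * basis_mat 4 e = D_mat 4"
    by (rule eigenbasis_diagonalizes[OF A e])
  have dB: "mat_adjoint ?V * B * ?V = D_mat 4"
    by (rule eigenbasis_diagonalizes[OF B \<zeta>])
  have \<alpha>W: "\<alpha> = ?W * D_mat 4 * mat_adjoint ?W"
    using change_of_basis[OF A e(1), of \<zeta>] unfolding dA adjoint_overlap_mat \<alpha>_def .
  have D: "D_mat 4 = mat 4 4 (\<lambda>(i, j). if i = j then ?\<omega> i else 0)"
    by (intro eq_matI) (simp_all add: D_mat_index)
  have DD: "D_mat 4 * D_mat 4 = mat 4 4 (\<lambda>(i, j). if i = j then ?\<omega> i ^ 2 else 0)" (is "_ = ?D2")
  proof (rule eq_matI)
    fix i j assume "i < dim_row ?D2" "j < dim_col ?D2"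
    then have ij: "i < 4" "j < 4" by simp_all
    have "(D_mat 4 * D_mat 4) $$ (i, j) = (\<Sum>k<4. if k = i then (if i = j then ?\<omega> i ^ 2 else 0) else 0)"
      unfolding mat_mult_index_sum[OF D_mat_carrier D_mat_carrier ij] using ij
      by (intro sum.cong refl) (auto simp: D_mat_index power2_eq_square)
    then show "(D_mat 4 * D_mat 4) $$ (i, j) = ?D2 $$ (i, j)" using ij by simp
  qed simp_all
  have \<alpha>_index: "\<alpha> $$ (m, k) = (\<Sum>l<4. ?\<omega> l * (?W $$ (m, l) * cnj (?W $$ (k, l))))" if "m < 4" "k < 4" for m k
    unfolding \<alpha>W D by (rule conjugated_diagonal_index[OF Wc that])
  have WW: "?W $$ (m, l) * cnj (?W $$ (m, l)) = 1 / 4" if "m < 4" "l < 4" for m l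
  proof -
    have "?W $$ (m, l) * cnj (?W $$ (m, l)) = complex_of_real ((cmod (?W $$ (m, l)))\<^sup>2)"
      by (rule complex_norm_square[symmetric])
    then show ?thesis unfolding unbiased[OF that] by simp
  qed
  have diag1: "\<alpha> $$ (m, m) = 0" if m: "m < 4" for m
  proof -
    have "\<alpha> $$ (m, m) = (\<Sum>l<4. ?\<omega> l * (1 / 4))"
      unfolding \<alpha>_index[OF m m] using m by (intro sum.cong refl) (simp add: WW)
    then show ?thesis by (simp add: sum_lessThan_345 unity_root_four)
  qed
  have diag2: "(\<alpha> * \<alpha>) $$ (m, m) = 0" if m: "m < 4" for m
  proof -
    have "(\<alpha> * \<alpha>) $$ (m, m) = (\<Sum>l<4. ?\<omega> l ^ 2 * (?W $$ (m, l) * cnj (?W $$ (m, l))))"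
      unfolding \<alpha>W square_of_conjugated[OF WU D_mat_carrier] DD by (rule conjugated_diagonal_index[OF Wc m m])
    also have "\<dots> = (\<Sum>l<4. ?\<omega> l ^ 2 * (1 / 4))"
      using m by (intro sum.cong refl) (simp add: WW)
    finally show ?thesis by (simp add: sum_lessThan_345 unity_root_four)
  qed
  have similar: "char_poly (mat_adjoint ?V * M * ?V) = char_poly M" if M: "M \<in> carrier_mat 4 4" for M
  proof (rule char_poly_similar, rule similar_matI)
    show "mat_adjoint ?V * ?V = 1\<^sub>m 4" "?V * mat_adjoint ?V = 1\<^sub>m 4"
      using basis_mat_unitary[OF \<zeta>(1)] by (auto simp: unitary_mat_def)
    show "{mat_adjoint ?V * M * ?V, M, mat_adjoint ?V, ?V} \<subseteq> carrier_mat 4 4"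
      using M V' mult_carrier_mat[OF mult_carrier_mat[OF V' M] basis_mat_carrier[of 4 \<zeta>]] by auto
  qed (rule refl)
  have V_sum: "mat_adjoint ?V * (x \<cdot>\<^sub>m A + y \<cdot>\<^sub>m B + 0 \<cdot>\<^sub>m (A * B)) * ?V = x \<cdot>\<^sub>m \<alpha> + y \<cdot>\<^sub>m D_mat 4" for x y
  proof (rule eq_matI)
    let ?M = "x \<cdot>\<^sub>m A + y \<cdot>\<^sub>m B + 0 \<cdot>\<^sub>m (A * B)"
    fix k l assume "k < dim_row (x \<cdot>\<^sub>m \<alpha> + y \<cdot>\<^sub>m D_mat 4)" "l < dim_col (x \<cdot>\<^sub>m \<alpha> + y \<cdot>\<^sub>m D_mat 4)"
    then have kl: "k < 4" "l < 4" by simp_all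
    have \<zeta>c: "\<zeta> j \<in> carrier_vec 4" if "j < 4" for j using \<zeta>(1) that by (auto simp: orthonormal_basis_def)
    have xA: "x \<cdot>\<^sub>m A \<in> carrier_mat 4 4" and yB: "y \<cdot>\<^sub>m B \<in> carrier_mat 4 4" and AB: "A * B \<in> carrier_mat 4 4"
      using A B by simp_all
    have "(mat_adjoint ?V * ?M * ?V) $$ (k, l) = (?M *\<^sub>v \<zeta> l) \<bullet>c \<zeta> k"
      by (intro adjoint_basis_mat_mult \<zeta>c kl add_carrier_mat smult_carrier_mat AB)
    also have "\<dots> = x * ((A *\<^sub>v \<zeta> l) \<bullet>c \<zeta> k) + y * ((B *\<^sub>v \<zeta> l) \<bullet>c \<zeta> k)"
      using A B xA yB AB \<zeta>c[OF kl(1)] \<zeta>c[OF kl(2)]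
      by (simp only: form_add[of _ 4] form_smult[of _ 4] add_carrier_mat smult_carrier_mat) simp
    also have "(A *\<^sub>v \<zeta> l) \<bullet>c \<zeta> k = \<alpha> $$ (k, l)"
      unfolding \<alpha>_def by (rule adjoint_basis_mat_mult[symmetric, OF \<zeta>c A \<zeta>c kl])
    also have "(B *\<^sub>v \<zeta> l) \<bullet>c \<zeta> k = D_mat 4 $$ (k, l)"
      unfolding dB[symmetric] by (rule adjoint_basis_mat_mult[symmetric, OF \<zeta>c B \<zeta>c kl])
    finally show "(mat_adjoint ?V * ?M * ?V) $$ (k, l) = (x \<cdot>\<^sub>m \<alpha> + y \<cdot>\<^sub>m D_mat 4) $$ (k, l)"
      using kl \<alpha>c by (simp del: index_mult_mat(1))
  qed (use \<alpha>c in simp_all)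
  have power: "(x \<cdot>\<^sub>m \<alpha> + y \<cdot>\<^sub>m D_mat 4) ^\<^sub>m 4 = (x ^ 4 + y ^ 4) \<cdot>\<^sub>m 1\<^sub>m 4" if "x ^ 4 + y ^ 4 \<noteq> 0" for x y
  proof (rule pow_mat_of_char_poly)
    have "char_poly (x \<cdot>\<^sub>m A + y \<cdot>\<^sub>m B + 0 \<cdot>\<^sub>m (A * B)) = monom 1 4 - [:x ^ 4 + y ^ 4:]"
      using that by (intro char_poly_pencil[OF _ A B spec]) simp_all
    then show "char_poly (x \<cdot>\<^sub>m \<alpha> + y \<cdot>\<^sub>m D_mat 4) = monom 1 4 - [:x ^ 4 + y ^ 4:]"
      unfolding V_sum[symmetric] using A B by (subst similar) simp_all
  qed (use \<alpha>c in simp_all)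
  have one: "1 \<cdot>\<^sub>m \<alpha> = \<alpha>" by (intro eq_matI) auto
  have zero: "\<alpha> + 0 \<cdot>\<^sub>m D_mat 4 = \<alpha>" using \<alpha>c by (intro eq_matI) auto
  have "\<alpha> ^\<^sub>m 4 = 1\<^sub>m 4"
    using power[of 1 0] unfolding one zero by (auto intro!: eq_matI)
  moreover have "(\<alpha> + 1 \<cdot>\<^sub>m D_mat 4) ^\<^sub>m 4 = 2 \<cdot>\<^sub>m 1\<^sub>m 4" "(\<alpha> + (-1) \<cdot>\<^sub>m D_mat 4) ^\<^sub>m 4 = 2 \<cdot>\<^sub>m 1\<^sub>m 4"
    using power[of 1 1] power[of 1 "-1"] unfolding one by simp_all
  ultimately have cyc: "\<alpha> $$ (m, (m + 1) mod 4) * \<alpha> $$ ((m + 1) mod 4, m)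
      = \<alpha> $$ (m, (m + 3) mod 4) * \<alpha> $$ ((m + 3) mod 4, m)" if "m < 4" for m
    using order_four_cyclic[OF \<alpha>c _ _ _ diag1 diag2 that] by blast
  have pw: "phase_weight (\<lambda>l. h m l * cnj (h k l)) = 16 * (\<alpha> $$ (m, k) * \<alpha> $$ (k, m))" if mk: "m < 4" "k < 4" for m k
  proof -
    have "(\<Sum>l<4. \<i> ^ l * (h m l * cnj (h k l))) = 4 * \<alpha> $$ (m, k)"
      unfolding \<alpha>_index[OF mk] sum_distrib_left using mk
      by (intro sum.cong refl) (simp add: h(2) unity_root_four_power)
    moreover have "(\<Sum>l<4. \<i> ^ l * cnj (h m l * cnj (h k l))) = 4 * \<alpha> $$ (k, m)"
      unfolding \<alpha>_index[OF mk(2,1)] sum_distrib_left using mk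
      by (intro sum.cong refl) (simp add: h(2) unity_root_four_power)
    ultimately show ?thesis by (simp add: phase_weight_def)
  qed
  show ?thesis
  proof (rule order_four_fourier)
    fix m :: nat assume m: "m < 4"
    show "phase_weight (\<lambda>l. h m l * cnj (h ((m + 1) mod 4) l)) = phase_weight (\<lambda>l. h m l * cnj (h ((m + 3) mod 4) l))"
      using m by (subst (1 2) pw) (simp_all add: cyc[OF m, simplified])
  qed simp
qed

theorem theorem1p7:
  fixes n :: nat and A B :: "complex mat"
  assumes "n \<ge> 1"
    and "A \<in> carrier_mat n n" and "B \<in> carrier_mat n n"
    and "normal_mat A" and "operator_norm B = 1"
    and "proper_joint_spectrum n [A, B, A * B] =
           {[x, y, z] | x y z. x ^ n + y ^ n + (-1) ^ (n - 1) * z ^ n = 1}"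
  shows "(unitary_mat n A \<and> unitary_mat n B \<and>
          spectrum A = {w. w ^ n = 1} \<and> (\<forall>w\<in>spectrum A. order w (char_poly A) = 1) \<and>
          spectrum B = {w. w ^ n = 1} \<and> (\<forall>w\<in>spectrum B. order w (char_poly B) = 1)) \<and>
         (\<forall>e \<zeta>. orthonormal_basis n e \<and> orthonormal_basis n \<zeta> \<and>
            (\<forall>j<n. A *\<^sub>v e j = cis (2 * pi * real j / real n) \<cdot>\<^sub>v e j) \<and>
            (\<forall>j<n. B *\<^sub>v \<zeta> j = cis (2 * pi * real j / real n) \<cdot>\<^sub>v \<zeta> j) \<longrightarrow>
            complex_hadamard n (complex_of_real (sqrt (real n)) \<cdot>\<^sub>m transition_mat n e \<zeta>)) \<and>
         (n \<in> {3, 4, 5} \<longrightarrow>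
            (\<exists>A' B'. fourier_hadamard_pair n (A', B') \<and>
               unitarily_equivalent_pairs n (A, B) (A', B')))"
proof -
  have n: "0 < n" using assms(1) by simp
  note A = assms(2) and B = assms(3) and spec = assms(6)
  have normalA: "A * mat_adjoint A = mat_adjoint A * A" using assms(4) by (simp add: normal_mat_def)
  have "1 \<cdot>\<^sub>m A + 0 \<cdot>\<^sub>m B + 0 \<cdot>\<^sub>m (A * B) = A" "0 \<cdot>\<^sub>m A + 1 \<cdot>\<^sub>m B + 0 \<cdot>\<^sub>m (A * B) = B"
    using A B by (auto intro!: eq_matI)
  then have pA: "char_poly A = monom 1 n - [:1:]" and pB: "char_poly B = monom 1 n - [:1:]"
    using char_poly_pencil[OF n A B spec, of 1 1 0 0] char_poly_pencil[OF n A B spec, of 1 0 1 0] n by (simp_all add: power_0_left)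
  have evA: "eigenvalue A (unity_root n j)" for j
    unfolding eigenvalue_root_char_poly[OF A] pA using n by (simp add: poly_monom unity_root_power)
  have evB: "eigenvalue B (unity_root n j)" for j
    unfolding eigenvalue_root_char_poly[OF B] pB using n by (simp add: poly_monom unity_root_power)
  obtain e0 where e0: "orthonormal_basis n e0" "\<And>j. j < n \<Longrightarrow> A *\<^sub>v e0 j = unity_root n j \<cdot>\<^sub>v e0 j"
    using orthonormal_eigenbasis_exists[OF A normalA evA unity_root_inj[OF n]] by blast
  have uA: "unitary_mat n A"
    by (rule unitary_of_eigenbasis[OF A normalA e0]) simp_all
  have one: "(1 :: complex) \<cdot>\<^sub>m 1\<^sub>m n = 1\<^sub>m n" by (intro eq_matI) auto
  have uB: "unitary_mat n B"
    using pow_mat_of_char_poly[OF n B pB] assms(5) unfolding one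
    by (intro power_id_contraction_unitary[OF n B]) simp_all
  then have normalB: "B * mat_adjoint B = mat_adjoint B * B" by (simp add: unitary_mat_def)
  obtain \<zeta>0 where \<zeta>0: "orthonormal_basis n \<zeta>0" "\<And>j. j < n \<Longrightarrow> B *\<^sub>v \<zeta>0 j = unity_root n j \<cdot>\<^sub>v \<zeta>0 j"
    using orthonormal_eigenbasis_exists[OF B normalB evB unity_root_inj[OF n]] by blast
  have unbiased: "(cmod (overlap_mat n \<zeta> e $$ (i, j)))\<^sup>2 = 1 / real n"
    if "orthonormal_basis n e" "\<And>j. j < n \<Longrightarrow> A *\<^sub>v e j = unity_root n j \<cdot>\<^sub>v e j"
      "orthonormal_basis n \<zeta>" "\<And>j. j < n \<Longrightarrow> B *\<^sub>v \<zeta> j = unity_root n j \<cdot>\<^sub>v \<zeta> j" "i < n" "j < n" for e \<zeta> i j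
  proof -
    have c: "\<zeta> i \<in> carrier_vec n" "e j \<in> carrier_vec n" using that(1,3,5,6) by (auto simp: orthonormal_basis_def)
    have "overlap_mat n \<zeta> e $$ (i, j) = cnj (overlap_mat n e \<zeta> $$ (j, i))"
      unfolding overlap_mat_index[OF that(3,1,5,6)] overlap_mat_index[OF that(1,3,6,5)]
      by (rule cscalar_prod_cnj[OF c])
    then show ?thesis
      using eigenbases_unbiased[OF n A B spec normalA that(1,2,3,4,6,5)] by simp
  qed
  have hadamard: "complex_hadamard n (complex_of_real (sqrt (real n)) \<cdot>\<^sub>m transition_mat n e \<zeta>)"
    if "orthonormal_basis n e" "\<And>j. j < n \<Longrightarrow> A *\<^sub>v e j = unity_root n j \<cdot>\<^sub>v e j"
      "orthonormal_basis n \<zeta>" "\<And>j. j < n \<Longrightarrow> B *\<^sub>v \<zeta> j = unity_root n j \<cdot>\<^sub>v \<zeta> j" for e \<zeta>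
    unfolding transition_mat_eq_overlap[OF that(1,3)]
    using unbiased[OF that] by (intro scaled_unitary_hadamard overlap_mat_unitary that)
  have fourier: "\<exists>A' B'. fourier_hadamard_pair n (A', B') \<and> unitarily_equivalent_pairs n (A, B) (A', B')"
    if n345: "n \<in> {3, 4, 5}"
  proof -
    let ?W = "overlap_mat n \<zeta>0 e0"
    define c where "c = complex_of_real (sqrt (real n))"
    define H where "H = c \<cdot>\<^sub>m ?W"
    have HH: "complex_hadamard n H"
      using hadamard[OF e0 \<zeta>0] unfolding H_def c_def transition_mat_eq_overlap[OF e0(1) \<zeta>0(1)] .
    interpret hadamard_array n "\<lambda>i l. H $$ (i, l)"
      by (rule hadamard_array_of_complex_hadamard[OF n HH])
    have Hc: "H \<in> carrier_mat n n" by (simp add: H_def)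
    have fourier_rows
    proof -
      consider "n = 3" | "n = 4" | "n = 5" using n345 by auto
      then show ?thesis
      proof cases
        case 1 then show ?thesis by (rule order_three_fourier)
      next
        case 2
        have H2: "H $$ (i, l) = 2 * overlap_mat 4 \<zeta>0 e0 $$ (i, l)" if "i < 4" "l < 4" for i l
          using that 2 carrier_matD[OF overlap_mat_carrier[of 4 \<zeta>0 e0]] by (simp add: H_def c_def)
        have "hadamard_array.fourier_rows 4 (\<lambda>i l. H $$ (i, l))"
          using A B spec e0 \<zeta>0 unbiased[OF e0 \<zeta>0] hadamard_array_axioms H2 unfolding 2
          by (intro order_four_pair_fourier[of A B e0 \<zeta>0]) simp_all
        then show ?thesis using 2 by simp
      next
        case 3 then show ?thesis by (rule order_five_fourier)
      qed
    qed
    then have type: "fourier_type n H"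
      using HH hadamard_similar_of_fourier_rows[OF _ Hc] by (simp add: fourier_type_def)
    let ?E = "basis_mat n e0"
    have dB: "mat_adjoint (basis_mat n \<zeta>0) * B * basis_mat n \<zeta>0 = D_mat n"
      by (rule eigenbasis_diagonalizes[OF B \<zeta>0])
    have H': "mat_adjoint H = cnj c \<cdot>\<^sub>m mat_adjoint ?W"
      using Hc carrier_matD[OF overlap_mat_carrier[of n \<zeta>0 e0]] unfolding H_def by (intro eq_matI) auto
    have W': "mat_adjoint ?W \<in> carrier_mat n n" by (rule mat_adjoint_carrier) simp
    have WD: "mat_adjoint ?W * D_mat n \<in> carrier_mat n n" by (rule mult_carrier_mat[OF W' D_mat_carrier])
    have cc: "c * cnj c = of_nat n"
      unfolding c_def by (simp flip: of_real_mult)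
    have "mat_adjoint H * D_mat n * H = (c * cnj c) \<cdot>\<^sub>m (mat_adjoint ?W * D_mat n * ?W)"
      unfolding H' unfolding H_def mult_smult_assoc_mat[OF W' D_mat_carrier]
        mult_smult_assoc_mat[OF WD smult_carrier_mat[OF overlap_mat_carrier]] mult_smult_distrib[OF WD overlap_mat_carrier]
      by (intro eq_matI) (auto simp: mult_ac)
    then have "(1 / of_nat n) \<cdot>\<^sub>m (mat_adjoint H * D_mat n * H) = mat_adjoint ?W * D_mat n * ?W"
      using n unfolding cc by (intro eq_matI) auto
    also have "\<dots> = mat_adjoint ?E * B * ?E"
      using change_of_basis[OF B \<zeta>0(1), of e0] unfolding dB adjoint_overlap_mat by (rule sym)
    finally have B': "mat_adjoint ?E * B * ?E = (1 / of_nat n) \<cdot>\<^sub>m (mat_adjoint H * D_mat n * H)" ..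
    have "fourier_hadamard_pair n (D_mat n, mat_adjoint ?E * B * ?E)"
      unfolding fourier_hadamard_pair_def B' using type by blast
    moreover have "unitarily_equivalent_pairs n (A, B) (D_mat n, mat_adjoint ?E * B * ?E)"
      unfolding unitarily_equivalent_pairs_def
      using basis_mat_unitary[OF e0(1)] eigenbasis_diagonalizes[OF A e0] by (intro exI[of _ ?E]) simp
    ultimately show ?thesis by blast
  qed
  show ?thesis
    using uA uB spectrum_order_roots_of_unity[OF n A pA] spectrum_order_roots_of_unity[OF n B pB]
      hadamard[unfolded unity_root_def] fourier by blast
qed

end
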